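(* Assume (A1). Then $\mathcal{D}_0(y,x)$ is finite for all $y,x\in J$, $\mathcal{D}_0$ is continuous on $J^2$, and for all $y,x\in J$ there exists $\varphi_0\in C^1_*(J^2)$ with $\varphi_0\ge\mathcal{D}_0$ on $J^2$, $\varphi_0(y,x)=\mathcal{D}_0(y,x)$, and such that, writing $E=(\varphi_0-x\partial_x\varphi_0-y\partial_y\varphi_0)(y,x)$: - if $x\in J_i^*$: $E+H_i(\partial_x\varphi_0(y,x))=0$; - if $x=0$: $E+\max_{i\in I_N}H_i^-(\partial^i_x\varphi_0(y,0))=0$; - if $y\in J_j^*$: $E+H_j(-\partial_y\varphi_0(y,x))=0$; - if $y=0$: $E+\max_{j\in I_N}H_j^-(-\partial^j_y\varphi_0(0,x))=0$ when $N\ge2$, and $E+H_1(-\partial^1_y\varphi_0(0,x))=0$ when $N=1$. Moreover, for every $R>0$ there is $C_R>0$ such that, for all $x,y\in J$ with $d(y,x)\le R$, the function $\varphi_0$ associated with $(y,x)$ satisfies $|\partial_x\varphi_0(y,x)|+|\partial_y\varphi_0(y,x)|\le C_R$.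
   Context: Junction: fix an integer $N\ge1$ and $N$ distinct unit vectors $e_1,\dots,e_N\in\mathbb{R}^2$. Set $J_i=[0,\infty)e_i$, $J_i^*=J_i\setminus\{0\}$, $J=\bigcup_{i=1}^NJ_i$, $I_N=\{1,\dots,N\}$. Each $x\in J_i$ is written $x=x_ie_i$, $x_i\ge0$. $J$ carries the geodesic distance $d(x,y)=|x-y|$ if $x,y$ lie in a common branch, $d(x,y)=|x|+|y|$ otherwise. Functions on $J^2$: for $\varphi$ on $J\times J$ (variables $(y,x)$), $\varphi^{ji}$ is its restriction to $J_j\times J_i$ viewed as a function of $(y_j,x_i)\in[0,\infty)^2$; $C^1_*(J^2)$ is the set of continuous $\varphi$ with all $\varphi^{ji}\in C^1([0,\infty)^2)$. For $y\in J_j$, $x\in J_i$: $\partial_x^i\varphi(y,x)=\partial\varphi^{ji}/\partial x_i$, $\partial^j_y\varphi(y,x)=\partial\varphi^{ji}/\partial y_j$; $\partial_x\varphi(y,x)=\partial^i_x\varphi(y,x)$ if $x\in J_i^*$ and the vector $(\partial^i_x\varphi(y,0))_{i\in I_N}$ if $x=0$; similarly for $\partial_y$. Also $x\partial_x\varphi=x_i\partial^i_x\varphi$ for $x\in J_i$ and $y\partial_y\varphi=y_j\partial^j_y\varphi$ for $y\in J_j$ (both vanish at $0$). (A1): there is $\gamma>0$ with $L_i\in C^2(\mathbb{R})$, $L_i''\ge\gamma$ for each $i$; $H_i(p)=\sup_{q\in\mathbb{R}}(pq-L_i(q))$, $H_i^-(p)=\sup_{q\le0}(pq-L_i(q))$.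 Minimal action: $L_0(p)=\min_jL_j(p)$; $A(x)=\mathbb{R}e_i$ if $x\in J_i^*$, $A(0)=\bigcup_i[0,\infty)e_i$; for $P=pe_i\in A(x)$, $L(x,P)=L_i(p)$ if $x\in J_i^*$, $L(0,P)=L_0(p)$. $\mathcal{A}(0,y;1,x)$ is the set of $X\in W^{1,1}([0,1];\mathbb{R}^2)$ with $X(\tau)\in J$, $\dot X(\tau)\in A(X(\tau))$ a.e., $X(0)=y$, $X(1)=x$. The reduced minimal action is $\mathcal{D}_0(y,x)=\inf_{X\in\mathcal{A}(0,y;1,x)}\int_0^1L(X(\tau),\dot X(\tau))\,d\tau$. *)

theory Defs
  imports "HOL-Analysis.Analysis"
begin

text \<open>The junction in R^2 (type real^2): N distinct unit vectors e 1, ..., e N.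
  Indices are I_N = {1..N}.\<close>

definition branch :: "(nat \<Rightarrow> real^2) \<Rightarrow> nat \<Rightarrow> (real^2) set" where
  "branch e i = {t *\<^sub>R e i | t. t \<ge> 0}"

definition junction :: "nat \<Rightarrow> (nat \<Rightarrow> real^2) \<Rightarrow> (real^2) set" where
  "junction N e = (\<Union>i\<in>{1..N}. branch e i)"

definition gdist :: "nat \<Rightarrow> (nat \<Rightarrow> real^2) \<Rightarrow> real^2 \<Rightarrow> real^2 \<Rightarrow> real" where
  "gdist N e y x = (if \<exists>i\<in>{1..N}. y \<in> branch e i \<and> x \<in> branch e i
                    then norm (y - x) else norm y + norm x)"

text \<open>The (unique, for x nonzero) branch index of a point of the junction.\<close>
definition brix :: "nat \<Rightarrow> (nat \<Rightarrow> real^2) \<Rightarrow> real^2 \<Rightarrow> nat" where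
  "brix N e x = (THE i. i \<in> {1..N} \<and> x \<in> branch e i)"

definition C2_unif_convex :: "(real \<Rightarrow> real) \<Rightarrow> real \<Rightarrow> bool" where
  "C2_unif_convex f \<gamma> = (\<exists>D1 D2. (\<forall>q. (f has_real_derivative D1 q) (at q)) \<and>
      (\<forall>q. (D1 has_real_derivative D2 q) (at q)) \<and> continuous_on UNIV D2 \<and>
      (\<forall>q. D2 q \<ge> \<gamma>))"

definition Ham :: "(nat \<Rightarrow> real \<Rightarrow> real) \<Rightarrow> nat \<Rightarrow> real \<Rightarrow> real" where
  "Ham L i p = (SUP q. p * q - L i q)"

definition Ham_minus :: "(nat \<Rightarrow> real \<Rightarrow> real) \<Rightarrow> nat \<Rightarrow> real \<Rightarrow> real" where
  "Ham_minus L i p = (SUP q\<in>{..0}. p * q - L i q)"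

definition L0 :: "nat \<Rightarrow> (nat \<Rightarrow> real \<Rightarrow> real) \<Rightarrow> real \<Rightarrow> real" where
  "L0 N L p = Min ((\<lambda>j. L j p) ` {1..N})"

text \<open>The admissible velocity set A(x) and the Lagrangian L(x,P) on it
  (for P = p e_i: p = P . e_i on a branch, p = |P| at the junction point).\<close>
definition adm_dir :: "nat \<Rightarrow> (nat \<Rightarrow> real^2) \<Rightarrow> real^2 \<Rightarrow> real^2 \<Rightarrow> bool" where
  "adm_dir N e x P = (if x = 0 then (\<exists>i\<in>{1..N}. \<exists>p\<ge>0. P = p *\<^sub>R e i)
                      else (\<exists>p. P = p *\<^sub>R e (brix N e x)))"

definition lag :: "nat \<Rightarrow> (nat \<Rightarrow> real^2) \<Rightarrow> (nat \<Rightarrow> real \<Rightarrow> real) \<Rightarrow> real^2 \<Rightarrow> real^2 \<Rightarrow> real" where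
  "lag N e L x P = (if x = 0 then L0 N L (norm P)
                    else L (brix N e x) (P \<bullet> e (brix N e x)))"

definition W11 :: "(real \<Rightarrow> real^2) \<Rightarrow> (real \<Rightarrow> real^2) \<Rightarrow> bool" where
  "W11 X g = (g absolutely_integrable_on {0..1} \<and>
              (\<forall>t\<in>{0..1}. X t = X 0 + integral {0..t} g))"

definition admissible :: "nat \<Rightarrow> (nat \<Rightarrow> real^2) \<Rightarrow> real^2 \<Rightarrow> real^2 \<Rightarrow>
    (real \<Rightarrow> real^2) \<Rightarrow> (real \<Rightarrow> real^2) \<Rightarrow> bool" where
  "admissible N e y x X g = (W11 X g \<and> (\<forall>\<tau>\<in>{0..1}. X \<tau> \<in> junction N e) \<and>
      (AE \<tau> in lebesgue_on {0..1}. adm_dir N e (X \<tau>) (g \<tau>)) \<and> X 0 = y \<and> X 1 = x)"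

text \<open>Action (the integrand is bounded below, so a non-integrable integrand has action +infinity).\<close>
definition action :: "nat \<Rightarrow> (nat \<Rightarrow> real^2) \<Rightarrow> (nat \<Rightarrow> real \<Rightarrow> real) \<Rightarrow>
    (real \<Rightarrow> real^2) \<Rightarrow> (real \<Rightarrow> real^2) \<Rightarrow> ereal" where
  "action N e L X g =
     (if integrable (lebesgue_on {0..1}) (\<lambda>\<tau>. lag N e L (X \<tau>) (g \<tau>))
      then ereal (integral\<^sup>L (lebesgue_on {0..1}) (\<lambda>\<tau>. lag N e L (X \<tau>) (g \<tau>)))
      else \<infinity>)"

definition D0 :: "nat \<Rightarrow> (nat \<Rightarrow> real^2) \<Rightarrow> (nat \<Rightarrow> real \<Rightarrow> real) \<Rightarrow> real^2 \<Rightarrow> real^2 \<Rightarrow> ereal" where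
  "D0 N e L y x = Inf {action N e L X g | X g. admissible N e y x X g}"

definition quadrant :: "(real \<times> real) set" where
  "quadrant = {p. fst p \<ge> 0 \<and> snd p \<ge> 0}"

definition C1_quad :: "(real \<times> real \<Rightarrow> real) \<Rightarrow> bool" where
  "C1_quad f = (\<exists>gs gt. continuous_on quadrant gs \<and> continuous_on quadrant gt \<and>
      (\<forall>p\<in>quadrant. (f has_derivative (\<lambda>h. gs p * fst h + gt p * snd h)) (at p within quadrant)))"

definition C1_star :: "nat \<Rightarrow> (nat \<Rightarrow> real^2) \<Rightarrow> (real^2 \<Rightarrow> real^2 \<Rightarrow> real) \<Rightarrow> bool" where
  "C1_star N e \<phi> = (continuous_on (junction N e \<times> junction N e) (\<lambda>z. \<phi> (fst z) (snd z)) \<and>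
      (\<forall>i\<in>{1..N}. \<forall>j\<in>{1..N}. C1_quad (\<lambda>z. \<phi> (fst z *\<^sub>R e j) (snd z *\<^sub>R e i))))"

text \<open>Partial derivatives: pdx phi y x i = d^i_x phi(y,x) for x in J_i;
  pdy phi y x j = d^j_y phi(y,x) for y in J_j.\<close>
definition pdx :: "(nat \<Rightarrow> real^2) \<Rightarrow> (real^2 \<Rightarrow> real^2 \<Rightarrow> real) \<Rightarrow> real^2 \<Rightarrow> real^2 \<Rightarrow> nat \<Rightarrow> real" where
  "pdx e \<phi> y x i = (THE D. ((\<lambda>t. \<phi> y (t *\<^sub>R e i)) has_real_derivative D) (at (norm x) within {0..}))"

definition pdy :: "(nat \<Rightarrow> real^2) \<Rightarrow> (real^2 \<Rightarrow> real^2 \<Rightarrow> real) \<Rightarrow> real^2 \<Rightarrow> real^2 \<Rightarrow> nat \<Rightarrow> real" where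
  "pdy e \<phi> y x j = (THE D. ((\<lambda>s. \<phi> (s *\<^sub>R e j) x) has_real_derivative D) (at (norm y) within {0..}))"

definition Eterm :: "(nat \<Rightarrow> real^2) \<Rightarrow> (real^2 \<Rightarrow> real^2 \<Rightarrow> real) \<Rightarrow> real^2 \<Rightarrow> real^2 \<Rightarrow> nat \<Rightarrow> nat \<Rightarrow> real" where
  "Eterm e \<phi> y x i j = \<phi> y x - norm x * pdx e \<phi> y x i - norm y * pdy e \<phi> y x j"

definition abs_dx :: "nat \<Rightarrow> (nat \<Rightarrow> real^2) \<Rightarrow> (real^2 \<Rightarrow> real^2 \<Rightarrow> real) \<Rightarrow> real^2 \<Rightarrow> real^2 \<Rightarrow> nat \<Rightarrow> real" where
  "abs_dx N e \<phi> y x i = (if x = 0 then sqrt (\<Sum>k\<in>{1..N}. (pdx e \<phi> y 0 k)\<^sup>2)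
                          else \<bar>pdx e \<phi> y x i\<bar>)"

definition abs_dy :: "nat \<Rightarrow> (nat \<Rightarrow> real^2) \<Rightarrow> (real^2 \<Rightarrow> real^2 \<Rightarrow> real) \<Rightarrow> real^2 \<Rightarrow> real^2 \<Rightarrow> nat \<Rightarrow> real" where
  "abs_dy N e \<phi> y x j = (if y = 0 then sqrt (\<Sum>k\<in>{1..N}. (pdy e \<phi> 0 x k)\<^sup>2)
                          else \<bar>pdy e \<phi> y x j\<bar>)"

end

theory Submission
  imports Defs
begin

text \<open>
  Jensen's inequality reduces the minimal action to two kinds of competitors: the straight path
  inside a branch, and the route that reaches the junction point in time \<open>t1\<close>, waits there at cost
  \<open>L0 N L 0\<close> per unit of time, and leaves it to arrive in time \<open>t2\<close>. Lower bounds come from tangents to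
  the Lagrangians, and match the cost of the best route because the marginal costs of time of both
  legs agree with each other (and with the cost of waiting, if there is any waiting).

  Upper bounds near a base point come from perturbing the optimal competitor. Where an endpoint is
  the junction point, the time needed by the new short leg is bought from the other leg at the
  marginal price \<open>\<mu>\<close>; this produces slopes at which the Hamiltonians equal \<open>- \<mu>\<close>, and \<open>\<mu>\<close> is also the
  value of the zeroth-order term of the equation. The expansions have an error of order \<open>4/3\<close>, so
  a separable function of class \<open>C\<^sup>1\<close> on every branch with these slopes touches the minimal action from above.
\<close>

section \<open>Uniformly convex functions\<close>

text \<open>Two features shape the proof. The times at which a path sits at the junction point may
  form a complicated closed set, so a path need not split into finitely many pieces; excursions are
  summed by countable additivity, and the velocity must be shown to vanish almost everywhere on that
  set before waiting can be charged at \<open>l0\<close>. The equations at the junction point are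
  not symmetric in \<open>y\<close> and \<open>x\<close>. A point \<open>y\<close> near 0 is brought
  to 0 at a speed \<open>q <= 0\<close>, where \<open>Ham\<close> and \<open>Ham_minus\<close>
  agree, so one choice of speeds with \<open>K k q = \<mu>\<close> serves \<open>N = 1\<close> and
  \<open>N >= 2\<close>. A point \<open>x\<close> near 0 is reached at a speed
  \<open>q >= 0\<close>, where \<open>Ham_minus\<close> is stuck at \<open>- L k 0\<close>; the
  maximum is then \<open>- l0\<close>, which is right only if \<open>\<mu> = l0\<close>. If
  \<open>\<mu> < l0\<close> and \<open>x = 0\<close>, no time is left for waiting, the route is the
  straight path from \<open>y\<close>, and perturbing it inside its branch supplies the one slope
  with value \<open>- \<mu>\<close>. Finally, points of one branch may be close together but far
  from 0; gradients stay bounded because a route through 0 then loses to the straight path.\<close>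

locale unif_convex =
  fixes f f' f'' :: "real \<Rightarrow> real" and \<gamma> :: real
  assumes gamma_pos: "\<gamma> > 0"
    and deriv1: "\<And>q. (f has_real_derivative f' q) (at q)"
    and deriv2: "\<And>q. (f' has_real_derivative f'' q) (at q)"
    and cont2: "continuous_on UNIV f''"
    and lower2: "\<And>q. f'' q \<ge> \<gamma>"
begin

text \<open>The value at \<open>0\<close> of the tangent to \<open>f\<close> at \<open>q\<close>, that is, minus the Legendre transform at \<open>f' q\<close>.
  Since \<open>K (v / t)\<close> is the derivative in \<open>t\<close> of \<open>t * f (v / t)\<close>, it is the marginal cost of travel time.\<close>

definition K :: "real \<Rightarrow> real" where "K q = f q - q * f' q"

lemma cont0: "continuous_on S f"
  by (meson DERIV_isCont continuous_at_imp_continuous_on deriv1)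

lemma cont1: "continuous_on S f'"
  by (meson DERIV_isCont continuous_at_imp_continuous_on deriv2)

lemma contK: "continuous_on S K"
  unfolding K_def by (intro continuous_intros cont0 cont1)

lemma taylor: "\<exists>\<xi>. (\<xi> \<in> closed_segment q u) \<and> f u = f q + f' q * (u - q) + f'' \<xi> / 2 * (u - q)\<^sup>2"
proof (cases "u = q")
  case False
  define diff where "diff = (\<lambda>m::nat. if m = 0 then f else if m = 1 then f' else f'')"
  have D: "\<forall>m t. m < 2 \<and> min q u \<le> t \<and> t \<le> max q u \<longrightarrow> DERIV (diff m) t :> diff (Suc m) t"
    by (auto simp: diff_def deriv1 deriv2 less_2_cases_iff)
  have "\<exists>t. (if u < q then u < t \<and> t < q else q < t \<and> t < u) \<and>
       f u = (\<Sum>m<2. (diff m q / fact m) * (u - q) ^ m) + (diff 2 t / fact 2) * (u - q) ^ 2"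
    by (rule Taylor[where a="min q u" and b="max q u"]) (use D False in \<open>auto simp: diff_def\<close>)
  then obtain t where t: "if u < q then u < t \<and> t < q else q < t \<and> t < u"
     "f u = (\<Sum>m<2. (diff m q / fact m) * (u - q) ^ m) + (diff 2 t / fact 2) * (u - q) ^ 2" by blast
  have "t \<in> closed_segment q u"
    using t(1) by (auto simp: closed_segment_eq_real_ivl split: if_splits)
  moreover have "f u = f q + f' q * (u - q) + f'' t / 2 * (u - q)\<^sup>2"
    using t(2) by (simp add: diff_def lessThan_Suc numeral_2_eq_2)
  ultimately show ?thesis by blast
qed auto

lemma strong_tangent: "f u \<ge> f q + f' q * (u - q) + \<gamma> / 2 * (u - q)\<^sup>2"
proof -
  obtain \<xi> where "f u = f q + f' q * (u - q) + f'' \<xi> / 2 * (u - q)\<^sup>2" using taylor by blast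
  moreover have "\<gamma> / 2 * (u - q)\<^sup>2 \<le> f'' \<xi> / 2 * (u - q)\<^sup>2"
    by (intro mult_right_mono) (use lower2[of \<xi>] in auto)
  ultimately show ?thesis by simp
qed

lemma tangent: "f v \<ge> K q + f' q * v"
proof -
  have "\<gamma> / 2 * (v - q)\<^sup>2 \<ge> 0" using gamma_pos by simp
  with strong_tangent[of q v] show ?thesis by (simp add: K_def algebra_simps)
qed

text \<open>The strong tangent at \<open>q\<close>, evaluated at 0. The quadratic decay makes
  \<open>K (v / t)\<close> tend to minus infinity as \<open>t\<close> tends to 0, which yields the
  existence of travel times; it also turns lower bounds on \<open>K\<close> into bounds on
  speeds.\<close>

lemma K_upper: "K q \<le> f 0 - \<gamma> / 2 * q\<^sup>2"
  using strong_tangent[of q 0] by (simp add: K_def algebra_simps)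

lemma K_0 [simp]: "K 0 = f 0" by (simp add: K_def)

text \<open>The second derivative is bounded only from below by assumption, so a quadratic upper
  bound is available only on bounded ranges, with a constant depending on \<open>B\<close>.\<close>

lemma taylor_upper:
  obtains C where "C \<ge> 0" "\<And>u q. \<bar>u\<bar> \<le> B \<Longrightarrow> \<bar>q\<bar> \<le> B \<Longrightarrow> f u \<le> f q + f' q * (u - q) + C * (u - q)\<^sup>2"
proof -
  have "compact (f'' ` {-B..B})"
    by (intro compact_continuous_image continuous_on_subset[OF cont2]) auto
  then obtain C where C: "\<And>\<xi>. \<xi> \<in> {-B..B} \<Longrightarrow> \<bar>f'' \<xi>\<bar> \<le> C"
    by (metis (no_types, lifting) bounded_iff compact_imp_bounded image_eqI real_norm_def)
  show ?thesis
  proof (rule that[of "\<bar>C\<bar> / 2"])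
    fix u q assume uq: "\<bar>u\<bar> \<le> B" "\<bar>q\<bar> \<le> B"
    obtain \<xi> where x: "\<xi> \<in> closed_segment q u" "f u = f q + f' q * (u - q) + f'' \<xi> / 2 * (u - q)\<^sup>2"
      using taylor by blast
    have "\<xi> \<in> {-B..B}" using x(1) uq by (auto simp: closed_segment_eq_real_ivl split: if_splits)
    from C[OF this] have "f'' \<xi> / 2 \<le> \<bar>C\<bar> / 2" by linarith
    then have "f'' \<xi> / 2 * (u - q)\<^sup>2 \<le> \<bar>C\<bar> / 2 * (u - q)\<^sup>2"
      by (intro mult_right_mono) auto
    with x(2) show "f u \<le> f q + f' q * (u - q) + \<bar>C\<bar> / 2 * (u - q)\<^sup>2" by simp
  qed simp
qed

text \<open>The tangent inequality at \<open>q\<close> bounds the supremum, and \<open>q\<close>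
  itself attains it. The set is kept general to cover both \<open>Ham\<close> (all speeds) and
  \<open>Ham_minus\<close> (speeds in \<open>{..0}\<close>).\<close>

lemma sup_tangent:
  assumes "q \<in> S"
  shows "(SUP u\<in>S. f' q * u - f u) = - K q"
proof (rule cSup_eq_maximum)
  show "- K q \<in> (\<lambda>u. f' q * u - f u) ` S" using assms by (force simp: K_def)
  show "\<And>z. z \<in> (\<lambda>u. f' q * u - f u) ` S \<Longrightarrow> z \<le> - K q"
    using tangent[of q] by (auto simp: algebra_simps)
qed

text \<open>For so large a slope the maximum over nonpositive speeds sits at the end
  \<open>u = 0\<close>. On these slopes the one-sided Hamiltonian is constant.\<close>

lemma sup_nonpos_steep:
  assumes "p \<ge> f' 0"
  shows "(SUP u\<in>{..0}. p * u - f u) = - f 0"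
proof (rule cSup_eq_maximum)
  show "- f 0 \<in> (\<lambda>u. p * u - f u) ` {..0}" by force
  fix z assume "z \<in> (\<lambda>u. p * u - f u) ` {..0}"
  then obtain u where u: "u \<le> 0" "z = p * u - f u" by auto
  have "p * u \<le> f' 0 * u" using assms u by (simp add: mult_right_mono_neg)
  then show "z \<le> - f 0" using u tangent[of 0 u] by simp
qed

text \<open>Intermediate values: shortening the time pushes the marginal cost below any level, by
  \<open>K_upper\<close>.\<close>

lemma K_level:
  assumes "v \<noteq> 0" "t0 > 0" "K (v / t0) \<ge> \<mu>"
  obtains t where "0 < t" "t \<le> t0" "K (v / t) = \<mu>"
proof -
  \<comment> \<open>The quotient makes \<open>\<gamma> / 2 * v\<^sup>2 / d\<close> at least
    \<open>\<bar>f 0 - \<mu>\<bar> + 1\<close>; the cap 1 gives \<open>d\<^sup>2 <= d\<close>, so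
    the same holds with \<open>d\<^sup>2\<close> in the denominator.\<close>
  define d where "d = min t0 (min 1 (\<gamma> / 2 * v\<^sup>2 / (\<bar>f 0 - \<mu>\<bar> + 1)))"
  have "\<gamma> / 2 * v\<^sup>2 / (\<bar>f 0 - \<mu>\<bar> + 1) > 0"
    using assms gamma_pos by (intro divide_pos_pos mult_pos_pos) auto
  then have d: "d > 0" "d \<le> t0" "d \<le> 1" "d \<le> \<gamma> / 2 * v\<^sup>2 / (\<bar>f 0 - \<mu>\<bar> + 1)"
    using assms gamma_pos unfolding d_def by (auto simp: min_def)
  have "d * (\<bar>f 0 - \<mu>\<bar> + 1) \<le> \<gamma> / 2 * v\<^sup>2"
    using d(4) by (subst (asm) pos_le_divide_eq) auto
  then have "\<bar>f 0 - \<mu>\<bar> + 1 \<le> \<gamma> / 2 * v\<^sup>2 / d"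
    using d(1) by (subst pos_le_divide_eq) (auto simp: mult.commute)
  also have "\<dots> \<le> \<gamma> / 2 * (v / d)\<^sup>2"
  proof -
    have "d\<^sup>2 \<le> d" using d by (simp add: power2_eq_square mult_left_le)
    then have "\<gamma> / 2 * v\<^sup>2 / d \<le> \<gamma> / 2 * v\<^sup>2 / d\<^sup>2"
      using d gamma_pos by (intro divide_left_mono) auto
    then show ?thesis by (simp add: power_divide)
  qed
  finally have low: "K (v / d) \<le> \<mu>" using K_upper[of "v/d"] by linarith
  have "\<exists>t\<ge>d. t \<le> t0 \<and> K (v / t) = \<mu>"
    by (rule IVT') (use low assms d in \<open>auto intro!: continuous_on_compose2[OF contK] continuous_intros\<close>)
  then obtain t where "d \<le> t" "t \<le> t0" "K (v / t) = \<mu>" by auto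
  with that[of t] d show thesis by linarith
qed

end

text \<open>The difference of the two marginal costs changes sign on the unit interval: as either
  leg loses its time its own \<open>K\<close> drops without bound, while that of the other leg stays
  bounded.\<close>

lemma split_level:
  assumes "unif_convex f f' f'' \<gamma>" "unif_convex g g' g'' \<delta>" "v \<noteq> 0" "w \<noteq> 0"
  obtains t where "0 < t" "t < 1" "unif_convex.K f f' (v / t) = unif_convex.K g g' (w / (1 - t))"
proof -
  interpret f: unif_convex f f' f'' \<gamma> by fact
  interpret g: unif_convex g g' g'' \<delta> by fact
  \<comment> \<open>The leg that keeps at least half of the time has a marginal cost bounded
    below.\<close>
  have bd: "\<exists>c. \<forall>t\<in>{1/2..1}. - c \<le> unif_convex.K h h' (u / t)"
    if "unif_convex h h' h'' \<eta>" for h h' h'' \<eta> u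
  proof -
    interpret h: unif_convex h h' h'' \<eta> by fact
    have "compact ((\<lambda>t. h.K (u / t)) ` {1/2..1})"
      by (intro compact_continuous_image continuous_on_compose2[OF h.contK[of UNIV]] continuous_intros) auto
    then obtain c where "\<forall>t\<in>{1/2..1}. \<bar>h.K (u / t)\<bar> \<le> c"
      by (metis (no_types, lifting) bounded_iff compact_imp_bounded image_eqI real_norm_def)
    then show ?thesis by (intro exI[of _ c]) (auto simp: abs_le_iff)
  qed
  obtain cf where cf: "\<forall>t\<in>{1/2..1}. - cf \<le> f.K (v / t)" using bd[OF f.unif_convex_axioms] by blast
  obtain cg where cg: "\<forall>t\<in>{1/2..1}. - cg \<le> g.K (w / t)" using bd[OF g.unif_convex_axioms] by blast
  \<comment> \<open>The target of interest is \<open>- cg\<close>; the minimum only ensures that it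
    does not exceed the value at time 1/2, as \<open>K_level\<close> demands.\<close>
  obtain a where a: "0 < a" "a \<le> 1/2" "f.K (v / a) = min (- cg) (f.K (v / (1/2)))"
    by (rule f.K_level[of v "1/2" "min (- cg) (f.K (v / (1/2)))"]) (use assms in auto)
  obtain b where b: "0 < b" "b \<le> 1/2" "g.K (w / b) = min (- cf) (g.K (w / (1/2)))"
    by (rule g.K_level[of w "1/2" "min (- cf) (g.K (w / (1/2)))"]) (use assms in auto)
  have "f.K (v / a) \<le> g.K (w / (1 - a))" using a cg[rule_format, of "1 - a"] by auto
  moreover have "g.K (w / b) \<le> f.K (v / (1 - b))" using b cf[rule_format, of "1 - b"] by auto
  ultimately have "\<exists>t\<ge>a. t \<le> 1 - b \<and> f.K (v / t) - g.K (w / (1 - t)) = 0"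
    using a b by (intro IVT') (auto intro!: continuous_intros continuous_on_compose2[OF f.contK[of UNIV]]
       continuous_on_compose2[OF g.contK[of UNIV]])
  then obtain t where "a \<le> t" "t \<le> 1 - b" "f.K (v / t) = g.K (w / (1 - t))" by auto
  with that[of t] a b show thesis by linarith
qed

section \<open>Paths on the junction\<close>

lemma open_component_real:
  fixes U :: "real set"
  assumes "open U" "bounded U" "C \<in> components U"
  obtains a b where "a < b" "C = {a<..<b}" "a \<notin> U" "b \<notin> U"
proof -
  have C: "open C" "connected C" "C \<noteq> {}" "C \<subseteq> U"
    using open_components[OF assms(1,3)] in_components_connected[OF assms(3)]
      in_components_nonempty[OF assms(3)] in_components_subset[OF assms(3)] by auto
  have bd: "bdd_above C" "bdd_below C"
    by (rule bounded_imp_bdd_above[OF bounded_subset[OF assms(2) C(4)]],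
        rule bounded_imp_bdd_below[OF bounded_subset[OF assms(2) C(4)]])
  define a b where "a = Inf C" and "b = Sup C"
  have in_ab: "a < x" "x < b" if xC: "x \<in> C" for x
  proof -
    obtain r where "r > 0" "ball x r \<subseteq> C" by (rule openE[OF C(1) xC])
    moreover have "x - r/2 \<in> ball x r" "x + r/2 \<in> ball x r"
      using \<open>r > 0\<close> by (simp_all add: dist_real_def)
    ultimately have "x - r/2 \<in> C" "x + r/2 \<in> C" by auto
    then show "a < x" "x < b" using \<open>r > 0\<close> bd cInf_lower[of "x - r/2" C] cSup_upper[of "x + r/2" C]
      unfolding a_def b_def by linarith+
  qed
  have sub: "{a<..<b} \<subseteq> C"
  proof
    fix x assume x: "x \<in> {a<..<b}"
    obtain c where "c \<in> C" "c < x" using x C(3) bd cInf_less_iff[of C x] unfolding a_def by auto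
    moreover obtain d where "d \<in> C" "x < d" using x C(3) bd less_cSup_iff[of C x] unfolding b_def by auto
    ultimately show "x \<in> C" using C(2) connected_contains_Icc[of C c d] by force
  qed
  have eq: "C = {a<..<b}" using sub in_ab by auto
  have ab: "a < b" using C(3) eq by force
  have maxim: "D = C" if "C \<subseteq> D" "D \<subseteq> U" "connected D" for D
    using components_maximal[OF assms(3) that(3) that(2)] C(3) that(1) by blast
  have "a \<notin> U"
  proof
    assume "a \<in> U"
    then have "{a..<b} \<subseteq> U" using eq C(4) ab by (force simp: less_le)
    then have "{a..<b} = C" by (intro maxim) (auto simp: eq)
    then show False using ab eq by force
  qed
  moreover have "b \<notin> U"
  proof
    assume "b \<in> U"
    then have "{a<..b} \<subseteq> U" using eq C(4) ab by (force simp: less_le)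
    then have "{a<..b} = C" by (intro maxim) (auto simp: eq)
    then show False using ab eq by force
  qed
  ultimately show thesis using that ab eq by blast
qed

text \<open>An open set of times may have infinitely many components, as when a path returns to 0
  infinitely often. They are countable and disjoint, so the integral is a countable sum, and only
  the intervals whose ends lie outside \<open>U\<close> have to be treated.\<close>

lemma integral_eq_0_by_components:
  fixes g :: "real \<Rightarrow> 'b::euclidean_space"
  assumes U: "open U" "bounded U" and g: "g absolutely_integrable_on U"
    and zero: "\<And>a b. a < b \<Longrightarrow> {a<..<b} \<subseteq> U \<Longrightarrow> a \<notin> U \<Longrightarrow> b \<notin> U \<Longrightarrow> integral {a<..<b} g = 0"
  shows "integral U g = 0"
proof -
  define CC where "CC = components U"
  have cnt: "countable CC"
    unfolding CC_def
    by (rule countable_disjoint_open_subsets)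
       (use U(1) open_components pairwise_disjoint_components[of U] in \<open>auto simp: disjnt_def pairwise_def\<close>)
  \<comment> \<open>An enumeration by all natural numbers, padded with the empty set at numbers that
    are no code of a component.\<close>
  define A where "A = (\<lambda>n. if n \<in> to_nat_on CC ` CC then from_nat_into CC n else {})"
  have A_in: "A n = {} \<or> A n \<in> CC" for n
    unfolding A_def using cnt by auto
  have open_A: "open (A n)" for n
    using A_in[of n] U open_components unfolding CC_def by auto
  have U_eq: "U = (\<Union>n. A n)"
  proof
    have "(\<Union>n. A n) \<subseteq> U"
      using A_in in_components_subset unfolding CC_def by blast
    then show "(\<Union>n. A n) \<subseteq> U" .
    show "U \<subseteq> (\<Union>n. A n)"
    proof
      fix x assume "x \<in> U"
      then obtain C where C: "C \<in> CC" "x \<in> C"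
        using Union_components[of U] unfolding CC_def by blast
      then have "A (to_nat_on CC C) = C" using cnt by (auto simp: A_def)
      then show "x \<in> (\<Union>n. A n)" using C by blast
    qed
  qed
  have disj: "A m \<inter> A n = {}" if "m \<noteq> n" for m n
  proof (rule ccontr)
    assume ne: "A m \<inter> A n \<noteq> {}"
    then have mn: "m \<in> to_nat_on CC ` CC" "n \<in> to_nat_on CC ` CC" "A m \<in> CC" "A n \<in> CC"
      using A_in[of m] A_in[of n] unfolding A_def by (auto split: if_splits)
    then have "A m = A n"
      using ne components_nonoverlap[of "A m" U "A n"] unfolding CC_def by blast
    then show False
      using mn that cnt unfolding A_def by (auto split: if_splits)
  qed
  have int0: "(LINT x:A n|lebesgue. g x) = 0" for n
  proof (cases "A n = {}")
    case False
    then have "A n \<in> components U" using A_in CC_def by blast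
    then obtain a b where ab: "a < b" "A n = {a<..<b}" "a \<notin> U" "b \<notin> U"
      using open_component_real U by metis
    have "set_integrable lebesgue (A n) g"
      by (rule set_integrable_subset[OF g]) (use U_eq open_A in auto)
    then have "(LINT x:A n|lebesgue. g x) = integral (A n) g"
      by (rule set_lebesgue_integral_eq_integral)
    moreover have "{a<..<b} \<subseteq> U" using ab(2) U_eq by blast
    then have "integral (A n) g = 0" using zero[OF ab(1) _ ab(3,4)] ab(2) by simp
    ultimately show ?thesis by simp
  qed (simp add: set_lebesgue_integral_def)
  have "(LINT x:(\<Union>n. A n)|lebesgue. g x) = (\<Sum>n. (LINT x:A n|lebesgue. g x))"
    by (rule lebesgue_integral_countable_add) (use disj open_A g in \<open>auto simp: U_eq[symmetric]\<close>)
  then show ?thesis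
    using int0 set_lebesgue_integral_eq_integral(2)[OF g] U_eq[symmetric] by simp
qed

lemma absolutely_integrable_restrict:
  fixes g :: "real \<Rightarrow> 'b::euclidean_space"
  assumes "g absolutely_integrable_on (S \<inter> T)"
  shows "(\<lambda>x. if x \<in> T then g x else 0) absolutely_integrable_on S"
proof -
  have "(\<lambda>x. indicator S x *\<^sub>R (if x \<in> T then g x else 0)) = (\<lambda>x. indicator (S \<inter> T) x *\<^sub>R g x)"
    by (auto simp: indicator_def)
  then show ?thesis using assms unfolding set_integrable_def by simp
qed

section \<open>Geometry of the junction\<close>

locale star_junction =
  fixes N :: nat and e :: "nat \<Rightarrow> real^2"
  assumes N1: "N \<ge> 1"
    and e_distinct: "inj_on e {1..N}"
    and e_unit: "\<And>i. i \<in> {1..N} \<Longrightarrow> norm (e i) = 1"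
begin

abbreviation "J \<equiv> junction N e"

lemma e_inner [simp]: "i \<in> {1..N} \<Longrightarrow> e i \<bullet> e i = 1"
  using e_unit by (simp add: dot_square_norm)

lemma e_nonzero: "i \<in> {1..N} \<Longrightarrow> e i \<noteq> 0" using e_unit by force

lemma norm_scaled [simp]: "i \<in> {1..N} \<Longrightarrow> norm (t *\<^sub>R e i) = \<bar>t\<bar>"
  using e_unit by simp

lemma branch_iff: "i \<in> {1..N} \<Longrightarrow> x \<in> branch e i \<longleftrightarrow> x = norm x *\<^sub>R e i"
  unfolding branch_def using norm_scaled[of i] by auto

lemma scaled_in_branch: "t \<ge> 0 \<Longrightarrow> t *\<^sub>R e i \<in> branch e i"
  unfolding branch_def by force

lemma branch_subset_J: "i \<in> {1..N} \<Longrightarrow> branch e i \<subseteq> J"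
  unfolding junction_def by blast

lemma scaled_in_J: "i \<in> {1..N} \<Longrightarrow> t \<ge> 0 \<Longrightarrow> t *\<^sub>R e i \<in> J"
  using branch_subset_J scaled_in_branch by blast

lemma J_cases:
  assumes "x \<in> J"
  obtains i where "i \<in> {1..N}" "x \<in> branch e i" "x = norm x *\<^sub>R e i"
  using assms branch_iff unfolding junction_def by blast

lemma branch_unique:
  assumes "i \<in> {1..N}" "k \<in> {1..N}" "x \<in> branch e i" "x \<in> branch e k" "x \<noteq> 0"
  shows "i = k"
proof -
  have "norm x *\<^sub>R e i = norm x *\<^sub>R e k"
    using branch_iff[OF assms(1)] branch_iff[OF assms(2)] assms(3,4) by metis
  then have "e i = e k" using assms(5) by simp
  then show ?thesis using inj_onD[OF e_distinct _ assms(1,2)] by blast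
qed

lemma brix_eq: "i \<in> {1..N} \<Longrightarrow> x \<in> branch e i \<Longrightarrow> x \<noteq> 0 \<Longrightarrow> brix N e x = i"
  unfolding brix_def using branch_unique[of _ i x] by (intro the_equality) blast+

lemma closed_branch: "i \<in> {1..N} \<Longrightarrow> closed (branch e i)"
proof -
  assume i: "i \<in> {1..N}"
  then have "branch e i = {x. x = norm x *\<^sub>R e i}" using branch_iff by auto
  then show ?thesis by (simp only:) (intro closed_Collect_eq continuous_intros)
qed

text \<open>The closed complementary piece to branch \<open>i\<close>: off 0, the junction is the
  disjoint union of two closed sets, which is the form needed for connectedness arguments.\<close>

definition rest :: "nat \<Rightarrow> (real^2) set" where
  "rest i = (\<Union>k\<in>{1..N}-{i}. branch e k)"

lemma closed_rest: "closed (rest i)"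
  unfolding rest_def using closed_branch by (intro closed_UN) auto

lemma J_split: "i \<in> {1..N} \<Longrightarrow> J = branch e i \<union> rest i"
  unfolding junction_def rest_def by blast

lemma rest_disjoint: "i \<in> {1..N} \<Longrightarrow> branch e i \<inter> rest i \<subseteq> {0}"
  unfolding rest_def using branch_unique by blast

text \<open>A connected image that misses 0 cannot meet both of the closed sets
  \<open>branch e i\<close> and \<open>rest i\<close>, which share at most 0.\<close>

lemma connected_in_branch:
  assumes "connected S" "continuous_on S X" "X ` S \<subseteq> J - {0}" "\<tau>\<^sub>0 \<in> S" "X \<tau>\<^sub>0 \<in> branch e i" "i \<in> {1..N}"
    and "\<tau> \<in> S"
  shows "X \<tau> \<in> branch e i"
proof -
  have "connected (X ` S)" using assms connected_continuous_image by blast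
  moreover have "X ` S \<subseteq> branch e i \<union> rest i" using J_split[OF assms(6)] assms(3) by blast
  moreover have "branch e i \<inter> rest i \<inter> X ` S = {}" using rest_disjoint[OF assms(6)] assms(3) by blast
  ultimately have "branch e i \<inter> X ` S = {} \<or> rest i \<inter> X ` S = {}"
    using closed_branch[OF assms(6)] closed_rest[of i] unfolding connected_closed by meson
  moreover have "X \<tau>\<^sub>0 \<in> branch e i \<inter> X ` S" using assms(4,5) by blast
  ultimately have "X \<tau> \<notin> rest i" using assms(7) by blast
  moreover have "X \<tau> \<in> branch e i \<union> rest i" using J_split[OF assms(6)] assms(3,7) by blast
  ultimately show ?thesis by blast
qed

end

section \<open>Times spent on a branch and at the junction point\<close>

locale junction_path = star_junction +
  fixes X g :: "real \<Rightarrow> real^2"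
  assumes W: "W11 X g" and in_J: "\<And>\<tau>. \<tau> \<in> {0..1} \<Longrightarrow> X \<tau> \<in> J"
begin

lemma g_abs: "g absolutely_integrable_on {0..1}"
  using W unfolding W11_def by blast

lemma g_int: "g integrable_on {0..1}"
  using g_abs absolutely_integrable_on_def by blast

lemma g_int_sub: "0 \<le> s \<Longrightarrow> t \<le> 1 \<Longrightarrow> g integrable_on {s..t}"
  by (rule integrable_on_subinterval[OF g_int]) auto

lemma X_eq: "t \<in> {0..1} \<Longrightarrow> X t = X 0 + integral {0..t} g"
  using W unfolding W11_def by blast

lemma X_diff:
  assumes "0 \<le> s" "s \<le> t" "t \<le> 1"
  shows "integral {s..t} g = X t - X s"
proof -
  have "X s = X 0 + integral {0..s} g" "X t = X 0 + integral {0..t} g"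
    by (rule X_eq, use assms in simp)+
  moreover have "integral {0..s} g + integral {s..t} g = integral {0..t} g"
    using assms g_int_sub by (intro Henstock_Kurzweil_Integration.integral_combine) auto
  ultimately show ?thesis by (metis add_diff_cancel_left add_diff_cancel_left')
qed

lemma X_cont: "continuous_on {0..1} X"
proof -
  have "continuous_on {0..1} (\<lambda>t. X 0 + integral {0..t} g)"
    using g_int by (intro continuous_intros indefinite_integral_continuous_1)
  then show ?thesis
    by (rule continuous_on_eq) (use X_eq in metis)
qed

definition on_branch :: "nat \<Rightarrow> real set" where
  "on_branch k = {\<tau>. X \<tau> \<in> branch e k - {0}}"

text \<open>A punctured branch is not open in the plane, but inside \<open>J\<close> it is the
  complement of the closed set \<open>rest k \<union> {0}\<close>.\<close>

lemma open_on_branch: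
  assumes "k \<in> {1..N}" "0 \<le> s" "t \<le> 1"
  shows "open (on_branch k \<inter> {s<..<t})"
proof -
  have "openin (top_of_set {s<..<t}) ({s<..<t} \<inter> X -` (- (rest k \<union> {0})))"
    using continuous_openin_preimage_gen[of "{s<..<t}" X "- (rest k \<union> {0})"]
      continuous_on_subset[OF X_cont, of "{s<..<t}"] closed_rest[of k] assms
    by (metis (mono_tags, lifting) closed_Un closed_singleton greaterThanLessThan_subseteq_atLeastAtMost_iff
        open_Compl)
  then have "open ({s<..<t} \<inter> X -` (- (rest k \<union> {0})))"
    by (simp add: openin_open_eq)
  moreover have "X \<tau> \<notin> rest k \<union> {0} \<longleftrightarrow> X \<tau> \<in> branch e k - {0}" if "\<tau> \<in> {s<..<t}" for \<tau>
  proof -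
    have "X \<tau> \<in> J" using that assms in_J by auto
    then show ?thesis using J_split[OF assms(1)] rest_disjoint[OF assms(1)] by blast
  qed
  then have "{s<..<t} \<inter> X -` (- (rest k \<union> {0})) = on_branch k \<inter> {s<..<t}"
    unfolding on_branch_def by blast
  ultimately show ?thesis by simp
qed

text \<open>Every component of the set of times is an excursion that starts and ends at 0, so the
  velocity integrates over it to a difference of two zero positions.\<close>

lemma excursion_zero:
  assumes k: "k \<in> {1..N}" and st: "0 \<le> s" "s \<le> t" "t \<le> 1" and z: "X s = 0" "X t = 0"
  shows "integral (on_branch k \<inter> {s<..<t}) g = 0"
proof (rule integral_eq_0_by_components)
  show op: "open (on_branch k \<inter> {s<..<t})" using open_on_branch k st by auto
  show "bounded (on_branch k \<inter> {s<..<t})" by (rule bounded_subset[of "{s..t}"]) auto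
  show "g absolutely_integrable_on on_branch k \<inter> {s<..<t}"
    by (rule set_integrable_subset[OF g_abs]) (use op st in auto)
  fix a b assume ab: "a < b" "{a<..<b} \<subseteq> on_branch k \<inter> {s<..<t}"
    "a \<notin> on_branch k \<inter> {s<..<t}" "b \<notin> on_branch k \<inter> {s<..<t}"
  have sub: "{a<..<b} \<subseteq> {s..t}" using ab(2) by auto
  have "closure {a<..<b} \<subseteq> {s..t}" by (rule closure_minimal[OF sub]) simp
  then have abst: "s \<le> a" "b \<le> t" using ab(1) by auto
  have cl: "X ` {a..b} \<subseteq> branch e k"
  proof -
    have "X ` closure {a<..<b} \<subseteq> branch e k"
    proof (rule image_closure_subset)
      show "continuous_on (closure {a<..<b}) X"
        by (rule continuous_on_subset[OF X_cont]) (use ab(1) abst st in auto)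
    qed (use closed_branch[OF k] ab(2) in \<open>auto simp: on_branch_def\<close>)
    then show ?thesis using ab(1) by simp
  qed
  \<comment> \<open>By closedness \<open>X a\<close> still lies on the branch; an interior time
    \<open>a\<close> outside \<open>on_branch k\<close> must therefore have
    \<open>X a = 0\<close>.\<close>
  have "X a = 0"
  proof (cases "a = s")
    case False
    then have "a \<in> {s<..<t}" using abst ab(1) by auto
    moreover have "X a \<in> branch e k" using cl ab(1) by force
    ultimately show ?thesis using ab(3) unfolding on_branch_def by auto
  qed (use z in simp)
  moreover have "X b = 0"
  proof (cases "b = t")
    case False
    then have "b \<in> {s<..<t}" using abst ab(1) by auto
    moreover have "X b \<in> branch e k" using cl ab(1) by force
    ultimately show ?thesis using ab(4) unfolding on_branch_def by auto
  qed (use z in simp)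
  moreover have "integral {a<..<b} g = integral {a..b} g"
    using integral_open_interval_real[of a b g] by simp
  ultimately show "integral {a<..<b} g = 0"
    using X_diff[of a b] abst ab(1) st by simp
qed

lemma integral_on_branch:
  assumes k: "k \<in> {1..N}" and st: "0 \<le> s" "s \<le> t" "t \<le> 1" and z: "X s = 0" "X t = 0"
  shows "(\<lambda>\<tau>. if \<tau> \<in> on_branch k then g \<tau> else 0) absolutely_integrable_on {s..t}"
    and "integral {s..t} (\<lambda>\<tau>. if \<tau> \<in> on_branch k then g \<tau> else 0) = 0"
proof -
  have eq: "on_branch k \<inter> {s<..<t} = {s..t} \<inter> on_branch k"
    using z unfolding on_branch_def by (auto simp: less_le)
  have "g absolutely_integrable_on (on_branch k \<inter> {s<..<t})"
    by (rule set_integrable_subset[OF g_abs]) (use open_on_branch[OF k] st in auto)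
  then show "(\<lambda>\<tau>. if \<tau> \<in> on_branch k then g \<tau> else 0) absolutely_integrable_on {s..t}"
    by (intro absolutely_integrable_restrict) (simp add: eq)
  show "integral {s..t} (\<lambda>\<tau>. if \<tau> \<in> on_branch k then g \<tau> else 0) = 0"
    using excursion_zero[OF assms] unfolding eq integral_restrict_Int by (simp add: Int_commute)
qed

lemma on_branch_disjoint: "k \<in> {1..N} \<Longrightarrow> l \<in> {1..N} \<Longrightarrow> \<tau> \<in> on_branch k \<Longrightarrow> \<tau> \<in> on_branch l \<Longrightarrow> k = l"
  using branch_unique unfolding on_branch_def by blast

lemma on_branch_cover: "\<tau> \<in> {0..1} \<Longrightarrow> X \<tau> \<noteq> 0 \<Longrightarrow> \<exists>k\<in>{1..N}. \<tau> \<in> on_branch k"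
  using in_J[of \<tau>] unfolding on_branch_def junction_def by auto

text \<open>The velocity integrates to \<open>0\<close> over the part of any interval where the path sits at the
  junction point, because it does so over every excursion; Lebesgue differentiation concludes.\<close>

lemma velocity_zero_at_junction: "\<exists>S. negligible S \<and> (\<forall>\<tau>\<in>{0..1} - S. X \<tau> = 0 \<longrightarrow> g \<tau> = 0)"
proof -
  define Z where "Z = {\<tau>\<in>{0..1}. X \<tau> = 0}"
  have Z_closed: "closed Z"
    unfolding Z_def using continuous_closed_preimage_constant[OF X_cont] by auto
  define f where "f = (\<lambda>\<tau>. if \<tau> \<in> Z then g \<tau> else 0)"
  have f_int: "f absolutely_integrable_on {a..b}" for a b
  proof -
    have "g absolutely_integrable_on ({a..b} \<inter> Z)"
      by (rule set_integrable_subset[OF g_abs]) (use Z_closed in \<open>auto simp: Z_def\<close>)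
    then show ?thesis unfolding f_def by (rule absolutely_integrable_restrict)
  qed
  have f0: "integral {a..b} f = 0" for a b
  proof (cases "{a..b} \<inter> Z = {}")
    case True
    then have "integral {a..b} f = integral {a..b} (\<lambda>_. 0)"
      by (intro Henstock_Kurzweil_Integration.integral_cong) (auto simp: f_def)
    then show ?thesis by simp
  next
    case False
    have cpt: "compact ({a..b} \<inter> Z)" using Z_closed by (simp add: compact_Int_closed)
    then obtain s where s: "s \<in> {a..b} \<inter> Z" "\<And>u. u \<in> {a..b} \<inter> Z \<Longrightarrow> s \<le> u"
      using compact_attains_inf False by metis
    obtain t where t: "t \<in> {a..b} \<inter> Z" "\<And>u. u \<in> {a..b} \<inter> Z \<Longrightarrow> u \<le> t"
      using compact_attains_sup False cpt by metis
    have st: "0 \<le> s" "s \<le> t" "t \<le> 1" "X s = 0" "X t = 0" using s t unfolding Z_def by auto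
    \<comment> \<open>Nothing of \<open>f\<close> is lost before the first zero \<open>s\<close> and
      after the last zero \<open>t\<close>; the smaller interval has both ends at the junction
      point, so its excursions are all closed.\<close>
    have "integral {a..b} f = integral {s..t} f"
    proof (rule integral_spike_set)
      have "{x \<in> {a..b} - {s..t}. f x \<noteq> 0} = {}" using s(2) t(2) by (force simp: f_def)
      then show "negligible {x \<in> {a..b} - {s..t}. f x \<noteq> 0}" by (metis negligible_empty)
      have "{x \<in> {s..t} - {a..b}. f x \<noteq> 0} = {}" using s(1) t(1) by auto
      then show "negligible {x \<in> {s..t} - {a..b}. f x \<noteq> 0}" by (metis negligible_empty)
    qed
    also have "\<dots> = 0"
    proof -
      \<comment> \<open>The velocity is the part at 0 plus one part per branch. The total
        displacement and all the branch parts vanish, which leaves the part at 0.\<close>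
      have "integral {s..t} g = integral {s..t} (\<lambda>\<tau>. f \<tau> + (\<Sum>k\<in>{1..N}. if \<tau> \<in> on_branch k then g \<tau> else 0))"
      proof (rule Henstock_Kurzweil_Integration.integral_cong)
        fix \<tau> assume tau: "\<tau> \<in> {s..t}"
        show "g \<tau> = f \<tau> + (\<Sum>k\<in>{1..N}. if \<tau> \<in> on_branch k then g \<tau> else 0)"
        proof (cases "X \<tau> = 0")
          case True
          then have "\<tau> \<in> Z" "\<And>k. \<tau> \<notin> on_branch k" using tau st by (auto simp: Z_def on_branch_def)
          then show ?thesis by (simp add: f_def)
        next
          case False
          have "\<tau> \<in> {0..1}" using tau st by auto
          from on_branch_cover[OF this False] obtain k where k: "k \<in> {1..N}" "\<tau> \<in> on_branch k"
            by blast
          have "(\<Sum>l\<in>{1..N}. if \<tau> \<in> on_branch l then g \<tau> else 0) = (\<Sum>l\<in>{1..N}. if l = k then g \<tau> else 0)"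
          proof (intro sum.cong refl)
            fix l assume "l \<in> {1..N}"
            then have "\<tau> \<in> on_branch l \<longleftrightarrow> l = k" using k on_branch_disjoint[of l k \<tau>] by blast
            then show "(if \<tau> \<in> on_branch l then g \<tau> else 0) = (if l = k then g \<tau> else 0)" by simp
          qed
          then show ?thesis using k False by (simp add: f_def Z_def)
        qed
      qed
      also have "\<dots> = integral {s..t} f + (\<Sum>k\<in>{1..N}. integral {s..t} (\<lambda>\<tau>. if \<tau> \<in> on_branch k then g \<tau> else 0))"
      proof -
        have i: "(\<lambda>\<tau>. if \<tau> \<in> on_branch k then g \<tau> else 0) integrable_on {s..t}" if "k \<in> {1..N}" for k
          using integral_on_branch(1)[OF that st] absolutely_integrable_on_def by blast
        have "f integrable_on {s..t}" using f_int absolutely_integrable_on_def by blast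
        then show ?thesis
          using i by (subst Henstock_Kurzweil_Integration.integral_add)
            (auto intro!: integrable_sum Henstock_Kurzweil_Integration.integral_sum)
      qed
      also have "\<dots> = integral {s..t} f" using integral_on_branch(2)[OF _ st] by simp
      finally show ?thesis using X_diff[OF st(1-3)] st by simp
    qed
    finally show ?thesis .
  qed
  obtain S where S: "negligible S"
    "\<And>x \<epsilon>. x \<notin> S \<Longrightarrow> 0 < \<epsilon> \<Longrightarrow> \<exists>d>0. \<forall>h. 0 < h \<and> h < d \<longrightarrow>
        norm (integral (cbox x (x + h *\<^sub>R One)) f /\<^sub>R h ^ DIM(real) - f x) < \<epsilon>"
    using integrable_ccontinuous_explicit[of f] f_int absolutely_integrable_on_def
    by (metis interval_cbox)
  have fz: "f x = 0" if xS: "x \<notin> S" for x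
  proof (rule ccontr)
    assume "f x \<noteq> 0"
    then obtain d where d: "d > 0" "\<forall>h. 0 < h \<and> h < d \<longrightarrow>
        norm (integral (cbox x (x + h *\<^sub>R One)) f /\<^sub>R h ^ DIM(real) - f x) < norm (f x)"
      using S(2)[OF xS, of "norm (f x)"] by auto
    from d(2)[rule_format, of "d/2"] d(1) f0[of x "x + (d/2) *\<^sub>R One"] show False by simp
  qed
  have "g \<tau> = 0" if "\<tau> \<in> {0..1} - S" "X \<tau> = 0" for \<tau>
    using fz[of \<tau>] that by (simp add: f_def Z_def)
  then show ?thesis using S(1) by blast
qed

end

section \<open>Lower bound for the action\<close>

lemma restricted_component_integral:
  fixes G :: "real \<Rightarrow> real^2"
  assumes ab: "0 \<le> a" "b \<le> 1" and G: "G absolutely_integrable_on {a..b}"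
  shows "(\<lambda>\<tau>. if \<tau> \<in> {a..b} then c * (G \<tau> \<bullet> v) else 0) absolutely_integrable_on {0..1}"
    and "integral {0..1} (\<lambda>\<tau>. if \<tau> \<in> {a..b} then c * (G \<tau> \<bullet> v) else 0) = c * (integral {a..b} G \<bullet> v)"
proof -
  have eq: "{0..1} \<inter> {a..b} = {a..b}" using ab by auto
  have bl: "bounded_linear (\<lambda>u. c * (u \<bullet> v))"
    by (intro bounded_linear_mult_right[THEN bounded_linear_compose] bounded_linear_inner_left)
  have "(\<lambda>\<tau>. c * (G \<tau> \<bullet> v)) absolutely_integrable_on {a..b}"
    using absolutely_integrable_linear[OF G bl] by (simp add: o_def)
  then show "(\<lambda>\<tau>. if \<tau> \<in> {a..b} then c * (G \<tau> \<bullet> v) else 0) absolutely_integrable_on {0..1}"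
    by (intro absolutely_integrable_restrict) (simp only: eq)
  have "G integrable_on {a..b}" using G absolutely_integrable_on_def by blast
  from integral_linear[OF this bl]
  have "integral {a..b} (\<lambda>\<tau>. c * (G \<tau> \<bullet> v)) = c * (integral {a..b} G \<bullet> v)" by (simp add: o_def)
  then show "integral {0..1} (\<lambda>\<tau>. if \<tau> \<in> {a..b} then c * (G \<tau> \<bullet> v) else 0) = c * (integral {a..b} G \<bullet> v)"
    by (subst integral_restrict_Int, subst Int_commute) (simp only: eq)
qed

lemma lebesgue_on_integral_ge:
  fixes f h :: "real \<Rightarrow> real"
  assumes f: "integrable (lebesgue_on {0..1}) f" and h: "h absolutely_integrable_on {0..1}"
    and S: "negligible S" and le: "\<And>\<tau>. \<tau> \<in> {0..1} - S \<Longrightarrow> h \<tau> \<le> f \<tau>"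
  shows "integral {0..1} h \<le> integral\<^sup>L (lebesgue_on {0..1}) f"
proof -
  have h': "integrable (lebesgue_on {0..1}) h"
    using h unfolding set_integrable_def by (subst integrable_restrict_space) auto
  have "AE \<tau> in lebesgue. \<tau> \<notin> S"
    using S negligible_iff_null_sets AE_not_in by blast
  then have "AE \<tau> in lebesgue_on {0..1}. h \<tau> \<le> f \<tau>"
    using le by (subst AE_restrict_space_iff) (auto elim!: eventually_mono)
  then have "integral\<^sup>L (lebesgue_on {0..1}) h \<le> integral\<^sup>L (lebesgue_on {0..1}) f"
    by (rule integral_mono_AE[OF h' f])
  then show ?thesis using lebesgue_integral_eq_integral[OF h'] by simp
qed

locale junction_lagrangian = star_junction +
  fixes L dL ddL :: "nat \<Rightarrow> real \<Rightarrow> real" and \<gamma> :: real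
  assumes convex: "\<And>k. k \<in> {1..N} \<Longrightarrow> unif_convex (L k) (dL k) (ddL k) \<gamma>"
begin

abbreviation K :: "nat \<Rightarrow> real \<Rightarrow> real" where "K k \<equiv> unif_convex.K (L k) (dL k)"
abbreviation l0 :: real where "l0 \<equiv> L0 N L 0"

lemma tangent: "k \<in> {1..N} \<Longrightarrow> K k q + dL k q * v \<le> L k v"
  using unif_convex.tangent[OF convex] by simp

lemma K_eq: "k \<in> {1..N} \<Longrightarrow> K k q = L k q - q * dL k q"
  using unif_convex.K_def[OF convex] by simp

lemma K_zero: "k \<in> {1..N} \<Longrightarrow> K k 0 = L k 0" by (simp add: K_eq)

lemma l0_le: "k \<in> {1..N} \<Longrightarrow> l0 \<le> L k 0"
  unfolding L0_def by (intro Min_le) auto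

lemma l0_attained: "\<exists>k\<in>{1..N}. l0 = L k 0"
proof -
  have "l0 \<in> (\<lambda>j. L j 0) ` {1..N}" unfolding L0_def using N1 by (intro Min_in) auto
  then show ?thesis by auto
qed

lemma lag_branch: "k \<in> {1..N} \<Longrightarrow> z \<in> branch e k - {0} \<Longrightarrow> lag N e L z P = L k (P \<bullet> e k)"
  using brix_eq[of k z] unfolding lag_def by simp

text \<open>Calibration: the Lagrangian is bounded below by its tangent at \<open>q1\<close> before the first visit
  to the junction point, at \<open>0\<close> during the excursions, and at \<open>q2\<close> after the last visit.\<close>

lemma path_through_junction_lower:
  assumes adm: "admissible N e y x X g"
    and int: "integrable (lebesgue_on {0..1}) (\<lambda>\<tau>. lag N e L (X \<tau>) (g \<tau>))"
    and j: "j \<in> {1..N}" "y = s *\<^sub>R e j" "s \<ge> 0" and i: "i \<in> {1..N}" "x = r *\<^sub>R e i" "r \<ge> 0"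
    and z: "\<tau>\<^sub>0 \<in> {0..1}" "X \<tau>\<^sub>0 = 0"
    and lam: "\<mu> \<le> l0" "\<mu> \<le> K j q1" "\<mu> \<le> K i q2"
  shows "\<mu> - s * dL j q1 + r * dL i q2 \<le> integral\<^sup>L (lebesgue_on {0..1}) (\<lambda>\<tau>. lag N e L (X \<tau>) (g \<tau>))"
proof -
  interpret junction_path N e X g
    by standard (use adm in \<open>auto simp: admissible_def\<close>)
  have X01: "X 0 = y" "X 1 = x" using adm by (auto simp: admissible_def)
  define Z where "Z = {\<tau>\<in>{0..1}. X \<tau> = 0}"
  have "compact Z"
    unfolding Z_def using continuous_closed_preimage_constant[OF X_cont, of 0]
    by (auto simp: compact_eq_bounded_closed intro: bounded_subset[of "{0..1}"])
  moreover have "Z \<noteq> {}" using z unfolding Z_def by blast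
  ultimately obtain t1 t2 where t1: "t1 \<in> Z" "\<And>u. u \<in> Z \<Longrightarrow> t1 \<le> u"
    and t2: "t2 \<in> Z" "\<And>u. u \<in> Z \<Longrightarrow> u \<le> t2"
    using compact_attains_inf[of Z] compact_attains_sup[of Z] by metis
  have t: "0 \<le> t1" "t1 \<le> t2" "t2 \<le> 1" "X t1 = 0" "X t2 = 0"
    using t1 t2 unfolding Z_def by auto
  have before: "\<tau> \<in> on_branch j" if "\<tau> \<in> {0..<t1}" for \<tau>
  proof -
    have nz: "X u \<noteq> 0" if "u \<in> {0..<t1}" for u
      using t1(2)[of u] that t unfolding Z_def by auto
    have "X \<tau> \<in> branch e j"
    proof (rule connected_in_branch[of "{0..<t1}" X 0])
      show "continuous_on {0..<t1} X" by (rule continuous_on_subset[OF X_cont]) (use t in auto)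
      show "X ` {0..<t1} \<subseteq> J - {0}" using nz in_J t by force
      show "X 0 \<in> branch e j" using X01 j scaled_in_branch by simp
    qed (use that j in auto)
    then show ?thesis using nz[OF that] unfolding on_branch_def by blast
  qed
  have after: "\<tau> \<in> on_branch i" if "\<tau> \<in> {t2<..1}" for \<tau>
  proof -
    have nz: "X u \<noteq> 0" if "u \<in> {t2<..1}" for u
      using t2(2)[of u] that t unfolding Z_def by auto
    have "X \<tau> \<in> branch e i"
    proof (rule connected_in_branch[of "{t2<..1}" X 1])
      show "continuous_on {t2<..1} X" by (rule continuous_on_subset[OF X_cont]) (use t in auto)
      show "X ` {t2<..1} \<subseteq> J - {0}" using nz in_J t by force
      show "X 1 \<in> branch e i" using X01 i scaled_in_branch by simp
    qed (use that i in auto)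
    then show ?thesis using nz[OF that] unfolding on_branch_def by blast
  qed
  define h1 where "h1 = (\<lambda>\<tau>. if \<tau> \<in> {0..t1} then dL j q1 * (g \<tau> \<bullet> e j) else 0)"
  define h2 where "h2 = (\<lambda>\<tau>. if \<tau> \<in> {t2..1} then dL i q2 * (g \<tau> \<bullet> e i) else 0)"
  \<comment> \<open>Over closed excursions these terms integrate to 0, so they are free. The tangent
    at 0 is the right one because its intercept \<open>K k 0 = L k 0\<close> is at least
    \<open>l0\<close>, hence at least \<open>\<mu>\<close>.\<close>
  define h3 where "h3 = (\<lambda>k \<tau>. if \<tau> \<in> {t1..t2} then dL k 0 * ((if \<tau> \<in> on_branch k then g \<tau> else 0) \<bullet> e k) else 0)"
  have g_abs_sub: "g absolutely_integrable_on {a..b}" if "0 \<le> a" "b \<le> 1" for a b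
    by (rule set_integrable_subset[OF g_abs]) (use that in auto)
  have h1: "h1 absolutely_integrable_on {0..1}" "integral {0..1} h1 = - s * dL j q1"
    using restricted_component_integral[OF _ _ g_abs_sub, of 0 t1 "dL j q1" "e j"] t X_diff[of 0 t1] X01 j
    unfolding h1_def by auto
  have h2: "h2 absolutely_integrable_on {0..1}" "integral {0..1} h2 = r * dL i q2"
    using restricted_component_integral[OF _ _ g_abs_sub, of t2 1 "dL i q2" "e i"] t X_diff[of t2 1] X01 i
    unfolding h2_def by auto
  have h3: "h3 k absolutely_integrable_on {0..1}" "integral {0..1} (h3 k) = 0" if "k \<in> {1..N}" for k
    using restricted_component_integral[OF _ _ integral_on_branch(1)[OF that t], of "dL k 0" "e k"]
      integral_on_branch(2)[OF that t] t
    unfolding h3_def by auto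
  define h where "h = (\<lambda>\<tau>. \<mu> + (h1 \<tau> + h2 \<tau>) + (\<Sum>k\<in>{1..N}. h3 k \<tau>))"
  have c_abs: "(\<lambda>\<tau>. \<mu>) absolutely_integrable_on {0..1::real}"
    by (rule absolutely_integrable_on_const) simp
  have h_abs: "h absolutely_integrable_on {0..1}"
    unfolding h_def using h1 h2 h3 c_abs
    by (intro set_integral_add absolutely_integrable_sum) auto
  have h_int: "integral {0..1} h = \<mu> - s * dL j q1 + r * dL i q2"
  proof -
    have I: "h1 integrable_on {0..1}" "h2 integrable_on {0..1}" "\<And>k. k \<in> {1..N} \<Longrightarrow> h3 k integrable_on {0..1}"
      using h1 h2 h3 absolutely_integrable_on_def by blast+
    have "(h1 has_integral (- s * dL j q1)) {0..1}" "(h2 has_integral (r * dL i q2)) {0..1}"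
      "\<And>k. k \<in> {1..N} \<Longrightarrow> (h3 k has_integral 0) {0..1}"
      using I h1(2) h2(2) h3(2) by (metis integrable_integral)+
    moreover have "((\<lambda>\<tau>. \<mu>) has_integral \<mu>) {0..1::real}"
      using has_integral_const_real[of \<mu> 0 1] by simp
    ultimately have "(h has_integral (\<mu> + (- s * dL j q1 + r * dL i q2) + (\<Sum>k\<in>{1..N}. 0))) {0..1}"
      unfolding h_def by (intro has_integral_add has_integral_sum) auto
    then show ?thesis by (simp add: integral_unique)
  qed
  obtain S where S: "negligible S" "\<And>\<tau>. \<tau> \<in> {0..1} - S \<Longrightarrow> X \<tau> = 0 \<Longrightarrow> g \<tau> = 0"
    using velocity_zero_at_junction by blast
  \<comment> \<open>The times \<open>t1\<close> and \<open>t2\<close> are dropped because the closed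
    intervals of \<open>h1\<close>, \<open>h2\<close> and \<open>h3\<close> overlap there.\<close>
  have "h \<tau> \<le> lag N e L (X \<tau>) (g \<tau>)" if tau: "\<tau> \<in> {0..1} - (S \<union> {t1, t2})" for \<tau>
  proof -
    have lag_k: "lag N e L (X \<tau>) (g \<tau>) = L k (g \<tau> \<bullet> e k)" if "k \<in> {1..N}" "\<tau> \<in> on_branch k" for k
      using lag_branch that unfolding on_branch_def by blast
    consider "\<tau> < t1" | "\<tau> > t2" | "t1 < \<tau>" "\<tau> < t2" using tau by fastforce
    then show ?thesis
    proof cases
      case 1
      then have "h \<tau> = \<mu> + dL j q1 * (g \<tau> \<bullet> e j)" using tau t unfolding h_def h1_def h2_def h3_def by simp
      moreover have "\<tau> \<in> on_branch j" using before 1 tau by simp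
      ultimately show ?thesis using lag_k[OF j(1)] tangent[OF j(1), of q1 "g \<tau> \<bullet> e j"] lam by simp
    next
      case 2
      then have "h \<tau> = \<mu> + dL i q2 * (g \<tau> \<bullet> e i)" using tau t unfolding h_def h1_def h2_def h3_def by simp
      moreover have "\<tau> \<in> on_branch i" using after 2 tau by simp
      ultimately show ?thesis using lag_k[OF i(1)] tangent[OF i(1), of q2 "g \<tau> \<bullet> e i"] lam by simp
    next
      case 3
      then have h_eq: "h \<tau> = \<mu> + (\<Sum>k\<in>{1..N}. if \<tau> \<in> on_branch k then dL k 0 * (g \<tau> \<bullet> e k) else 0)"
        using tau t unfolding h_def h1_def h2_def h3_def by (auto intro!: sum.cong)
      show ?thesis
      proof (cases "X \<tau> = 0")
        case True
        then have "g \<tau> = 0" using S(2) tau by blast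
        moreover have "h \<tau> = \<mu>" using True h_eq by (simp add: on_branch_def)
        ultimately show ?thesis using True lam by (simp add: lag_def)
      next
        case False
        have "\<tau> \<in> {0..1}" using tau by blast
        from on_branch_cover[OF this False] obtain k where k: "k \<in> {1..N}" "\<tau> \<in> on_branch k" by blast
        have "(\<Sum>l\<in>{1..N}. if \<tau> \<in> on_branch l then dL l 0 * (g \<tau> \<bullet> e l) else 0)
            = (\<Sum>l\<in>{1..N}. if l = k then dL k 0 * (g \<tau> \<bullet> e k) else 0)"
        proof (intro sum.cong refl)
          fix l assume "l \<in> {1..N}"
          then have "\<tau> \<in> on_branch l \<longleftrightarrow> l = k" using k on_branch_disjoint[of l k \<tau>] by blast
          then show "(if \<tau> \<in> on_branch l then dL l 0 * (g \<tau> \<bullet> e l) else 0)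
            = (if l = k then dL k 0 * (g \<tau> \<bullet> e k) else 0)" by simp
        qed
        then have "h \<tau> = \<mu> + dL k 0 * (g \<tau> \<bullet> e k)" using h_eq k by simp
        moreover have "\<mu> \<le> K k 0" using lam l0_le[OF k(1)] K_zero[OF k(1)] by simp
        ultimately show ?thesis using lag_k[OF k] tangent[OF k(1), of 0 "g \<tau> \<bullet> e k"] by simp
      qed
    qed
  qed
  then show ?thesis
    using lebesgue_on_integral_ge[OF int h_abs, of "S \<union> {t1, t2}"] S(1) h_int
    by (simp add: negligible_Un negligible_insert)
qed

text \<open>Connectedness keeps the path in one branch, where the tangent at the mean speed
  \<open>r - s\<close> integrates to exactly \<open>L i (r - s)\<close>: Jensen's
  inequality.\<close>

lemma path_avoiding_junction_lower:
  assumes adm: "admissible N e y x X g"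
    and int: "integrable (lebesgue_on {0..1}) (\<lambda>\<tau>. lag N e L (X \<tau>) (g \<tau>))"
    and j: "j \<in> {1..N}" "y = s *\<^sub>R e j" "s \<ge> 0" and i: "i \<in> {1..N}" "x = r *\<^sub>R e i" "r \<ge> 0"
    and nz: "\<And>\<tau>. \<tau> \<in> {0..1} \<Longrightarrow> X \<tau> \<noteq> 0"
  shows "i = j" and "L i (r - s) \<le> integral\<^sup>L (lebesgue_on {0..1}) (\<lambda>\<tau>. lag N e L (X \<tau>) (g \<tau>))"
proof -
  interpret junction_path N e X g
    by standard (use adm in \<open>auto simp: admissible_def\<close>)
  have X01: "X 0 = y" "X 1 = x" using adm by (auto simp: admissible_def)
  have on: "X \<tau> \<in> branch e j - {0}" if "\<tau> \<in> {0..1}" for \<tau>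
  proof -
    have "X \<tau> \<in> branch e j"
    proof (rule connected_in_branch[of "{0..1}" X 0])
      show "X ` {0..1} \<subseteq> J - {0}" using in_J nz by (intro image_subsetI DiffI) simp_all
      show "X 0 \<in> branch e j" using X01 j scaled_in_branch by simp
    qed (use that j X_cont in auto)
    then show ?thesis using nz[OF that] by blast
  qed
  show ij: "i = j"
    using on[of 1] X01(2) i(2) branch_unique[OF i(1) j(1), of x] scaled_in_branch[OF i(3), of i] by simp
  define v where "v = r - s"
  define h where "h = (\<lambda>\<tau>. K i v + (if \<tau> \<in> {0..1} then dL i v * (g \<tau> \<bullet> e i) else 0))"
  have "(\<lambda>\<tau>. K i v) absolutely_integrable_on {0..1::real}"
    by (rule absolutely_integrable_on_const) simp
  moreover note R = restricted_component_integral[OF _ _ g_abs, of "dL i v" "e i"]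
  ultimately have h_abs: "h absolutely_integrable_on {0..1}"
    unfolding h_def by (intro set_integral_add) auto
  have "((\<lambda>\<tau>. if \<tau> \<in> {0..1} then dL i v * (g \<tau> \<bullet> e i) else 0) has_integral dL i v * (integral {0..1} g \<bullet> e i)) {0..1}"
    using R[OF order.refl order.refl] absolutely_integrable_on_def by (metis (no_types, lifting) integrable_integral)
  moreover have "integral {0..1} g \<bullet> e i = v"
    using X_diff[of 0 1] X01 i j ij by (simp add: v_def inner_diff_left)
  ultimately have "(h has_integral (K i v + dL i v * v)) {0..1}"
    unfolding h_def using has_integral_const_real[of "K i v" 0 1] by (intro has_integral_add) auto
  then have h_int: "integral {0..1} h = L i v"
    using K_eq[OF i(1), of v] by (simp add: integral_unique)
  have "h \<tau> \<le> lag N e L (X \<tau>) (g \<tau>)" if "\<tau> \<in> {0..1} - {}" for \<tau>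
    using lag_branch[OF j(1) on, of \<tau>] that tangent[OF i(1), of v] ij unfolding h_def by simp
  from lebesgue_on_integral_ge[OF int h_abs negligible_empty this] h_int
  show "L i (r - s) \<le> integral\<^sup>L (lebesgue_on {0..1}) (\<lambda>\<tau>. lag N e L (X \<tau>) (g \<tau>))"
    by (simp add: v_def)
qed

text \<open>Weak duality: any numbers satisfying the inequalities on \<open>\<mu>\<close> certify a
  lower bound for paths through 0. The straight cost enters only for paths that avoid 0, which
  forces both endpoints to be nonzero and on one branch.\<close>

lemma D0_lower:
  assumes j: "j \<in> {1..N}" "s \<ge> 0" and i: "i \<in> {1..N}" "r \<ge> 0"
    and lam: "\<mu> \<le> l0" "\<mu> \<le> K j q1" "\<mu> \<le> K i q2"
    and c: "c \<le> \<mu> - s * dL j q1 + r * dL i q2" "i = j \<Longrightarrow> s > 0 \<Longrightarrow> r > 0 \<Longrightarrow> c \<le> L i (r - s)"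
  shows "ereal c \<le> D0 N e L (s *\<^sub>R e j) (r *\<^sub>R e i)"
  unfolding D0_def
proof (rule Inf_greatest, clarify)
  fix X g assume adm: "admissible N e (s *\<^sub>R e j) (r *\<^sub>R e i) X g"
  show "ereal c \<le> action N e L X g"
  proof (cases "integrable (lebesgue_on {0..1}) (\<lambda>\<tau>. lag N e L (X \<tau>) (g \<tau>))")
    case True
    have "c \<le> integral\<^sup>L (lebesgue_on {0..1}) (\<lambda>\<tau>. lag N e L (X \<tau>) (g \<tau>))"
    proof (cases "\<exists>\<tau>\<^sub>0\<in>{0..1}. X \<tau>\<^sub>0 = 0")
      case z: True
      then show ?thesis
        using path_through_junction_lower[OF adm True j(1) refl j(2) i(1) refl i(2) _ _ lam] c(1) by (meson order.trans)
    next
      case nz: False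
      have "X 0 = s *\<^sub>R e j" "X 1 = r *\<^sub>R e i" using adm by (auto simp: admissible_def)
      then have "s \<noteq> 0" "r \<noteq> 0" using nz by fastforce+
      moreover have nz': "\<And>\<tau>. \<tau> \<in> {0..1} \<Longrightarrow> X \<tau> \<noteq> 0" using nz by blast
      ultimately show ?thesis
        using path_avoiding_junction_lower[OF adm True j(1) refl j(2) i(1) refl i(2) nz'] c(2) j(2) i(2) by simp
    qed
    then show ?thesis using True by (simp add: action_def)
  qed (simp add: action_def)
qed

end

section \<open>Explicit competitors\<close>

text \<open>The form \<open>min t c\<close> covers all upper limits at once: for general
  \<open>t\<close> it gives the position of a competitor, and for \<open>t = 1\<close> its
  cost.\<close>

lemma has_integral_step_before:
  assumes "0 \<le> c" "0 \<le> t"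
  shows "((\<lambda>\<tau>::real. if \<tau> \<in> {..<c} then v else 0) has_integral (v::real) * min t c) {0..t}"
proof -
  have "((\<lambda>\<tau>. v) has_integral v * min t c) {0..min t c}"
    using has_integral_const_real[of v 0 "min t c"] assms by (cases "t \<le> c") (simp_all add: mult.commute)
  then have "((\<lambda>\<tau>. if \<tau> \<in> {0..min t c} then v else 0) has_integral v * min t c) {0..t}"
    by (subst has_integral_restrict) auto
  then show ?thesis
    by (rule has_integral_spike_finite[of "{c}", rotated 2]) auto
qed

lemma has_integral_step_after:
  assumes "0 \<le> c" "0 \<le> t"
  shows "((\<lambda>\<tau>::real. if \<tau> \<in> {c<..} then v else 0) has_integral (v::real) * max 0 (t - c)) {0..t}"
proof -
  have "((\<lambda>\<tau>::real. v - (if \<tau> \<in> {..<c} then v else 0)) has_integral v * t - v * min t c) {0..t}"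
    using has_integral_const_real[of v 0 t] assms
    by (intro has_integral_diff has_integral_step_before) (auto simp: mult.commute)
  moreover have "v * t - v * min t c = v * max 0 (t - c)" by (auto simp: min_def max_def algebra_simps)
  ultimately have "((\<lambda>\<tau>::real. v - (if \<tau> \<in> {..<c} then v else 0)) has_integral v * max 0 (t - c)) {0..t}"
    by simp
  then show ?thesis
    by (rule has_integral_spike_finite[of "{c}", rotated 2]) auto
qed

lemma absolutely_integrable_step:
  fixes v :: "'b::euclidean_space" and T :: "real set"
  assumes "T \<in> sets borel"
  shows "(\<lambda>\<tau>. if \<tau> \<in> T then v else 0) absolutely_integrable_on {0..1}"
proof (rule absolutely_integrable_restrict)
  have "{0..1} \<inter> T \<in> lmeasurable"
    by (rule bounded_set_imp_lmeasurable) (use assms in \<open>auto intro: bounded_subset[of "{0..1}"]\<close>)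
  then show "(\<lambda>\<tau>. v) absolutely_integrable_on {0..1} \<inter> T" by (rule absolutely_integrable_on_const)
qed

context junction_lagrangian
begin

text \<open>The finite set \<open>S\<close> absorbs end times at which a path may be at 0, where the
  Lagrangian is not the one of its branch.\<close>

lemma D0_le_path:
  assumes W: "W11 X g" and J: "\<And>\<tau>. \<tau> \<in> {0..1} \<Longrightarrow> X \<tau> \<in> J" and S: "finite S"
    and adm: "\<And>\<tau>. \<tau> \<in> {0..1} - S \<Longrightarrow> adm_dir N e (X \<tau>) (g \<tau>)"
    and w: "w absolutely_integrable_on {0..1}" "(w has_integral I) {0..1}"
    and lag: "\<And>\<tau>. \<tau> \<in> {0..1} - S \<Longrightarrow> lag N e L (X \<tau>) (g \<tau>) = w \<tau>"
  shows "D0 N e L (X 0) (X 1) \<le> ereal I"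
proof -
  have neg: "negligible S" using S by (rule negligible_finite)
  have "AE \<tau> in lebesgue. \<tau> \<notin> S"
    using neg negligible_iff_null_sets AE_not_in by blast
  then have "AE \<tau> in lebesgue_on {0..1}. adm_dir N e (X \<tau>) (g \<tau>)"
    using adm by (subst AE_restrict_space_iff) (auto elim!: eventually_mono)
  then have adm': "admissible N e (X 0) (X 1) X g" unfolding admissible_def using W J by auto
  have "(\<lambda>\<tau>. lag N e L (X \<tau>) (g \<tau>)) absolutely_integrable_on {0..1}"
    by (rule absolutely_integrable_spike[OF w(1) neg lag])
  then have int: "integrable (lebesgue_on {0..1}) (\<lambda>\<tau>. lag N e L (X \<tau>) (g \<tau>))"
    unfolding set_integrable_def by (subst integrable_restrict_space) auto
  have "((\<lambda>\<tau>. lag N e L (X \<tau>) (g \<tau>)) has_integral I) {0..1}"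
    by (rule has_integral_spike[OF neg lag w(2)])
  then have "integral\<^sup>L (lebesgue_on {0..1}) (\<lambda>\<tau>. lag N e L (X \<tau>) (g \<tau>)) = I"
    using lebesgue_integral_eq_integral[OF int] by (simp add: integral_unique)
  then have "ereal I = action N e L X g" using int by (simp add: action_def)
  then have "ereal I \<in> {action N e L X' g' | X' g'. admissible N e (X 0) (X 1) X' g'}" using adm' by blast
  then show ?thesis unfolding D0_def by (rule Inf_lower)
qed

lemma adm_dir_branch: "k \<in> {1..N} \<Longrightarrow> z \<in> branch e k - {0} \<Longrightarrow> adm_dir N e z (p *\<^sub>R e k)"
  using brix_eq[of k z] unfolding adm_dir_def by auto

lemma adm_dir_zero: "adm_dir N e 0 0"
  unfolding adm_dir_def using N1 by (auto intro!: bexI[of _ 1] exI[of _ 0])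

lemma lag_zero: "lag N e L 0 0 = l0" unfolding lag_def by simp

text \<open>The competitor moves at constant speed on each leg and rests at 0 in between. A leg of
  length 0 is spent resting as well, and with time 0 its quotient is 0 by the convention for
  division.\<close>

lemma D0_le_route:
  assumes k: "k \<in> {1..N}" and l: "l \<in> {1..N}" and sr: "s \<ge> 0" "r \<ge> 0"
    and t: "t1 \<ge> 0" "t2 \<ge> 0" "t1 + t2 \<le> 1" and pos: "s > 0 \<Longrightarrow> t1 > 0" "r > 0 \<Longrightarrow> t2 > 0"
  shows "D0 N e L (s *\<^sub>R e k) (r *\<^sub>R e l) \<le> ereal (t1 * L k (- s / t1) + t2 * L l (r / t2) + (1 - t1 - t2) * l0)"
proof -
  define a b where "a = s / t1" and "b = r / t2"
  have at: "a * t1 = s" "b * t2 = r" using pos sr unfolding a_def b_def by (cases "s = 0"; cases "r = 0"; force)+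
  \<comment> \<open>One formula for all three phases: since \<open>t1 + t2 <= 1\<close>, the first
    summand has vanished before the second starts to grow.\<close>
  define X where "X = (\<lambda>\<tau>. (s - a * min \<tau> t1) *\<^sub>R e k + (b * max 0 (\<tau> - (1 - t2))) *\<^sub>R e l)"
  define g where "g = (\<lambda>\<tau>. (if \<tau> \<in> {..<t1} then - a *\<^sub>R e k else 0) + (if \<tau> \<in> {1 - t2<..} then b *\<^sub>R e l else 0))"
  \<comment> \<open>A leg of length 0 costs \<open>l0\<close> per unit of time, and not
    \<open>L k 0\<close>; as \<open>l0 <= L k 0\<close>, the claimed bound is still correct.\<close>
  define c1 c2 where "c1 = (if s = 0 then l0 else L k (- a))" and "c2 = (if r = 0 then l0 else L l b)"
  define w where "w = (\<lambda>\<tau>. l0 + ((if \<tau> \<in> {..<t1} then c1 - l0 else 0) + (if \<tau> \<in> {1 - t2<..} then c2 - l0 else 0)))"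
  have X0: "X 0 = s *\<^sub>R e k" using t unfolding X_def by simp
  have "min 1 t1 = t1" "max 0 (1 - (1 - t2)) = t2" using t by auto
  then have X1: "X 1 = r *\<^sub>R e l" using at unfolding X_def by simp
  have W: "W11 X g"
    unfolding W11_def
  proof (intro conjI ballI)
    show "g absolutely_integrable_on {0..1}"
      unfolding g_def by (intro set_integral_add absolutely_integrable_step) auto
    fix \<tau> :: real assume tau: "\<tau> \<in> {0..1}"
    have eq: "g = (\<lambda>\<tau>. (if \<tau> \<in> {..<t1} then - a else 0) *\<^sub>R e k + (if \<tau> \<in> {1 - t2<..} then b else 0) *\<^sub>R e l)"
      unfolding g_def by auto
    have "(g has_integral ((- a * min \<tau> t1) *\<^sub>R e k + (b * max 0 (\<tau> - (1 - t2))) *\<^sub>R e l)) {0..\<tau>}"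
      unfolding eq using t tau
      by (intro has_integral_add has_integral_scaleR_left has_integral_step_before has_integral_step_after) auto
    then show "X \<tau> = X 0 + integral {0..\<tau>} g"
      unfolding X0 by (simp add: integral_unique X_def algebra_simps)
  qed
  have first: "X \<tau> = (s - a * \<tau>) *\<^sub>R e k" "g \<tau> = - a *\<^sub>R e k" "s - a * \<tau> \<ge> 0" "s \<noteq> 0 \<Longrightarrow> s - a * \<tau> > 0"
    "w \<tau> = c1"
    if "\<tau> \<in> {0..1}" "\<tau> < t1" for \<tau>
  proof -
    show "X \<tau> = (s - a * \<tau>) *\<^sub>R e k" "g \<tau> = - a *\<^sub>R e k" "w \<tau> = c1"
      using that t unfolding X_def g_def w_def by auto
    have eq: "s - a * \<tau> = a * (t1 - \<tau>)" using at by (simp add: algebra_simps)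
    have "a \<ge> 0" "s \<noteq> 0 \<Longrightarrow> a > 0" using sr t pos unfolding a_def by auto
    then show "s - a * \<tau> \<ge> 0" "s \<noteq> 0 \<Longrightarrow> s - a * \<tau> > 0" unfolding eq using that by auto
  qed
  have last: "X \<tau> = (b * (\<tau> - (1 - t2))) *\<^sub>R e l" "g \<tau> = b *\<^sub>R e l" "b * (\<tau> - (1 - t2)) \<ge> 0"
      "r \<noteq> 0 \<Longrightarrow> b * (\<tau> - (1 - t2)) > 0" "w \<tau> = c2"
    if "\<tau> \<in> {0..1}" "\<tau> > 1 - t2" for \<tau>
  proof -
    have m: "min \<tau> t1 = t1" using that t by auto
    show "X \<tau> = (b * (\<tau> - (1 - t2))) *\<^sub>R e l" "g \<tau> = b *\<^sub>R e l" "w \<tau> = c2"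
      using that t at m unfolding X_def g_def w_def by auto
    have "b \<ge> 0" "r \<noteq> 0 \<Longrightarrow> b > 0" using sr t pos unfolding b_def by auto
    then show "b * (\<tau> - (1 - t2)) \<ge> 0" "r \<noteq> 0 \<Longrightarrow> b * (\<tau> - (1 - t2)) > 0" using that by auto
  qed
  have mid: "X \<tau> = 0" "g \<tau> = 0" "w \<tau> = l0" if "\<tau> \<in> {0..1}" "\<tau> \<ge> t1" "\<tau> \<le> 1 - t2" for \<tau>
  proof -
    have "min \<tau> t1 = t1" "max 0 (\<tau> - (1 - t2)) = 0" using that by auto
    then show "X \<tau> = 0" "g \<tau> = 0" "w \<tau> = l0" using that at unfolding X_def g_def w_def by auto
  qed
  have all: "X \<tau> \<in> J \<and> adm_dir N e (X \<tau>) (g \<tau>) \<and> lag N e L (X \<tau>) (g \<tau>) = w \<tau>" if tau: "\<tau> \<in> {0..1}" for \<tau>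
  proof -
    consider "\<tau> < t1" | "\<tau> > 1 - t2" | "\<tau> \<ge> t1" "\<tau> \<le> 1 - t2" by linarith
    then show ?thesis
    proof cases
      case 1
      note F = first[OF tau 1]
      show ?thesis
      proof (cases "s = 0")
        case True
        then have "X \<tau> = 0" "g \<tau> = 0" using F(1,2) by (auto simp: a_def)
        then show ?thesis using F(5) True adm_dir_zero lag_zero scaled_in_J[OF k, of 0] by (simp add: c1_def)
      next
        case False
        have "X \<tau> \<in> branch e k" using F(1,3) scaled_in_branch by simp
        moreover have "X \<tau> \<noteq> 0" using F(1) F(4)[OF False] e_nonzero[OF k] by simp
        ultimately have Xb: "X \<tau> \<in> branch e k - {0}" by blast
        then show ?thesis
          using F False lag_branch[OF k Xb] adm_dir_branch[OF k Xb, of "-a"] branch_subset_J[OF k] k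
          by (auto simp: c1_def)
      qed
    next
      case 2
      note F = last[OF tau 2]
      show ?thesis
      proof (cases "r = 0")
        case True
        then have "X \<tau> = 0" "g \<tau> = 0" using F(1,2) by (auto simp: b_def)
        then show ?thesis using F(5) True adm_dir_zero lag_zero scaled_in_J[OF k, of 0] by (simp add: c2_def)
      next
        case False
        have "X \<tau> \<in> branch e l" using F(1,3) scaled_in_branch by simp
        moreover have "X \<tau> \<noteq> 0" using F(1) F(4)[OF False] e_nonzero[OF l] by (metis less_irrefl scaleR_eq_0_iff)
        ultimately have Xb: "X \<tau> \<in> branch e l - {0}" by blast
        then show ?thesis
          using F False lag_branch[OF l Xb] adm_dir_branch[OF l Xb, of b] branch_subset_J[OF l] l
          by (auto simp: c2_def)
      qed
    next
      case 3
      then show ?thesis using mid[OF tau 3] adm_dir_zero lag_zero scaled_in_J[OF k, of 0] by simp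
    qed
  qed
  have "D0 N e L (X 0) (X 1) \<le> ereal (l0 + ((c1 - l0) * t1 + (c2 - l0) * t2))"
  proof (rule D0_le_path[OF W, of "{}" w])
    have c: "(\<lambda>\<tau>. l0) absolutely_integrable_on {0..1::real}"
      by (rule absolutely_integrable_on_const) simp
    show "w absolutely_integrable_on {0..1}"
      unfolding w_def by (intro set_integral_add c absolutely_integrable_step) auto
    have "((\<lambda>\<tau>. l0) has_integral l0) {0..1::real}" using has_integral_const_real[of l0 0 1] by simp
    moreover have "((\<lambda>\<tau>::real. if \<tau> \<in> {..<t1} then c1 - l0 else 0) has_integral (c1 - l0) * t1) {0..1}"
      using has_integral_step_before[of t1 1 "c1 - l0"] t \<open>min 1 t1 = t1\<close> by (simp del: lessThan_iff)
    moreover have "((\<lambda>\<tau>::real. if \<tau> \<in> {1 - t2<..} then c2 - l0 else 0) has_integral (c2 - l0) * t2) {0..1}"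
      using has_integral_step_after[of "1 - t2" 1 "c2 - l0"] t by (simp del: greaterThan_iff add: max_def)
    ultimately show "(w has_integral (l0 + ((c1 - l0) * t1 + (c2 - l0) * t2))) {0..1}"
      unfolding w_def by (intro has_integral_add)
  qed (use all in auto)
  also have "l0 + ((c1 - l0) * t1 + (c2 - l0) * t2) \<le> t1 * L k (- s / t1) + t2 * L l (r / t2) + (1 - t1 - t2) * l0"
  proof -
    have "c1 * t1 \<le> t1 * L k (- s / t1)"
      using l0_le[OF k] t by (auto simp: c1_def a_def mult.commute intro: mult_left_mono)
    moreover have "c2 * t2 \<le> t2 * L l (r / t2)"
      using l0_le[OF l] t by (auto simp: c2_def b_def mult.commute intro: mult_left_mono)
    ultimately show ?thesis by (simp add: algebra_simps)
  qed
  finally show ?thesis using X0 X1 by simp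
qed

lemma D0_le_straight:
  assumes k: "k \<in> {1..N}" and sr: "s \<ge> 0" "r \<ge> 0"
  shows "D0 N e L (s *\<^sub>R e k) (r *\<^sub>R e k) \<le> ereal (L k (r - s))"
proof (cases "s = 0 \<and> r = 0")
  \<comment> \<open>A motionless path at 0 is charged \<open>l0\<close> instead of
    \<open>L k 0\<close>, so this case is handled by the route with no travel time.\<close>
  case True
  then show ?thesis
    using D0_le_route[OF k k, of 0 0 0 0] l0_le[OF k] by (simp add: order.trans)
next
  case False
  define X where "X = (\<lambda>\<tau>::real. (s + \<tau> * (r - s)) *\<^sub>R e k)"
  define g where "g = (\<lambda>\<tau>::real. (r - s) *\<^sub>R e k)"
  have W: "W11 X g"
    unfolding W11_def
  proof (intro conjI ballI)
    show "g absolutely_integrable_on {0..1}"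
      unfolding g_def by (rule absolutely_integrable_on_const) simp
    fix \<tau> :: real assume "\<tau> \<in> {0..1}"
    then show "X \<tau> = X 0 + integral {0..\<tau>} g"
      unfolding X_def g_def by (simp add: algebra_simps)
  qed
  have nonneg: "s + \<tau> * (r - s) \<ge> 0" if "\<tau> \<in> {0..1}" for \<tau>
  proof -
    have "s + \<tau> * (r - s) = (1 - \<tau>) * s + \<tau> * r" by (simp add: algebra_simps)
    then show ?thesis using that sr by simp
  qed
  have posit: "s + \<tau> * (r - s) > 0" if "\<tau> \<in> {0..1} - {0, 1}" for \<tau>
  proof -
    have "s + \<tau> * (r - s) = (1 - \<tau>) * s + \<tau> * r" by (simp add: algebra_simps)
    moreover have "(1 - \<tau>) * s > 0 \<or> \<tau> * r > 0" "(1 - \<tau>) * s \<ge> 0" "\<tau> * r \<ge> 0"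
      using that sr False by auto
    ultimately show ?thesis by linarith
  qed
  have on: "X \<tau> \<in> branch e k - {0}" if "\<tau> \<in> {0..1} - {0, 1}" for \<tau>
    using posit[OF that] scaled_in_branch[of "s + \<tau> * (r - s)" k] e_nonzero[OF k] unfolding X_def by auto
  have "D0 N e L (X 0) (X 1) \<le> ereal (L k (r - s))"
  proof (rule D0_le_path[OF W, of "{0,1}" "\<lambda>_. L k (r - s)"])
    show "X \<tau> \<in> J" if "\<tau> \<in> {0..1}" for \<tau>
      unfolding X_def using nonneg[OF that] scaled_in_J[OF k] by blast
    show "adm_dir N e (X \<tau>) (g \<tau>)" if "\<tau> \<in> {0..1} - {0,1}" for \<tau>
      unfolding g_def by (rule adm_dir_branch[OF k on[OF that]])
    show "lag N e L (X \<tau>) (g \<tau>) = L k (r - s)" if "\<tau> \<in> {0..1} - {0,1}" for \<tau>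
      using lag_branch[OF k on[OF that]] k by (simp add: g_def)
    show "(\<lambda>_. L k (r - s)) absolutely_integrable_on {0..1::real}"
      by (rule absolutely_integrable_on_const) simp
    show "((\<lambda>_. L k (r - s)) has_integral L k (r - s)) {0..1::real}"
      using has_integral_const_real[of "L k (r - s)" 0 1] by simp
  qed simp
  then show ?thesis by (simp add: X_def)
qed

section \<open>The reduced minimal action in branch coordinates\<close>

definition D :: "nat \<Rightarrow> real \<Rightarrow> nat \<Rightarrow> real \<Rightarrow> real" where
  "D k s l r = real_of_ereal (D0 N e L (s *\<^sub>R e k) (r *\<^sub>R e l))"

text \<open>Finiteness: the tangents at 0 with \<open>\<mu> = l0\<close> give a lower bound, and the
  route that spends half of the time on each leg gives an upper bound.\<close>

lemma D0_eq_D: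
  assumes "k \<in> {1..N}" "l \<in> {1..N}" "s \<ge> 0" "r \<ge> 0"
  shows "D0 N e L (s *\<^sub>R e k) (r *\<^sub>R e l) = ereal (D k s l r)"
proof -
  define c where "c = min (l0 - s * dL k 0 + r * dL l 0) (L l (r - s))"
  have "ereal c \<le> D0 N e L (s *\<^sub>R e k) (r *\<^sub>R e l)"
    using assms l0_le K_zero by (intro D0_lower[where \<mu>=l0 and ?q1.0=0 and ?q2.0=0]) (auto simp: c_def)
  moreover have "D0 N e L (s *\<^sub>R e k) (r *\<^sub>R e l)
      \<le> ereal (1/2 * L k (- s / (1/2)) + 1/2 * L l (r / (1/2)) + (1 - 1/2 - 1/2) * l0)"
    using assms by (intro D0_le_route) auto
  ultimately show ?thesis unfolding D_def
    by (cases "D0 N e L (s *\<^sub>R e k) (r *\<^sub>R e l)") auto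
qed

lemma D_lower:
  assumes "j \<in> {1..N}" "s \<ge> 0" "i \<in> {1..N}" "r \<ge> 0" "\<mu> \<le> l0" "\<mu> \<le> K j q1" "\<mu> \<le> K i q2"
    "c \<le> \<mu> - s * dL j q1 + r * dL i q2" "i = j \<Longrightarrow> s > 0 \<Longrightarrow> r > 0 \<Longrightarrow> c \<le> L i (r - s)"
  shows "c \<le> D j s i r"
  using D0_lower[OF assms] D0_eq_D assms by simp

lemma D_le_route:
  assumes "k \<in> {1..N}" "l \<in> {1..N}" "s \<ge> 0" "r \<ge> 0" "t1 \<ge> 0" "t2 \<ge> 0" "t1 + t2 \<le> 1"
    "s > 0 \<Longrightarrow> t1 > 0" "r > 0 \<Longrightarrow> t2 > 0"
  shows "D k s l r \<le> t1 * L k (- s / t1) + t2 * L l (r / t2) + (1 - t1 - t2) * l0"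
  using D0_le_route[OF assms] D0_eq_D assms by simp

lemma D_le_straight: "k \<in> {1..N} \<Longrightarrow> s \<ge> 0 \<Longrightarrow> r \<ge> 0 \<Longrightarrow> D k s k r \<le> L k (r - s)"
  using D0_le_straight D0_eq_D by simp

text \<open>First-order optimality conditions for the travel times \<open>t1\<close>, \<open>t2\<close> of the two legs of a route
  through the junction point: \<open>\<mu>\<close> is the common marginal cost of time, equal to the cost \<open>l0\<close> of
  waiting unless no time is left for waiting.\<close>

definition leg :: "nat \<Rightarrow> real \<Rightarrow> real \<Rightarrow> real \<Rightarrow> real \<Rightarrow> bool" where
  "leg k v \<mu> t q \<longleftrightarrow> t \<ge> 0 \<and> v = q * t \<and> (v \<noteq> 0 \<longrightarrow> t > 0 \<and> K k q = \<mu>) \<and> (v = 0 \<longrightarrow> t = 0 \<and> q = 0)"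

definition optimal :: "nat \<Rightarrow> real \<Rightarrow> nat \<Rightarrow> real \<Rightarrow> real \<Rightarrow> real \<Rightarrow> real \<Rightarrow> real \<Rightarrow> real \<Rightarrow> bool" where
  "optimal j s i r \<mu> t1 q1 t2 q2 \<longleftrightarrow> \<mu> \<le> l0 \<and> leg j (- s) \<mu> t1 q1 \<and> leg i r \<mu> t2 q2
     \<and> t1 + t2 \<le> 1 \<and> (\<mu> = l0 \<or> t1 + t2 = 1)"

lemma legI: "v \<noteq> 0 \<Longrightarrow> t > 0 \<Longrightarrow> K k (v / t) = \<mu> \<Longrightarrow> leg k v \<mu> t (v / t)"
  unfolding leg_def by auto

lemma leg_zero: "leg k 0 \<mu> 0 0"
  unfolding leg_def by auto

text \<open>The leg takes the whole unit of time if its marginal cost is then at most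
  \<open>l0\<close>. Otherwise waiting is cheaper, and the leg is shortened until the two prices
  agree.\<close>

lemma single_leg:
  assumes "k \<in> {1..N}" "v \<noteq> 0"
  obtains \<mu> t q where "\<mu> \<le> l0" "leg k v \<mu> t q" "t \<le> 1" "\<mu> = l0 \<or> t = 1"
proof (cases "K k (v / 1) \<le> l0")
  case True
  show thesis by (rule that[OF True legI[OF assms(2)]]) auto
next
  case False
  obtain t where "0 < t" "t \<le> 1" "K k (v / t) = l0"
    by (rule unif_convex.K_level[OF convex[OF assms(1)] assms(2), of 1 l0]) (use False in auto)
  then show thesis using that[OF order.refl legI[OF assms(2)]] by auto
qed

text \<open>With two nontrivial legs the unit of time is first divided so that the marginal costs
  agree. If the common value exceeds \<open>l0\<close>, both legs are shortened to the level
  \<open>l0\<close> and the rest of the time is spent waiting.\<close>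

lemma optimal_exists:
  assumes ji: "j \<in> {1..N}" "i \<in> {1..N}"
  obtains \<mu> t1 q1 t2 q2 where "optimal j s i r \<mu> t1 q1 t2 q2"
proof -
  consider "s = 0" "r = 0" | "s \<noteq> 0" "r = 0" | "s = 0" "r \<noteq> 0" | "s \<noteq> 0" "r \<noteq> 0" by blast
  then show thesis
  proof cases
    case 1
    then have "optimal j s i r l0 0 0 0 0" using leg_zero unfolding optimal_def by simp
    then show thesis by (rule that)
  next
    case 2
    obtain \<mu> t q where "\<mu> \<le> l0" "leg j (- s) \<mu> t q" "t \<le> 1" "\<mu> = l0 \<or> t = 1"
      by (rule single_leg[OF ji(1), of "- s"]) (use 2 in auto)
    then have "optimal j s i r \<mu> t q 0 0" using 2 leg_zero unfolding optimal_def by auto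
    then show thesis by (rule that)
  next
    case 3
    obtain \<mu> t q where "\<mu> \<le> l0" "leg i r \<mu> t q" "t \<le> 1" "\<mu> = l0 \<or> t = 1"
      by (rule single_leg[OF ji(2), of r]) (use 3 in auto)
    then have "optimal j s i r \<mu> 0 0 t q" using 3 leg_zero unfolding optimal_def by auto
    then show thesis by (rule that)
  next
    case 4
    obtain t where t: "0 < t" "t < 1" "K j (- s / t) = K i (r / (1 - t))"
      by (rule split_level[OF convex[OF ji(1)] convex[OF ji(2)], of "- s" r]) (use 4 in auto)
    show thesis
    proof (cases "K j (- s / t) \<le> l0")
      case True
      have "leg j (- s) (K j (- s / t)) t (- s / t)" by (rule legI) (use 4 t in auto)
      moreover have "leg i r (K j (- s / t)) (1 - t) (r / (1 - t))" by (rule legI) (use 4 t in auto)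
      ultimately have "optimal j s i r (K j (- s / t)) t (- s / t) (1 - t) (r / (1 - t))"
        unfolding optimal_def using True by simp
      then show thesis by (rule that)
    next
      case False
      obtain a where a: "0 < a" "a \<le> t" "K j (- s / a) = l0"
        by (rule unif_convex.K_level[OF convex[OF ji(1)], of "- s" t l0]) (use 4 t False in auto)
      obtain b where b: "0 < b" "b \<le> 1 - t" "K i (r / b) = l0"
        by (rule unif_convex.K_level[OF convex[OF ji(2)], of r "1 - t" l0]) (use 4 t False in auto)
      have "leg j (- s) l0 a (- s / a)" by (rule legI) (use 4 a in auto)
      moreover have "leg i r l0 b (r / b)" by (rule legI) (use 4 b in auto)
      ultimately have "optimal j s i r l0 a (- s / a) b (r / b)"
        unfolding optimal_def using a b by simp
      then show thesis by (rule that)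
    qed
  qed
qed

text \<open>The identity \<open>L k q = K k q + q * dL k q\<close> multiplied by the time. It brings
  the cost of a leg to the shape of the calibrated lower bound, so that the two can be
  compared.\<close>

lemma leg_cost:
  assumes "k \<in> {1..N}" "leg k v \<mu> t q"
  shows "t * L k (v / t) = t * \<mu> + v * dL k q"
proof (cases "v = 0")
  case False
  then have "t > 0" "v = q * t" "K k q = \<mu>" using assms unfolding leg_def by blast+
  then have vt: "v / t = q" by simp
  have "L k q = \<mu> + q * dL k q" using K_eq[OF assms(1), of q] \<open>K k q = \<mu>\<close> by linarith
  then have "t * L k (v / t) = t * (\<mu> + q * dL k q)" unfolding vt by simp
  also have "\<dots> = t * \<mu> + (q * t) * dL k q" by (simp add: algebra_simps)
  finally show ?thesis using \<open>v = q * t\<close> by simp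
next
  case True
  then have "t = 0" using assms unfolding leg_def by blast
  with True show ?thesis by simp
qed

lemma leg_K_ge:
  assumes "k \<in> {1..N}" "leg k v \<mu> t q" "\<mu> \<le> l0"
  shows "\<mu> \<le> K k q"
proof (cases "v = 0")
  case True
  then have "q = 0" using assms unfolding leg_def by blast
  then show ?thesis using l0_le[OF assms(1)] K_zero[OF assms(1)] assms(3) by simp
next
  case False
  then have "K k q = \<mu>" using assms unfolding leg_def by blast
  then show ?thesis by simp
qed

context
  fixes j i s r \<mu> t1 q1 t2 q2
  assumes ji: "j \<in> {1..N}" "i \<in> {1..N}" and sr: "s \<ge> 0" "r \<ge> 0"
    and opt: "optimal j s i r \<mu> t1 q1 t2 q2"
begin

abbreviation "V \<equiv> \<mu> - s * dL j q1 + r * dL i q2"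

lemma optimal_D_le: "D j s i r \<le> V"
proof -
  note o = opt[unfolded optimal_def]
  have "D j s i r \<le> t1 * L j (- s / t1) + t2 * L i (r / t2) + (1 - t1 - t2) * l0"
  proof (rule D_le_route[OF ji sr])
    show "0 \<le> t1" "0 \<le> t2" "t1 + t2 \<le> 1" using o unfolding leg_def by blast+
    show "0 < t1" if "0 < s" using o that unfolding leg_def by (metis less_irrefl neg_equal_0_iff_equal)
    show "0 < t2" if "0 < r" using o that unfolding leg_def by (metis less_irrefl)
  qed
  also have "\<dots> = (t1 + t2) * \<mu> + (1 - t1 - t2) * l0 - s * dL j q1 + r * dL i q2"
    using leg_cost[OF ji(1), of "- s" \<mu> t1 q1] leg_cost[OF ji(2), of r \<mu> t2 q2] o by (simp add: algebra_simps)
  \<comment> \<open>Complementary slackness: either there is no waiting time, or its price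
    \<open>l0\<close> equals \<open>\<mu>\<close>.\<close>
  also have "(t1 + t2) * \<mu> + (1 - t1 - t2) * l0 = \<mu>"
  proof -
    have "(1 - t1 - t2) * (l0 - \<mu>) = 0" using o by auto
    then show ?thesis by (simp add: algebra_simps)
  qed
  finally show ?thesis .
qed

lemma optimal_K_ge: "\<mu> \<le> l0" "\<mu> \<le> K j q1" "\<mu> \<le> K i q2"
  using opt leg_K_ge[OF ji(1), of "-s" \<mu> t1 q1] leg_K_ge[OF ji(2), of r \<mu> t2 q2]
  unfolding optimal_def by blast+

lemma optimal_D_ge:
  assumes "i = j \<Longrightarrow> s > 0 \<Longrightarrow> r > 0 \<Longrightarrow> c \<le> L i (r - s)" "c \<le> V"
  shows "c \<le> D j s i r"
  by (rule D_lower[OF ji(1) sr(1) ji(2) sr(2) optimal_K_ge assms(2) assms(1)])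

text \<open>No duality gap: \<open>V\<close> is both the cost of the optimal route and its
  calibrated lower bound. Only a cheaper straight path could undercut it.\<close>

lemma optimal_D_eq: "i \<noteq> j \<or> s = 0 \<or> r = 0 \<or> V \<le> L i (r - s) \<Longrightarrow> D j s i r = V"
  using optimal_D_le optimal_D_ge[of V] by (intro antisym) auto

lemma straight_D_eq: "i = j \<Longrightarrow> L i (r - s) \<le> V \<Longrightarrow> D j s i r = L i (r - s)"
  using optimal_D_ge[of "L i (r - s)"] D_le_straight[OF ji(1) sr] by (intro antisym) auto

text \<open>The inequalities on \<open>\<mu>\<close> in \<open>D_lower\<close> do not involve the
  endpoints, so the multipliers found at one base point give lower bounds everywhere, continuous and
  exact at the base point.\<close>

lemma lower_support:
  obtains f where "continuous_on UNIV f" "\<And>s' r'. s' \<ge> 0 \<Longrightarrow> r' \<ge> 0 \<Longrightarrow> f (s', r') \<le> D j s' i r'"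
    "f (s, r) = D j s i r"
proof -
  define g where "g = (\<lambda>p::real \<times> real. \<mu> - fst p * dL j q1 + snd p * dL i q2)"
  define f where "f = (\<lambda>p. if i = j then min (g p) (L i (snd p - fst p)) else g p)"
  have g_cont: "continuous_on UNIV g" unfolding g_def by (intro continuous_intros)
  have L_cont: "continuous_on UNIV (\<lambda>p::real \<times> real. L i (snd p - fst p))"
    by (intro continuous_on_compose2[OF unif_convex.cont0[OF convex[OF ji(2)], of UNIV]] continuous_intros) auto
  show thesis
  proof (rule that[of f])
    show "continuous_on UNIV f"
      unfolding f_def using g_cont L_cont by (cases "i = j") (auto intro!: continuous_intros)
    show "f (s', r') \<le> D j s' i r'" if "s' \<ge> 0" "r' \<ge> 0" for s' r'
      by (rule D_lower[OF ji(1) that(1) ji(2) that(2) optimal_K_ge]) (auto simp: f_def g_def)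
    have "f (s, r) = (if i = j then min V (L i (r - s)) else V)" by (simp add: f_def g_def)
    also have "\<dots> = D j s i r"
    proof (cases "i = j \<and> L i (r - s) \<le> V")
      case True
      then show ?thesis using straight_D_eq by auto
    next
      case False
      then show ?thesis using optimal_D_eq by auto
    qed
    finally show "f (s, r) = D j s i r" .
  qed
qed

end

end

section \<open>Upper expansions of the minimal action\<close>

text \<open>The exponent comes from \<open>short_leg_zero\<close>: an error \<open>s\<^sup>2 / t + t\<^sup>2\<close> is smallest for \<open>t\<close> of order \<open>s powr (2/3)\<close>.\<close>

definition omega :: "real \<Rightarrow> real" where "omega z = \<bar>z\<bar> powr (4/3)"

lemma omega_nonneg [simp]: "omega z \<ge> 0" unfolding omega_def by simp

lemma omega_0 [simp]: "omega 0 = 0" unfolding omega_def by simp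

lemma omega_uminus [simp]: "omega (- z) = omega z" unfolding omega_def by simp

lemma square_le_omega:
  assumes "\<bar>z\<bar> \<le> 1"
  shows "z\<^sup>2 \<le> omega z"
proof (cases "z = 0")
  case False
  then have "\<bar>z\<bar> powr 2 \<le> \<bar>z\<bar> powr (4/3)"
    using assms by (intro powr_mono') auto
  then show ?thesis unfolding omega_def by (simp add: powr_numeral False)
qed simp

lemma omega_le_abs:
  assumes "\<bar>z\<bar> \<le> 1"
  shows "omega z \<le> \<bar>z\<bar>"
proof (cases "z = 0")
  case False
  then have "\<bar>z\<bar> powr (4/3) \<le> \<bar>z\<bar> powr 1"
    using assms by (intro powr_mono') auto
  then show ?thesis unfolding omega_def by (simp add: False)
qed simp

lemma sum_square_le: "(x + y)\<^sup>2 \<le> 2 * x\<^sup>2 + 2 * (y::real)\<^sup>2"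
  using sum_squares_bound[of x y] by (simp add: power2_sum)

text \<open>A regular leg can give up a small amount \<open>\<tau>\<close> of its time \<open>t0\<close> at price \<open>\<mu>\<close>; a short leg starts from
  length \<open>0\<close> and uses time bought at that price. In both cases \<open>c\<close> is the slope of the cost in the length.\<close>

definition regular_leg :: "(real \<Rightarrow> real) \<Rightarrow> real \<Rightarrow> real \<Rightarrow> real \<Rightarrow> real \<Rightarrow> bool" where
  "regular_leg f s0 t0 \<mu> c \<longleftrightarrow> (\<exists>M\<ge>0. \<exists>\<delta>>0. \<forall>s \<tau>. \<bar>s - s0\<bar> \<le> \<delta> \<longrightarrow> 0 \<le> \<tau> \<longrightarrow> \<tau> \<le> \<delta> \<longrightarrow>
      0 < t0 - \<tau> \<and> (t0 - \<tau>) * f (s / (t0 - \<tau>)) \<le> (t0 - \<tau>) * \<mu> + c * s + M * ((s - s0)\<^sup>2 + \<tau>\<^sup>2))"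

definition short_leg :: "(real \<Rightarrow> real) \<Rightarrow> real \<Rightarrow> real \<Rightarrow> bool" where
  "short_leg f \<mu> c \<longleftrightarrow> (\<exists>M\<ge>0. \<forall>s\<in>{0..1}. \<exists>t\<ge>0. (s > 0 \<longrightarrow> t > 0) \<and>
      t * f (s / t) \<le> t * \<mu> + c * s + M * omega s \<and> t\<^sup>2 \<le> M * omega s)"

context unif_convex
begin

text \<open>The cost \<open>T * f (s / T)\<close> is homogeneous of degree 1 in \<open>s\<close> and
  \<open>T\<close>, so its tangent plane at \<open>(s0, t0)\<close> is
  \<open>T * K q + f' q * s\<close> without a constant; the remainder is quadratic as long as
  \<open>T\<close> stays away from 0.\<close>

lemma regular_legI:
  assumes t0: "t0 > 0"
  shows "regular_leg f (q * t0) t0 (K q) (f' q)"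
proof -
  define s0 where "s0 = q * t0"
  \<comment> \<open>A bound for all speeds \<open>s / T\<close> with
    \<open>\<bar>s - s0\<bar> <= 1\<close> and \<open>T >= t0 / 2\<close>.\<close>
  define B where "B = (\<bar>s0\<bar> + 1) * 2 / t0"
  obtain C where C: "C \<ge> 0" "\<And>u q. \<bar>u\<bar> \<le> B \<Longrightarrow> \<bar>q\<bar> \<le> B \<Longrightarrow> f u \<le> f q + f' q * (u - q) + C * (u - q)\<^sup>2"
    using taylor_upper[of B] by blast
  define \<delta> where "\<delta> = min 1 (t0 / 2)"
  define M where "M = C * (4 / t0 * (1 + q\<^sup>2))"
  have qB: "\<bar>q\<bar> \<le> B"
  proof -
    have "\<bar>q\<bar> = \<bar>s0\<bar> / t0" using t0 by (simp add: s0_def abs_mult)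
    also have "\<dots> \<le> B" unfolding B_def using t0 by (intro divide_right_mono) auto
    finally show ?thesis .
  qed
  have main: "0 < t0 - \<tau> \<and> (t0 - \<tau>) * f (s / (t0 - \<tau>)) \<le> (t0 - \<tau>) * K q + f' q * s + M * ((s - s0)\<^sup>2 + \<tau>\<^sup>2)"
    if st: "\<bar>s - s0\<bar> \<le> \<delta>" "0 \<le> \<tau>" "\<tau> \<le> \<delta>" for s \<tau>
  proof -
    define T where "T = t0 - \<tau>"
    have T: "T \<ge> t0 / 2" "T > 0" using st t0 unfolding T_def \<delta>_def by auto
    define u where "u = s / T"
    have s_eq: "s = u * T" using T by (simp add: u_def)
    have uB: "\<bar>u\<bar> \<le> B"
    proof -
      have "\<bar>s\<bar> \<le> \<bar>s0\<bar> + 1" using st unfolding \<delta>_def by linarith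
      then have "\<bar>u\<bar> \<le> (\<bar>s0\<bar> + 1) / T" using T by (simp add: u_def abs_divide divide_right_mono)
      also have "\<dots> \<le> (\<bar>s0\<bar> + 1) / (t0 / 2)" using T t0 by (intro divide_left_mono) auto
      finally show ?thesis by (simp add: B_def)
    qed
    have "T * f u \<le> T * (f q + f' q * (u - q) + C * (u - q)\<^sup>2)"
      using C(2)[OF uB qB] T by (intro mult_left_mono) auto
    also have "\<dots> = T * K q + f' q * s + C * (T * (u - q)\<^sup>2)"
      unfolding K_def s_eq by (simp add: algebra_simps)
    also have "C * (T * (u - q)\<^sup>2) \<le> M * ((s - s0)\<^sup>2 + \<tau>\<^sup>2)"
    proof -
      have "T * (u - q)\<^sup>2 = ((s - s0) + q * \<tau>)\<^sup>2 / T"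
      proof -
        have "(s - s0) + q * \<tau> = T * (u - q)" unfolding s_eq s0_def T_def by (simp add: algebra_simps)
        then show ?thesis using T by (simp add: power2_eq_square)
      qed
      also have "\<dots> \<le> ((s - s0) + q * \<tau>)\<^sup>2 / (t0 / 2)"
        using T t0 by (intro divide_left_mono) auto
      also have "\<dots> \<le> (2 * (s - s0)\<^sup>2 + 2 * (q * \<tau>)\<^sup>2) / (t0 / 2)"
        using t0 sum_square_le by (intro divide_right_mono) auto
      also have "\<dots> \<le> 4 / t0 * (1 + q\<^sup>2) * ((s - s0)\<^sup>2 + \<tau>\<^sup>2)"
      proof -
        have "(s - s0)\<^sup>2 + (q * \<tau>)\<^sup>2 \<le> (1 + q\<^sup>2) * ((s - s0)\<^sup>2 + \<tau>\<^sup>2)"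
          by (simp add: power_mult_distrib algebra_simps)
        then have "4 / t0 * ((s - s0)\<^sup>2 + (q * \<tau>)\<^sup>2) \<le> 4 / t0 * ((1 + q\<^sup>2) * ((s - s0)\<^sup>2 + \<tau>\<^sup>2))"
          using t0 by (intro mult_left_mono) auto
        then show ?thesis by (simp add: algebra_simps add_divide_distrib)
      qed
      finally have "T * (u - q)\<^sup>2 \<le> 4 / t0 * (1 + q\<^sup>2) * ((s - s0)\<^sup>2 + \<tau>\<^sup>2)" .
      then have "C * (T * (u - q)\<^sup>2) \<le> C * (4 / t0 * (1 + q\<^sup>2) * ((s - s0)\<^sup>2 + \<tau>\<^sup>2))"
        using C(1) by (rule mult_left_mono)
      then show ?thesis by (simp add: M_def mult.assoc)
    qed
    finally show ?thesis using T unfolding u_def T_def by simp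
  qed
  moreover have "\<delta> > 0" "M \<ge> 0" using t0 C(1) unfolding \<delta>_def M_def by auto
  ultimately show ?thesis unfolding regular_leg_def s0_def by blast
qed

text \<open>Travelling at speed \<open>q\<close>, hence for the time \<open>s / q\<close>, has
  exactly the claimed linear cost; the constant only serves the bound on the squared time.\<close>

lemma short_leg_pos:
  assumes "q > 0"
  shows "short_leg f (K q) (f' q)"
  unfolding short_leg_def
proof (rule exI[of _ "1 / q\<^sup>2"], intro conjI ballI)
  fix s :: real assume s: "s \<in> {0..1}"
  have "s / q \<ge> 0" "s > 0 \<Longrightarrow> s / q > 0" using s assms by auto
  moreover have "s / q * f (s / (s / q)) \<le> s / q * K q + f' q * s + 1 / q\<^sup>2 * omega s"
  proof -
    have "s / q * f (s / (s / q)) = s / q * K q + f' q * s"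
      using assms by (cases "s = 0") (auto simp: K_def field_simps)
    then show ?thesis by simp
  qed
  moreover have "(s / q)\<^sup>2 \<le> 1 / q\<^sup>2 * omega s"
  proof -
    have "s\<^sup>2 \<le> omega s" using s by (intro square_le_omega) auto
    then have "s\<^sup>2 / q\<^sup>2 \<le> omega s / q\<^sup>2" by (intro divide_right_mono) auto
    then show ?thesis by (simp add: power_divide)
  qed
  ultimately show "\<exists>t\<ge>0. (s > 0 \<longrightarrow> t > 0) \<and> t * f (s / t) \<le> t * K q + f' q * s + 1 / q\<^sup>2 * omega s
      \<and> t\<^sup>2 \<le> 1 / q\<^sup>2 * omega s" by blast
qed simp

text \<open>No distance is covered at speed 0, so the speed \<open>s powr (1/3)\<close> is used: it
  tends to 0, and both the Taylor error \<open>t * (s / t)\<^sup>2\<close> and the squared time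
  equal \<open>omega s\<close>.\<close>

lemma short_leg_zero: "short_leg f (f 0) (f' 0)"
proof -
  obtain C where C: "C \<ge> 0" "\<And>u q. \<bar>u\<bar> \<le> 1 \<Longrightarrow> \<bar>q\<bar> \<le> 1 \<Longrightarrow> f u \<le> f q + f' q * (u - q) + C * (u - q)\<^sup>2"
    using taylor_upper[of 1] by blast
  have "\<exists>t\<ge>0. (s > 0 \<longrightarrow> t > 0) \<and> t * f (s / t) \<le> t * f 0 + f' 0 * s + (C + 1) * omega s
      \<and> t\<^sup>2 \<le> (C + 1) * omega s" if s: "s \<in> {0..1}" for s
  proof (cases "s = 0")
    case False
    then have s0: "s > 0" using s by simp
    define t where "t = s powr (2/3)"
    have t: "t > 0" using s0 by (simp add: t_def)
    have t2: "t\<^sup>2 = omega s" unfolding t_def omega_def using s0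
      by (simp add: powr_power)
    have u: "s / t = s powr (1/3)"
      unfolding t_def using s0 powr_diff[of s 1 "2/3"] by simp
    have "\<bar>s / t\<bar> \<le> 1" unfolding u using s s0 by (simp add: powr_le1)
    then have "f (s / t) \<le> f 0 + f' 0 * (s / t) + C * (s / t)\<^sup>2" using C(2)[of "s / t" 0] by simp
    then have "t * f (s / t) \<le> t * (f 0 + f' 0 * (s / t) + C * (s / t)\<^sup>2)" using t by (intro mult_left_mono) auto
    also have "\<dots> = t * f 0 + f' 0 * s + C * (t * (s / t)\<^sup>2)" using t by (simp add: algebra_simps)
    also have "t * (s / t)\<^sup>2 = omega s"
    proof -
      have "t * (s / t)\<^sup>2 = s * (s / t)" using t by (simp add: power2_eq_square)
      also have "\<dots> = s powr 1 * s powr (1/3)" using u s0 by simp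
      also have "\<dots> = omega s" unfolding omega_def using s0 powr_add[of s 1 "1/3"] by simp
      finally show ?thesis .
    qed
    finally have "t * f (s / t) \<le> t * f 0 + f' 0 * s + (C + 1) * omega s"
      using omega_nonneg[of s] unfolding distrib_right by linarith
    moreover have "t\<^sup>2 \<le> (C + 1) * omega s" using t2 C(1) by (simp add: algebra_simps)
    ultimately show ?thesis using t by (intro exI[of _ t]) auto
  qed (auto intro!: exI[of _ 0])
  then show ?thesis unfolding short_leg_def using C(1) by (intro exI[of _ "C + 1"]) auto
qed

lemma short_leg_level:
  assumes "q \<ge> 0"
  shows "short_leg f (K q) (f' q)"
  using short_leg_pos[of q] short_leg_zero assms by (cases "q = 0") auto

text \<open>A deliberately simple leg at speed 1, usually dearer than the best one. It is used where
  a slope only has to be steep.\<close>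

lemma short_leg_unit_speed: "short_leg f \<mu> (f 1 - \<mu>)"
  unfolding short_leg_def
proof (rule exI[of _ 1], intro conjI ballI)
  fix s :: real assume s: "s \<in> {0..1}"
  have "s * f (s / s) \<le> s * \<mu> + (f 1 - \<mu>) * s + 1 * omega s"
    by (cases "s = 0") (auto simp: algebra_simps)
  moreover have "s\<^sup>2 \<le> 1 * omega s" using s square_le_omega[of s] by simp
  ultimately show "\<exists>t\<ge>0. (s > 0 \<longrightarrow> t > 0) \<and> t * f (s / t) \<le> t * \<mu> + (f 1 - \<mu>) * s + 1 * omega s
      \<and> t\<^sup>2 \<le> 1 * omega s" using s by (intro exI[of _ s]) auto
qed simp

lemma K_level_nonpos:
  assumes "\<mu> \<le> f 0"
  obtains q where "q \<le> 0" "K q = \<mu>"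
proof -
  \<comment> \<open>Chosen so that \<open>\<gamma> / 2 * Q >= f 0 - \<mu>\<close>; since
    \<open>Q >= 1\<close>, the quadratic decay of \<open>K\<close> has passed the level
    \<open>\<mu>\<close> at \<open>- Q\<close>.\<close>
  define Q where "Q = 1 + 2 * (f 0 - \<mu>) / \<gamma>"
  have Q: "Q \<ge> 1" using assms gamma_pos by (simp add: Q_def)
  have "f 0 - \<mu> \<le> \<gamma> / 2 * Q" using gamma_pos assms by (simp add: Q_def field_simps)
  also have "\<dots> \<le> \<gamma> / 2 * Q\<^sup>2" using Q gamma_pos by (simp add: power2_eq_square)
  finally have "K (- Q) \<le> \<mu>" using K_upper[of "- Q"] by simp
  then have "\<exists>q\<ge>- Q. q \<le> 0 \<and> K q = \<mu>"
    using assms Q by (intro IVT' contK) auto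
  then show thesis using that by auto
qed

text \<open>A leg towards 0 has a nonpositive speed; reflection reduces it to the results on legs
  that start at 0.\<close>

lemma reflect: "unif_convex (\<lambda>u. f (- u)) (\<lambda>u. - f' (- u)) (\<lambda>u. f'' (- u)) \<gamma>"
proof
  show "0 < \<gamma>" by (rule gamma_pos)
  show "((\<lambda>u. f (- u)) has_real_derivative - f' (- q)) (at q)" for q
  proof -
    have "((\<lambda>u. f (- u)) has_real_derivative f' (- q) * (- 1)) (at q)"
      by (rule DERIV_chain2[where g=uminus and x=q, OF deriv1]) (auto intro!: derivative_eq_intros)
    then show ?thesis by simp
  qed
  show "((\<lambda>u. - f' (- u)) has_real_derivative f'' (- q)) (at q)" for q
  proof -
    have "((\<lambda>u. f' (- u)) has_real_derivative f'' (- q) * (- 1)) (at q)"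
      by (rule DERIV_chain2[where g=uminus and x=q, OF deriv2]) (auto intro!: derivative_eq_intros)
    then show ?thesis using DERIV_minus by fastforce
  qed
  show "continuous_on UNIV (\<lambda>u. f'' (- u))"
    by (intro continuous_on_compose2[OF cont2] continuous_intros) auto
  show "\<gamma> \<le> f'' (- q)" for q by (rule lower2)
qed

end

lemma small_time:
  assumes "M \<ge> 0" "\<epsilon> > 0"
  shows "\<exists>\<delta>. \<delta> > 0 \<and> \<delta> \<le> 1 \<and> \<delta> \<le> \<epsilon> \<and> (\<forall>t z. t\<^sup>2 \<le> M * omega z \<longrightarrow> \<bar>z\<bar> \<le> \<delta> \<longrightarrow> t \<le> \<epsilon>)"
proof -
  \<comment> \<open>The cap 1 allows \<open>omega z <= \<bar>z\<bar>\<close>; dividing by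
    \<open>M + 1\<close> avoids a vanishing denominator.\<close>
  define \<delta> where "\<delta> = min 1 (min \<epsilon> (\<epsilon>\<^sup>2 / (M + 1)))"
  have pos: "\<delta> > 0" using assms unfolding \<delta>_def by (simp add: divide_pos_pos add_nonneg_pos)
  have "M * \<delta> \<le> (M + 1) * \<delta>" using pos by simp
  also have "\<dots> \<le> (M + 1) * (\<epsilon>\<^sup>2 / (M + 1))" using assms unfolding \<delta>_def by (intro mult_left_mono) auto
  also have "\<dots> = \<epsilon>\<^sup>2" using assms by simp
  finally have le: "M * \<delta> \<le> \<epsilon>\<^sup>2" .
  show ?thesis
  proof (rule exI[of _ \<delta>], intro conjI allI impI)
    fix t z assume t: "t\<^sup>2 \<le> M * omega z" and z: "\<bar>z\<bar> \<le> \<delta>"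
    have "omega z \<le> \<delta>" using omega_le_abs[of z] z unfolding \<delta>_def by simp
    then have "M * omega z \<le> M * \<delta>" using assms(1) by (rule mult_left_mono)
    then have "t\<^sup>2 \<le> \<epsilon>\<^sup>2" using t le by linarith
    then show "t \<le> \<epsilon>" using assms(2) by (rule power2_le_imp_le[OF _ less_imp_le])
  qed (use pos in \<open>auto simp: \<delta>_def\<close>)
qed

section \<open>Upper expansions of the minimal action at a base point\<close>

context junction_lagrangian
begin

text \<open>Only the upper half of differentiability, since test functions touch from above. If the
  base point has a zero coordinate, the branch \<open>k\<close> or \<open>l\<close> of the nearby
  points may be any branch.\<close>

definition upper_expansion :: "nat \<Rightarrow> real \<Rightarrow> nat \<Rightarrow> real \<Rightarrow> real \<Rightarrow> real \<Rightarrow> real \<Rightarrow> bool" where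
  "upper_expansion k s0 l r0 v a b \<longleftrightarrow> (\<exists>M\<ge>0. \<exists>\<delta>>0. \<forall>s r. s \<ge> 0 \<longrightarrow> r \<ge> 0 \<longrightarrow> \<bar>s - s0\<bar> \<le> \<delta> \<longrightarrow> \<bar>r - r0\<bar> \<le> \<delta> \<longrightarrow>
      D k s l r \<le> v + a * (s - s0) + b * (r - r0) + M * (omega (s - s0) + omega (r - r0)))"

lemma D_le_times:
  assumes "k \<in> {1..N}" "l \<in> {1..N}" "s \<ge> 0" "r \<ge> 0" "t1 \<ge> 0" "t2 \<ge> 0" "t1 + t2 \<le> 1"
    "s > 0 \<longrightarrow> t1 > 0" "r > 0 \<longrightarrow> t2 > 0"
    "t1 * L k (- (s / t1)) \<le> A" "t2 * L l (r / t2) \<le> B"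
  shows "D k s l r \<le> A + B + (1 - t1 - t2) * l0"
proof -
  have "D k s l r \<le> t1 * L k (- s / t1) + t2 * L l (r / t2) + (1 - t1 - t2) * l0"
    by (rule D_le_route[OF assms(1-7)]) (use assms(8,9) in blast)+
  also have "- s / t1 = - (s / t1)" by simp
  also have "t1 * L k (- (s / t1)) + t2 * L l (r / t2) + (1 - t1 - t2) * l0 \<le> A + B + (1 - t1 - t2) * l0"
    using assms(10,11) by (intro add_mono) auto
  finally show ?thesis .
qed

text \<open>The competitors keep the travel times \<open>t1\<close> and \<open>t2\<close> of the
  base route, so no time is traded and the errors are purely quadratic.\<close>

lemma upper_expansion_regular:
  assumes kl: "k \<in> {1..N}" "l \<in> {1..N}"
    and y: "regular_leg (\<lambda>u. L k (- u)) s0 t1 \<mu> c" and x: "regular_leg (L l) r0 t2 \<mu> c'"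
    and t: "t1 + t2 \<le> 1" "\<mu> = l0 \<or> t1 + t2 = 1"
  shows "upper_expansion k s0 l r0 (\<mu> + c * s0 + c' * r0) c c'"
proof -
  obtain M1 \<delta>1 where 1: "M1 \<ge> 0" "\<delta>1 > 0" "\<And>s \<tau>. \<bar>s - s0\<bar> \<le> \<delta>1 \<Longrightarrow> 0 \<le> \<tau> \<Longrightarrow> \<tau> \<le> \<delta>1 \<Longrightarrow>
      0 < t1 - \<tau> \<and> (t1 - \<tau>) * L k (- (s / (t1 - \<tau>))) \<le> (t1 - \<tau>) * \<mu> + c * s + M1 * ((s - s0)\<^sup>2 + \<tau>\<^sup>2)"
    using y unfolding regular_leg_def by blast
  obtain M2 \<delta>2 where 2: "M2 \<ge> 0" "\<delta>2 > 0" "\<And>r \<tau>. \<bar>r - r0\<bar> \<le> \<delta>2 \<Longrightarrow> 0 \<le> \<tau> \<Longrightarrow> \<tau> \<le> \<delta>2 \<Longrightarrow>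
      0 < t2 - \<tau> \<and> (t2 - \<tau>) * L l (r / (t2 - \<tau>)) \<le> (t2 - \<tau>) * \<mu> + c' * r + M2 * ((r - r0)\<^sup>2 + \<tau>\<^sup>2)"
    using x unfolding regular_leg_def by blast
  \<comment> \<open>The waiting time is priced at \<open>l0\<close>, which is \<open>\<mu>\<close>
    unless there is none.\<close>
  have idle: "t1 * \<mu> + t2 * \<mu> + (1 - t1 - t2) * l0 = \<mu>"
  proof -
    have "(1 - t1 - t2) * (l0 - \<mu>) = 0" using t by auto
    then show ?thesis by (simp add: algebra_simps)
  qed
  show ?thesis
    unfolding upper_expansion_def
  proof (rule exI[of _ "M1 + M2"], intro conjI, use 1(1) 2(1) in simp,
      rule exI[of _ "min 1 (min \<delta>1 \<delta>2)"], intro conjI allI impI)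
    fix s r assume sr: "s \<ge> 0" "r \<ge> 0" "\<bar>s - s0\<bar> \<le> min 1 (min \<delta>1 \<delta>2)" "\<bar>r - r0\<bar> \<le> min 1 (min \<delta>1 \<delta>2)"
    have a: "0 < t1" "t1 * L k (- (s / t1)) \<le> t1 * \<mu> + c * s + M1 * (s - s0)\<^sup>2"
      using 1(3)[of s 0] 1(2) sr by auto
    have b: "0 < t2" "t2 * L l (r / t2) \<le> t2 * \<mu> + c' * r + M2 * (r - r0)\<^sup>2"
      using 2(3)[of r 0] 2(2) sr by auto
    have "D k s l r \<le> (t1 * \<mu> + c * s + M1 * (s - s0)\<^sup>2) + (t2 * \<mu> + c' * r + M2 * (r - r0)\<^sup>2) + (1 - t1 - t2) * l0"
      using sr(1,2) a b t(1) by (intro D_le_times[OF kl]) auto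
    moreover have "M1 * (s - s0)\<^sup>2 \<le> M1 * omega (s - s0)" "M2 * (r - r0)\<^sup>2 \<le> M2 * omega (r - r0)"
      using 1(1) 2(1) sr by (auto intro!: mult_left_mono square_le_omega)
    moreover have "M1 * omega (r - r0) \<ge> 0" "M2 * omega (s - s0) \<ge> 0" using 1(1) 2(1) by simp_all
    ultimately show "D k s l r \<le> (\<mu> + c * s0 + c' * r0) + c * (s - s0) + c' * (r - r0)
        + (M1 + M2) * (omega (s - s0) + omega (r - r0))"
      using idle by (simp add: algebra_simps)
  qed (use 1(2) 2(2) in simp)
qed

text \<open>The time of the new short leg is taken from the regular leg. Both price it at
  \<open>\<mu>\<close>, so the first-order terms in time cancel; the remaining error
  \<open>M1 * t\<^sup>2\<close> is why \<open>short_leg\<close> bounds the squared time by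
  \<open>omega\<close>.\<close>

lemma upper_expansion_regular_short:
  assumes kl: "k \<in> {1..N}" "l \<in> {1..N}"
    and y: "regular_leg (\<lambda>u. L k (- u)) s0 t1 \<mu> c" and x: "short_leg (L l) \<mu> c'"
    and t: "t1 \<le> 1" "\<mu> = l0 \<or> t1 = 1"
  shows "upper_expansion k s0 l 0 (\<mu> + c * s0) c c'"
proof -
  obtain M1 \<delta>1 where 1: "M1 \<ge> 0" "\<delta>1 > 0" "\<And>s \<tau>. \<bar>s - s0\<bar> \<le> \<delta>1 \<Longrightarrow> 0 \<le> \<tau> \<Longrightarrow> \<tau> \<le> \<delta>1 \<Longrightarrow>
      0 < t1 - \<tau> \<and> (t1 - \<tau>) * L k (- (s / (t1 - \<tau>))) \<le> (t1 - \<tau>) * \<mu> + c * s + M1 * ((s - s0)\<^sup>2 + \<tau>\<^sup>2)"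
    using y unfolding regular_leg_def by blast
  obtain M2 where 2: "M2 \<ge> 0" "\<And>r. r \<in> {0..1} \<Longrightarrow> \<exists>t\<ge>0. (r > 0 \<longrightarrow> t > 0) \<and>
      t * L l (r / t) \<le> t * \<mu> + c' * r + M2 * omega r \<and> t\<^sup>2 \<le> M2 * omega r"
    using x unfolding short_leg_def by blast
  have idle: "t1 * \<mu> + (1 - t1) * l0 = \<mu>"
  proof -
    have "(1 - t1) * (l0 - \<mu>) = 0" using t by auto
    then show ?thesis by (simp add: algebra_simps)
  qed
  from small_time[OF 2(1) 1(2)] obtain \<delta> where \<delta>: "\<delta> > 0" "\<delta> \<le> 1" "\<delta> \<le> \<delta>1"
    "\<forall>t z. t\<^sup>2 \<le> M2 * omega z \<longrightarrow> \<bar>z\<bar> \<le> \<delta> \<longrightarrow> t \<le> \<delta>1"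
    by (elim exE conjE)
  show ?thesis
    unfolding upper_expansion_def
  proof (rule exI[of _ "M1 + M1 * M2 + M2"], intro conjI, use 1(1) 2(1) in simp,
      rule exI[of _ \<delta>], intro conjI allI impI)
    fix s r assume sr: "s \<ge> 0" "r \<ge> 0" "\<bar>s - s0\<bar> \<le> \<delta>" "\<bar>r - 0\<bar> \<le> \<delta>"
    have "r \<in> {0..1}" using sr \<delta>(2) by simp
    from 2(2)[OF this] obtain t where t': "t \<ge> 0" "r > 0 \<longrightarrow> t > 0"
      "t * L l (r / t) \<le> t * \<mu> + c' * r + M2 * omega r" "t\<^sup>2 \<le> M2 * omega r" by blast
    have "t \<le> \<delta>1" by (rule \<delta>(4)[rule_format, OF t'(4)]) (use sr in simp)
    then have a: "0 < t1 - t" "(t1 - t) * L k (- (s / (t1 - t))) \<le> (t1 - t) * \<mu> + c * s + M1 * ((s - s0)\<^sup>2 + t\<^sup>2)"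
      using 1(3)[of s t] t'(1) sr \<delta>(3) by auto
    have "D k s l r \<le> ((t1 - t) * \<mu> + c * s + M1 * ((s - s0)\<^sup>2 + t\<^sup>2)) + (t * \<mu> + c' * r + M2 * omega r) + (1 - (t1 - t) - t) * l0"
      using sr(1,2) a t(1) t' by (intro D_le_times[OF kl]) auto
    moreover have "M1 * (s - s0)\<^sup>2 \<le> M1 * omega (s - s0)" "M1 * t\<^sup>2 \<le> M1 * (M2 * omega r)"
      using 1(1) 2(1) sr \<delta>(2) t' by (auto intro!: mult_left_mono square_le_omega)
    moreover have "M1 * omega r \<ge> 0" "M2 * omega (s - s0) \<ge> 0" "M1 * M2 * omega (s - s0) \<ge> 0" using 1(1) 2(1) by simp_all
    ultimately show "D k s l r \<le> (\<mu> + c * s0) + c * (s - s0) + c' * (r - 0)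
        + (M1 + M1 * M2 + M2) * (omega (s - s0) + omega (r - 0))"
      using idle by (simp add: algebra_simps)
  qed (use \<delta>(1) in simp)
qed

lemma upper_expansion_short_regular:
  assumes kl: "k \<in> {1..N}" "l \<in> {1..N}"
    and y: "short_leg (\<lambda>u. L k (- u)) \<mu> c" and x: "regular_leg (L l) r0 t2 \<mu> c'"
    and t: "t2 \<le> 1" "\<mu> = l0 \<or> t2 = 1"
  shows "upper_expansion k 0 l r0 (\<mu> + c' * r0) c c'"
proof -
  obtain M1 \<delta>1 where 1: "M1 \<ge> 0" "\<delta>1 > 0" "\<And>s \<tau>. \<bar>s - r0\<bar> \<le> \<delta>1 \<Longrightarrow> 0 \<le> \<tau> \<Longrightarrow> \<tau> \<le> \<delta>1 \<Longrightarrow>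
      0 < t2 - \<tau> \<and> (t2 - \<tau>) * L l (s / (t2 - \<tau>)) \<le> (t2 - \<tau>) * \<mu> + c' * s + M1 * ((s - r0)\<^sup>2 + \<tau>\<^sup>2)"
    using x unfolding regular_leg_def by blast
  obtain M2 where 2: "M2 \<ge> 0" "\<And>r. r \<in> {0..1} \<Longrightarrow> \<exists>t\<ge>0. (r > 0 \<longrightarrow> t > 0) \<and>
      t * L k (- (r / t)) \<le> t * \<mu> + c * r + M2 * omega r \<and> t\<^sup>2 \<le> M2 * omega r"
    using y unfolding short_leg_def by blast
  have idle: "t2 * \<mu> + (1 - t2) * l0 = \<mu>"
  proof -
    have "(1 - t2) * (l0 - \<mu>) = 0" using t by auto
    then show ?thesis by (simp add: algebra_simps)
  qed
  from small_time[OF 2(1) 1(2)] obtain \<delta> where \<delta>: "\<delta> > 0" "\<delta> \<le> 1" "\<delta> \<le> \<delta>1"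
    "\<forall>t z. t\<^sup>2 \<le> M2 * omega z \<longrightarrow> \<bar>z\<bar> \<le> \<delta> \<longrightarrow> t \<le> \<delta>1"
    by (elim exE conjE)
  show ?thesis
    unfolding upper_expansion_def
  proof (rule exI[of _ "M1 + M1 * M2 + M2"], intro conjI, use 1(1) 2(1) in simp,
      rule exI[of _ \<delta>], intro conjI allI impI)
    fix s r assume sr: "s \<ge> 0" "r \<ge> 0" "\<bar>s - 0\<bar> \<le> \<delta>" "\<bar>r - r0\<bar> \<le> \<delta>"
    have "s \<in> {0..1}" using sr \<delta>(2) by simp
    from 2(2)[OF this] obtain t where t': "t \<ge> 0" "s > 0 \<longrightarrow> t > 0"
      "t * L k (- (s / t)) \<le> t * \<mu> + c * s + M2 * omega s" "t\<^sup>2 \<le> M2 * omega s" by blast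
    have "t \<le> \<delta>1" by (rule \<delta>(4)[rule_format, OF t'(4)]) (use sr in simp)
    then have a: "0 < t2 - t" "(t2 - t) * L l (r / (t2 - t)) \<le> (t2 - t) * \<mu> + c' * r + M1 * ((r - r0)\<^sup>2 + t\<^sup>2)"
      using 1(3)[of r t] t'(1) sr \<delta>(3) by auto
    have "D k s l r \<le> (t * \<mu> + c * s + M2 * omega s) + ((t2 - t) * \<mu> + c' * r + M1 * ((r - r0)\<^sup>2 + t\<^sup>2)) + (1 - t - (t2 - t)) * l0"
      using sr(1,2) a t(1) t' by (intro D_le_times[OF kl]) auto
    moreover have "M1 * (r - r0)\<^sup>2 \<le> M1 * omega (r - r0)" "M1 * t\<^sup>2 \<le> M1 * (M2 * omega s)"
      using 1(1) 2(1) sr \<delta>(2) t' by (auto intro!: mult_left_mono square_le_omega)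
    moreover have "M1 * omega s \<ge> 0" "M2 * omega (r - r0) \<ge> 0" "M1 * M2 * omega (r - r0) \<ge> 0" using 1(1) 2(1) by simp_all
    ultimately show "D k s l r \<le> (\<mu> + c' * r0) + c * (s - 0) + c' * (r - r0)
        + (M1 + M1 * M2 + M2) * (omega (s - 0) + omega (r - r0))"
      using idle by (simp add: algebra_simps)
  qed (use \<delta>(1) in simp)
qed

text \<open>With both base points at 0 the base route only waits, so time is available at the price
  \<open>l0\<close>; near 0 each short leg needs at most half of the unit.\<close>

lemma upper_expansion_short:
  assumes kl: "k \<in> {1..N}" "l \<in> {1..N}"
    and y: "short_leg (\<lambda>u. L k (- u)) l0 c" and x: "short_leg (L l) l0 c'"
  shows "upper_expansion k 0 l 0 l0 c c'"
proof -
  obtain M1 where 1: "M1 \<ge> 0" "\<And>r. r \<in> {0..1} \<Longrightarrow> \<exists>t\<ge>0. (r > 0 \<longrightarrow> t > 0) \<and>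
      t * L k (- (r / t)) \<le> t * l0 + c * r + M1 * omega r \<and> t\<^sup>2 \<le> M1 * omega r"
    using y unfolding short_leg_def by blast
  obtain M2 where 2: "M2 \<ge> 0" "\<And>r. r \<in> {0..1} \<Longrightarrow> \<exists>t\<ge>0. (r > 0 \<longrightarrow> t > 0) \<and>
      t * L l (r / t) \<le> t * l0 + c' * r + M2 * omega r \<and> t\<^sup>2 \<le> M2 * omega r"
    using x unfolding short_leg_def by blast
  from small_time[OF 1(1) half_gt_zero[OF zero_less_one]] obtain \<delta>1 where \<delta>1: "\<delta>1 > 0" "\<delta>1 \<le> 1" "\<delta>1 \<le> 1/2"
    "\<forall>t z. t\<^sup>2 \<le> M1 * omega z \<longrightarrow> \<bar>z\<bar> \<le> \<delta>1 \<longrightarrow> t \<le> 1/2"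
    by (elim exE conjE)
  from small_time[OF 2(1) half_gt_zero[OF zero_less_one]] obtain \<delta>2 where \<delta>2: "\<delta>2 > 0" "\<delta>2 \<le> 1" "\<delta>2 \<le> 1/2"
    "\<forall>t z. t\<^sup>2 \<le> M2 * omega z \<longrightarrow> \<bar>z\<bar> \<le> \<delta>2 \<longrightarrow> t \<le> 1/2"
    by (elim exE conjE)
  define \<delta> where "\<delta> = min \<delta>1 \<delta>2"
  have \<delta>: "\<delta> > 0" "\<delta> \<le> 1" "\<delta> \<le> \<delta>1" "\<delta> \<le> \<delta>2" using \<delta>1(1,2) \<delta>2(1) unfolding \<delta>_def by auto
  show ?thesis
    unfolding upper_expansion_def
  proof (rule exI[of _ "M1 + M2"], intro conjI, use 1(1) 2(1) in simp,
      rule exI[of _ \<delta>], intro conjI allI impI)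
    fix s r assume sr: "s \<ge> 0" "r \<ge> 0" "\<bar>s - 0\<bar> \<le> \<delta>" "\<bar>r - 0\<bar> \<le> \<delta>"
    have "s \<in> {0..1}" "r \<in> {0..1}" using sr \<delta>(2) by simp_all
    obtain t where t: "t \<ge> 0" "s > 0 \<longrightarrow> t > 0"
      "t * L k (- (s / t)) \<le> t * l0 + c * s + M1 * omega s" "t\<^sup>2 \<le> M1 * omega s"
      using 1(2)[OF \<open>s \<in> {0..1}\<close>] by blast
    obtain t' where t': "t' \<ge> 0" "r > 0 \<longrightarrow> t' > 0"
      "t' * L l (r / t') \<le> t' * l0 + c' * r + M2 * omega r" "t'\<^sup>2 \<le> M2 * omega r"
      using 2(2)[OF \<open>r \<in> {0..1}\<close>] by blast
    have "t \<le> 1/2" "t' \<le> 1/2"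
      using \<delta>1(4)[rule_format, OF t(4)] \<delta>2(4)[rule_format, OF t'(4)] sr \<delta>(3,4) by auto
    then have "D k s l r \<le> (t * l0 + c * s + M1 * omega s) + (t' * l0 + c' * r + M2 * omega r) + (1 - t - t') * l0"
      using sr(1,2) t t' by (intro D_le_times[OF kl]) auto
    moreover have "M1 * omega r \<ge> 0" "M2 * omega s \<ge> 0" using 1(1) 2(1) by simp_all
    ultimately show "D k s l r \<le> l0 + c * (s - 0) + c' * (r - 0) + (M1 + M2) * (omega (s - 0) + omega (r - 0))"
      by (simp add: algebra_simps)
  qed (use \<delta>(1) in simp)
qed

lemma upper_expansion_straight:
  assumes k: "k \<in> {1..N}"
  shows "upper_expansion k s0 k r0 (L k (r0 - s0)) (- dL k (r0 - s0)) (dL k (r0 - s0))"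
proof -
  interpret k: unif_convex "L k" "dL k" "ddL k" \<gamma> using convex[OF k] .
  define v0 where "v0 = r0 - s0"
  obtain C where C: "C \<ge> 0" "\<And>u q. \<bar>u\<bar> \<le> \<bar>v0\<bar> + 2 \<Longrightarrow> \<bar>q\<bar> \<le> \<bar>v0\<bar> + 2 \<Longrightarrow>
      L k u \<le> L k q + dL k q * (u - q) + C * (u - q)\<^sup>2"
    using k.taylor_upper[of "\<bar>v0\<bar> + 2"] by blast
  show ?thesis
    unfolding upper_expansion_def
  proof (rule exI[of _ "2 * C"], intro conjI, use C(1) in simp, rule exI[of _ 1], intro conjI allI impI)
    fix s r assume sr: "s \<ge> 0" "r \<ge> 0" "\<bar>s - s0\<bar> \<le> 1" "\<bar>r - r0\<bar> \<le> 1"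
    define h where "h = (r - r0) + - (s - s0)"
    have u: "r - s = v0 + h" unfolding h_def v0_def by simp
    have "D k s k r \<le> L k (v0 + h)" using D_le_straight[OF k sr(1,2)] u by simp
    also have "\<dots> \<le> L k v0 + dL k v0 * h + C * h\<^sup>2"
      using C(2)[of "v0 + h" v0] sr unfolding h_def by auto
    also have "C * h\<^sup>2 \<le> C * (2 * omega (r - r0) + 2 * omega (s - s0))"
    proof (rule mult_left_mono)
      show "h\<^sup>2 \<le> 2 * omega (r - r0) + 2 * omega (s - s0)"
        using sum_square_le[of "r - r0" "- (s - s0)"] square_le_omega[of "r - r0"] square_le_omega[of "s - s0"] sr
        unfolding h_def power2_minus by linarith
    qed (rule C(1))
    finally show "D k s k r \<le> L k (r0 - s0) + - dL k (r0 - s0) * (s - s0) + dL k (r0 - s0) * (r - r0)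
        + 2 * C * (omega (s - s0) + omega (r - r0))"
      by (simp add: v0_def[symmetric] h_def algebra_simps)
  qed simp
qed

end

section \<open>Slopes of the test functions\<close>

lemma finite_uniform_constant:
  fixes P :: "'a \<Rightarrow> real \<Rightarrow> bool"
  assumes "finite A" "\<And>k. k \<in> A \<Longrightarrow> \<exists>c. P k c" "\<And>k c c'. k \<in> A \<Longrightarrow> P k c \<Longrightarrow> c \<le> c' \<Longrightarrow> P k c'"
  obtains c where "c \<ge> 0" "\<And>k. k \<in> A \<Longrightarrow> P k c"
proof -
  obtain d where d: "\<And>k. k \<in> A \<Longrightarrow> P k (d k)" using assms(2) by metis
  define c where "c = (\<Sum>k\<in>A. \<bar>d k\<bar>)"
  have le: "d k \<le> c" if "k \<in> A" for k
    using member_le_sum[of k A "\<lambda>k. \<bar>d k\<bar>"] that assms(1) unfolding c_def by fastforce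
  have "c \<ge> 0" unfolding c_def by (simp add: sum_nonneg)
  then show thesis using that[of c] assms(3)[OF _ d le] by blast
qed

context unif_convex
begin

lemma coercive: "\<exists>C. \<forall>u. \<bar>u\<bar> - C \<le> f u"
proof -
  \<comment> \<open>Completing the square gives growth of slope \<open>b\<close>, of which
    \<open>\<bar>f' 0\<bar>\<close> is lost to the linear term and 1 remains.\<close>
  define b where "b = 1 + \<bar>f' 0\<bar>"
  have "\<bar>u\<bar> - (b\<^sup>2 / (2 * \<gamma>) - f 0) \<le> f u" for u
  proof -
    have "0 \<le> (\<gamma> * \<bar>u\<bar> - b)\<^sup>2 / (2 * \<gamma>)" using gamma_pos by simp
    also have "\<dots> = \<gamma> / 2 * u\<^sup>2 - b * \<bar>u\<bar> + b\<^sup>2 / (2 * \<gamma>)"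
      using gamma_pos by (simp add: power2_diff power_mult_distrib field_simps power2_eq_square)
    finally have "b * \<bar>u\<bar> \<le> \<gamma> / 2 * u\<^sup>2 + b\<^sup>2 / (2 * \<gamma>)" by simp
    moreover have "f' 0 * u \<ge> - \<bar>f' 0\<bar> * \<bar>u\<bar>" using abs_ge_minus_self[of "f' 0 * u"] by (simp add: abs_mult)
    moreover have "f u \<ge> f 0 + f' 0 * u + \<gamma> / 2 * u\<^sup>2" using strong_tangent[of 0 u] by simp
    ultimately show ?thesis unfolding b_def by (simp add: algebra_simps)
  qed
  then show ?thesis by blast
qed

lemma K_ge_imp_bounded:
  assumes "m \<le> K q"
  shows "\<bar>q\<bar> \<le> 1 + 2 * (f 0 - m) / \<gamma>"
proof -
  have "\<gamma> / 2 * q\<^sup>2 \<le> f 0 - m" using K_upper[of q] assms by linarith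
  then have "q\<^sup>2 \<le> 2 * (f 0 - m) / \<gamma>" using gamma_pos by (simp add: field_simps)
  moreover have "\<bar>q\<bar> \<le> 1 + q\<^sup>2"
  proof -
    have "0 \<le> (\<bar>q\<bar> - 1)\<^sup>2" by simp
    then have "2 * \<bar>q\<bar> \<le> 1 + q\<^sup>2" by (simp add: power2_diff)
    then show ?thesis by simp
  qed
  ultimately show ?thesis by linarith
qed

end

lemma continuous_bounded_on_interval:
  fixes F :: "real \<Rightarrow> real"
  assumes "continuous_on UNIV F"
  shows "\<exists>c. \<forall>q. \<bar>q\<bar> \<le> B \<longrightarrow> \<bar>F q\<bar> \<le> c"
proof -
  have "compact (F ` {-B..B})"
    by (intro compact_continuous_image continuous_on_subset[OF assms]) auto
  then obtain c where "\<And>q. q \<in> {-B..B} \<Longrightarrow> \<bar>F q\<bar> \<le> c"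
    by (metis (no_types, lifting) bounded_iff compact_imp_bounded image_eqI real_norm_def)
  then show ?thesis by (intro exI[of _ c]) (auto simp: abs_le_iff)
qed

context junction_lagrangian
begin

lemma uniform_bound:
  fixes F :: "nat \<Rightarrow> real \<Rightarrow> real"
  assumes "\<And>k. k \<in> {1..N} \<Longrightarrow> continuous_on UNIV (F k)"
  obtains c where "c \<ge> 0" "\<And>k q. k \<in> {1..N} \<Longrightarrow> \<bar>q\<bar> \<le> B \<Longrightarrow> \<bar>F k q\<bar> \<le> c"
proof -
  obtain c where "c \<ge> 0" "\<And>k. k \<in> {1..N} \<Longrightarrow> \<forall>q. \<bar>q\<bar> \<le> B \<longrightarrow> \<bar>F k q\<bar> \<le> c"
  proof (rule finite_uniform_constant[of "{1..N}" "\<lambda>k c. \<forall>q. \<bar>q\<bar> \<le> B \<longrightarrow> \<bar>F k q\<bar> \<le> c"])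
    show "\<exists>c. \<forall>q. \<bar>q\<bar> \<le> B \<longrightarrow> \<bar>F k q\<bar> \<le> c" if "k \<in> {1..N}" for k
      using continuous_bounded_on_interval[OF assms[OF that]] .
  qed (auto intro: order.trans)
  then show thesis using that by blast
qed

lemma contL: "k \<in> {1..N} \<Longrightarrow> continuous_on UNIV (L k)"
  and contdL: "k \<in> {1..N} \<Longrightarrow> continuous_on UNIV (dL k)"
  and contK: "k \<in> {1..N} \<Longrightarrow> continuous_on UNIV (K k)"
  using unif_convex.cont0[OF convex] unif_convex.cont1[OF convex] unif_convex.contK[OF convex] by auto

lemma gamma_pos: "\<gamma> > 0" using unif_convex.gamma_pos[OF convex[of 1]] N1 by simp

lemma uniform_coercive:
  obtains C where "C \<ge> 0" "\<And>k u. k \<in> {1..N} \<Longrightarrow> \<bar>u\<bar> - C \<le> L k u"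
proof -
  obtain c where "c \<ge> 0" "\<And>k. k \<in> {1..N} \<Longrightarrow> \<forall>u. \<bar>u\<bar> - c \<le> L k u"
  proof (rule finite_uniform_constant[of "{1..N}" "\<lambda>k c. \<forall>u. \<bar>u\<bar> - c \<le> L k u"])
    show "\<exists>c. \<forall>u. \<bar>u\<bar> - c \<le> L k u" if "k \<in> {1..N}" for k
      using unif_convex.coercive[OF convex[OF that]] .
    show "\<forall>u. \<bar>u\<bar> - c' \<le> L k u" if "\<forall>u. \<bar>u\<bar> - c \<le> L k u" "c \<le> c'" for k c c'
      using that by (smt (verit))
  qed auto
  then show thesis using that by blast
qed

lemma leg_time_pos: "leg k v \<mu> t q \<Longrightarrow> t > 0 \<Longrightarrow> K k q = \<mu>"
  unfolding leg_def by (metis less_irrefl)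

text \<open>The quantity \<open>V\<close> with its arguments explicit, so that it can be quantified
  over.\<close>

definition route_value :: "nat \<Rightarrow> real \<Rightarrow> nat \<Rightarrow> real \<Rightarrow> real \<Rightarrow> real \<Rightarrow> real \<Rightarrow> real" where
  "route_value j s i r \<mu> q1 q2 = \<mu> - s * dL j q1 + r * dL i q2"

text \<open>The value is the cost of a route of total length \<open>s + r\<close> in unit time, and
  every Lagrangian, waiting included, is at least the speed minus \<open>C\<close>.\<close>

lemma optimal_value_coercive:
  assumes ji: "j \<in> {1..N}" "i \<in> {1..N}" and sr: "s \<ge> 0" "r \<ge> 0"
    and opt: "optimal j s i r \<mu> t1 q1 t2 q2"
    and C: "\<And>k u. k \<in> {1..N} \<Longrightarrow> \<bar>u\<bar> - C \<le> L k u"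
  shows "s + r - C \<le> route_value j s i r \<mu> q1 q2"
proof -
  note o = opt[unfolded optimal_def]
  have leg: "\<bar>v\<bar> - t * C \<le> t * \<mu> + v * dL k q" if "k \<in> {1..N}" "leg k v \<mu> t q" for k v t q
  proof (cases "v = 0")
    case True
    then have "t = 0" using that(2) unfolding leg_def by blast
    with True show ?thesis by simp
  next
    case False
    then have t: "t > 0" using that(2) unfolding leg_def by blast
    have "t * (\<bar>v / t\<bar> - C) \<le> t * L k (v / t)" using C[OF that(1), of "v / t"] t by (intro mult_left_mono) simp_all
    moreover have "t * (\<bar>v / t\<bar> - C) = \<bar>v\<bar> - t * C" using t by (simp add: right_diff_distrib abs_divide)
    ultimately show ?thesis using leg_cost[OF that] by simp
  qed
  have "\<bar>- s\<bar> - t1 * C \<le> t1 * \<mu> + - s * dL j q1" "\<bar>r\<bar> - t2 * C \<le> t2 * \<mu> + r * dL i q2"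
    using leg ji o by blast+
  moreover have "- C \<le> l0" using l0_attained C[of _ 0] by (metis abs_zero diff_0)
  then have "(1 - t1 - t2) * (- C) \<le> (1 - t1 - t2) * l0" using o by (intro mult_left_mono) auto
  moreover have "(1 - t1 - t2) * (l0 - \<mu>) = 0" using o by auto
  ultimately show ?thesis using sr unfolding route_value_def by (simp add: algebra_simps)
qed

text \<open>Collects every kind of slope that will be chosen: that of a straight path, that of a leg
  with \<open>\<mu> <= K k q\<close>, and \<open>L k 1 - \<mu>\<close>. The last two are needed only
  where a route through 0 realizes the minimal action; elsewhere they need not be bounded in terms
  of the distance.\<close>

definition slope_bound :: "real \<Rightarrow> real \<Rightarrow> bool" where
  "slope_bound R c \<longleftrightarrow> (\<forall>k\<in>{1..N}. \<forall>v. \<bar>v\<bar> \<le> R \<longrightarrow> \<bar>dL k v\<bar> \<le> c) \<and>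
    (\<forall>j i s r \<mu> t1 q1 t2 q2 k q. j \<in> {1..N} \<longrightarrow> i \<in> {1..N} \<longrightarrow> s \<ge> 0 \<longrightarrow> r \<ge> 0 \<longrightarrow>
      optimal j s i r \<mu> t1 q1 t2 q2 \<longrightarrow> D j s i r = route_value j s i r \<mu> q1 q2 \<longrightarrow>
      (if i = j then \<bar>s - r\<bar> else s + r) \<le> R \<longrightarrow> k \<in> {1..N} \<longrightarrow>
      \<bar>L k 1 - \<mu>\<bar> \<le> c \<and> (\<mu> \<le> K k q \<longrightarrow> \<bar>dL k q\<bar> \<le> c))"

lemma slope_bound_exists: "\<exists>c. slope_bound R c"
proof -
  obtain C where C: "C \<ge> 0" "\<And>k u. k \<in> {1..N} \<Longrightarrow> \<bar>u\<bar> - C \<le> L k u" using uniform_coercive by blast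
  obtain c1 where c1: "c1 \<ge> 0" "\<And>k q. k \<in> {1..N} \<Longrightarrow> \<bar>q\<bar> \<le> R \<Longrightarrow> \<bar>L k q\<bar> \<le> c1"
    using uniform_bound[of L R] contL by blast
  \<comment> \<open>Bounds \<open>s + r\<close>: by the distance itself for different branches, and
    by \<open>c1 + C\<close> for points of one branch.\<close>
  define R' where "R' = max R (c1 + C)"
  obtain c2 where c2: "c2 \<ge> 0" "\<And>k q. k \<in> {1..N} \<Longrightarrow> \<bar>q\<bar> \<le> 2 * R' \<Longrightarrow> \<bar>K k q\<bar> \<le> c2"
    using uniform_bound[of K "2 * R'"] contK by blast
  obtain c3 where c3: "c3 \<ge> 0" "\<And>k q. k \<in> {1..N} \<Longrightarrow> \<bar>q\<bar> \<le> 1 \<Longrightarrow> \<bar>L k q\<bar> \<le> c3"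
    using uniform_bound[of L 1] contL by blast
  define m where "m = - (c2 + c3)"
  obtain c4 where c4: "c4 \<ge> 0" "\<And>k q. k \<in> {1..N} \<Longrightarrow> \<bar>q\<bar> \<le> 1 + 2 * (c3 - m) / \<gamma> \<Longrightarrow> \<bar>dL k q\<bar> \<le> c4"
    using uniform_bound[of dL "1 + 2 * (c3 - m) / \<gamma>"] contdL by blast
  obtain c5 where c5: "c5 \<ge> 0" "\<And>k q. k \<in> {1..N} \<Longrightarrow> \<bar>q\<bar> \<le> R \<Longrightarrow> \<bar>dL k q\<bar> \<le> c5"
    using uniform_bound[of dL R] contdL by blast
  have l0: "\<bar>l0\<bar> \<le> c3" using l0_attained c3(2)[of _ 0] by force
  define B where "B = c2 + 2 * c3 + c4 + c5"
  show ?thesis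
    unfolding slope_bound_def
  proof (rule exI[of _ B], intro conjI ballI allI impI)
    show "\<bar>dL k v\<bar> \<le> B" if "k \<in> {1..N}" "\<bar>v\<bar> \<le> R" for v k
      using c5(2)[OF that] c2(1) c3(1) c4(1) unfolding B_def by linarith
    fix j i s r \<mu> t1 q1 t2 q2 k q
    assume ji: "j \<in> {1..N}" "i \<in> {1..N}" and sr: "s \<ge> 0" "r \<ge> 0"
      and opt: "optimal j s i r \<mu> t1 q1 t2 q2" and Deq: "D j s i r = route_value j s i r \<mu> q1 q2"
      and dist: "(if i = j then \<bar>s - r\<bar> else s + r) \<le> R" and k: "k \<in> {1..N}"
    note o = opt[unfolded optimal_def]
    \<comment> \<open>On a single branch the distance does not control \<open>s + r\<close>, but the
      optimal route costs no more than the straight path, whose speed is at most \<open>R\<close>,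
      and coercivity then bounds its length.\<close>
    have srR: "s + r \<le> R'"
    proof (cases "i = j")
      case True
      have "s + r - C \<le> D j s i r" using optimal_value_coercive[OF ji sr opt C(2)] Deq by simp
      also have "\<dots> \<le> L i (r - s)" using D_le_straight[OF ji(1) sr] True by simp
      also have "\<dots> \<le> c1" using c1(2)[OF ji(2), of "r - s"] dist True by (simp add: abs_minus_commute)
      finally show ?thesis unfolding R'_def by simp
    qed (use dist R'_def in simp)
    have half: "K l p \<ge> - c2" if "l \<in> {1..N}" "leg l v \<mu> t p" "t \<ge> 1/2" "\<bar>v\<bar> \<le> R'" for l v t p
    proof -
      have "v = p * t" using that(2) unfolding leg_def by blast
      then have "\<bar>p\<bar> = \<bar>v\<bar> / t" using that(3) by (simp add: abs_mult)
      also have "\<dots> \<le> \<bar>v\<bar> / (1/2)" using that(3) by (intro divide_left_mono) auto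
      finally have "\<bar>p\<bar> \<le> 2 * R'" using that(4) by simp
      from c2(2)[OF that(1) this] show ?thesis by linarith
    qed
    \<comment> \<open>If \<open>\<mu>\<close> differs from \<open>l0\<close>, the legs fill the unit
      of time, so one of them lasts at least 1/2, has speed at most \<open>2 * R'\<close>, and
      \<open>\<mu>\<close> is a value of \<open>K\<close> on that range.\<close>
    have mu: "m \<le> \<mu>"
    proof (cases "\<mu> = l0")
      case True
      then show ?thesis using l0 c2(1) unfolding m_def by linarith
    next
      case False
      then have "t1 \<ge> 1/2 \<or> t2 \<ge> 1/2" using o by linarith
      then show ?thesis
      proof
        assume t: "t1 \<ge> 1/2"
        have l: "leg j (- s) \<mu> t1 q1" using o by blast
        have "K j q1 = \<mu>" by (rule leg_time_pos[OF l]) (use t in simp)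
        then show ?thesis using half[OF ji(1) l t] srR sr c3(1) unfolding m_def by simp
      next
        assume t: "t2 \<ge> 1/2"
        have l: "leg i r \<mu> t2 q2" using o by blast
        have "K i q2 = \<mu>" by (rule leg_time_pos[OF l]) (use t in simp)
        then show ?thesis using half[OF ji(2) l t] srR sr c3(1) unfolding m_def by simp
      qed
    qed
    have "\<mu> \<le> l0" using o by blast
    then show "\<bar>L k 1 - \<mu>\<bar> \<le> B"
      using c3(2)[OF k, of 1] mu l0 c2(1) c3(1) c4(1) c5(1) unfolding m_def B_def by (simp add: abs_le_iff)
    show "\<bar>dL k q\<bar> \<le> B" if "\<mu> \<le> K k q"
    proof -
      have "\<bar>q\<bar> \<le> 1 + 2 * (L k 0 - m) / \<gamma>"
        using unif_convex.K_ge_imp_bounded[OF convex[OF k], of m q] mu that by linarith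
      also have "\<dots> \<le> 1 + 2 * (c3 - m) / \<gamma>"
        using c3(2)[OF k, of 0] gamma_pos by (intro add_left_mono divide_right_mono) (auto simp: abs_le_iff)
      finally show ?thesis using c4(2)[OF k, of q] c2(1) c3(1) c5(1) unfolding B_def by linarith
    qed
  qed
qed

section \<open>Choice of slopes solving the equations\<close>

lemma Ham_slope: "k \<in> {1..N} \<Longrightarrow> Ham L k (dL k q) = - K k q"
  using unif_convex.sup_tangent[OF convex, of k q UNIV] unfolding Ham_def by simp

lemma Ham_minus_slope: "k \<in> {1..N} \<Longrightarrow> q \<le> 0 \<Longrightarrow> Ham_minus L k (dL k q) = - K k q"
  using unif_convex.sup_tangent[OF convex, of k q "{..0}"] unfolding Ham_minus_def by simp

lemma Ham_minus_steep: "k \<in> {1..N} \<Longrightarrow> dL k 0 \<le> p \<Longrightarrow> Ham_minus L k p = - L k 0"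
  using unif_convex.sup_nonpos_steep[OF convex, of k p] unfolding Ham_minus_def by simp

lemma regular_leg_right:
  assumes "k \<in> {1..N}" "leg k v \<mu> t q" "v \<noteq> 0"
  shows "regular_leg (L k) v t \<mu> (dL k q)"
proof -
  have "t > 0" "v = q * t" "K k q = \<mu>" using assms unfolding leg_def by blast+
  then show ?thesis using unif_convex.regular_legI[OF convex[OF assms(1)], of t q] by simp
qed

lemma K_reflect:
  assumes "k \<in> {1..N}"
  shows "unif_convex.K (\<lambda>u. L k (- u)) (\<lambda>u. - dL k (- u)) (- q) = K k q"
  using unif_convex.K_def[OF unif_convex.reflect[OF convex[OF assms]]] K_eq[OF assms] by simp

lemma regular_leg_left:
  assumes "k \<in> {1..N}" "leg k (- s) \<mu> t q" "s \<noteq> 0"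
  shows "regular_leg (\<lambda>u. L k (- u)) s t \<mu> (- dL k q)"
proof -
  have t: "t > 0" "- s = q * t" "K k q = \<mu>" using assms unfolding leg_def by auto
  then have s: "s = - q * t" by simp
  show ?thesis
    using unif_convex.regular_legI[OF unif_convex.reflect[OF convex[OF assms(1)]] t(1), of "- q"]
      K_reflect[OF assms(1), of q] t(3) unfolding s by simp
qed

lemma short_leg_left:
  assumes "k \<in> {1..N}" "q \<le> 0" "K k q = \<mu>"
  shows "short_leg (\<lambda>u. L k (- u)) \<mu> (- dL k q)"
  using unif_convex.short_leg_level[OF unif_convex.reflect[OF convex[OF assms(1)]], of "- q"]
    K_reflect[OF assms(1), of q] assms(2,3) by simp

lemma short_leg_right: "l \<in> {1..N} \<Longrightarrow> short_leg (L l) \<mu> (L l 1 - \<mu>)"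
  using unif_convex.short_leg_unit_speed[OF convex] by blast

text \<open>The tangent at 0 gives \<open>L l 1 >= L l 0 + dL l 0\<close>, and
  \<open>\<mu> <= l0 <= L l 0\<close>. Hence the slope of a leg at unit speed lies where
  \<open>Ham_minus\<close> is constant.\<close>

lemma steep:
  assumes "l \<in> {1..N}" "\<mu> \<le> l0"
  shows "dL l 0 \<le> L l 1 - \<mu>"
  using tangent[OF assms(1), of 0 1] K_zero[OF assms(1)] l0_le[OF assms(1)] assms(2) by simp

lemma Max_image_eqI:
  fixes F :: "nat \<Rightarrow> real"
  assumes "k \<in> {1..N}" "F k = m" "\<And>l. l \<in> {1..N} \<Longrightarrow> F l \<le> m"
  shows "Max (F ` {1..N}) = m"
  by (rule Max_eqI) (use assms in auto)

definition hj_slopes :: "nat \<Rightarrow> real \<Rightarrow> nat \<Rightarrow> real \<Rightarrow> real \<Rightarrow> (nat \<Rightarrow> real) \<Rightarrow> (nat \<Rightarrow> real) \<Rightarrow> bool" where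
  "hj_slopes j s i r E a b \<longleftrightarrow>
      (r > 0 \<longrightarrow> E + Ham L i (b i) = 0)
    \<and> (r = 0 \<longrightarrow> E + Max ((\<lambda>k. Ham_minus L k (b k)) ` {1..N}) = 0)
    \<and> (s > 0 \<longrightarrow> E + Ham L j (- a j) = 0)
    \<and> (s = 0 \<longrightarrow> N \<ge> 2 \<longrightarrow> E + Max ((\<lambda>k. Ham_minus L k (- a k)) ` {1..N}) = 0)
    \<and> (s = 0 \<longrightarrow> N = 1 \<longrightarrow> E + Ham L 1 (- a 1) = 0)"

text \<open>The slopes are indexed by all branches, but those of a branch that does not contain the
  base point are left unconstrained.\<close>

definition test_data :: "(real \<Rightarrow> real) \<Rightarrow> nat \<Rightarrow> real \<Rightarrow> nat \<Rightarrow> real \<Rightarrow> (nat \<Rightarrow> real) \<Rightarrow> (nat \<Rightarrow> real) \<Rightarrow> bool" where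
  "test_data B j s i r a b \<longleftrightarrow>
      (\<forall>k\<in>{1..N}. \<forall>l\<in>{1..N}. (k = j \<or> s = 0) \<longrightarrow> (l = i \<or> r = 0) \<longrightarrow>
                upper_expansion k s l r (D j s i r) (a k) (b l))
    \<and> hj_slopes j s i r (D j s i r - r * b i - s * a j) a b
    \<and> (\<forall>R. (if i = j then \<bar>s - r\<bar> else s + r) \<le> R \<longrightarrow>
          (\<forall>k\<in>{1..N}. ((k = j \<or> s = 0) \<longrightarrow> \<bar>a k\<bar> \<le> B R) \<and> ((k = i \<or> r = 0) \<longrightarrow> \<bar>b k\<bar> \<le> B R)))"

lemma test_data_exists:
  obtains B where "\<And>j i s r. j \<in> {1..N} \<Longrightarrow> i \<in> {1..N} \<Longrightarrow> s \<ge> 0 \<Longrightarrow> r \<ge> 0 \<Longrightarrow> \<exists>a b. test_data B j s i r a b"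
proof -
  obtain B where B: "\<And>R. slope_bound R (B R)" using slope_bound_exists by metis
  have B1: "\<bar>dL k v\<bar> \<le> B R" if "k \<in> {1..N}" "\<bar>v\<bar> \<le> R" for R v k
    using B[of R] that unfolding slope_bound_def by blast
  have B2: "\<bar>L k 1 - \<mu>\<bar> \<le> B R \<and> (\<mu> \<le> K k q \<longrightarrow> \<bar>dL k q\<bar> \<le> B R)"
    if "j \<in> {1..N}" "i \<in> {1..N}" "s \<ge> 0" "r \<ge> 0" "optimal j s i r \<mu> t1 q1 t2 q2"
      "D j s i r = route_value j s i r \<mu> q1 q2" "(if i = j then \<bar>s - r\<bar> else s + r) \<le> R" "k \<in> {1..N}"
    for R j i s r \<mu> t1 q1 t2 q2 k q
    using B[of R, unfolded slope_bound_def, THEN conjunct2, rule_format, OF that] by blast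
  show thesis
  proof (rule that[of B])
    fix j i s r assume ji: "j \<in> {1..N}" "i \<in> {1..N}" and sr: "s \<ge> (0::real)" "r \<ge> (0::real)"
    obtain \<mu> t1 q1 t2 q2 where opt: "optimal j s i r \<mu> t1 q1 t2 q2" using optimal_exists[OF ji] by blast
    show "\<exists>a b. test_data B j s i r a b"
    proof (cases "i = j \<and> s > 0 \<and> r > 0 \<and> L i (r - s) \<le> route_value j s i r \<mu> q1 q2")
      case True
      define a b where "a = (\<lambda>k::nat. - dL i (r - s))" and "b = (\<lambda>k::nat. dL i (r - s))"
      have Deq: "D j s i r = L i (r - s)"
        using straight_D_eq[OF ji sr opt] True unfolding route_value_def by blast
      have "upper_expansion j s i r (D j s i r) (a j) (b i)"
        using upper_expansion_straight[OF ji(1), of s r] True Deq unfolding a_def b_def by simp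
      moreover have "D j s i r - r * b i - s * a j = K i (r - s)"
        unfolding Deq a_def b_def K_eq[OF ji(2)] by (simp add: algebra_simps)
      then have "hj_slopes j s i r (D j s i r - r * b i - s * a j) a b"
        using Ham_slope[OF ji(2), of "r - s"] True unfolding hj_slopes_def a_def b_def by simp
      moreover have "\<bar>a k\<bar> \<le> B R \<and> \<bar>b k\<bar> \<le> B R" if "(if i = j then \<bar>s - r\<bar> else s + r) \<le> R" for R k
        using B1[OF ji(2), of "r - s" R] that True unfolding a_def b_def by (simp add: abs_minus_commute)
      ultimately show ?thesis unfolding test_data_def using True by (intro exI[of _ a] exI[of _ b]) auto
    next
      case False
      then have "i \<noteq> j \<or> s = 0 \<or> r = 0 \<or> route_value j s i r \<mu> q1 q2 \<le> L i (r - s)"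
        using sr by linarith
      then have Deq: "D j s i r = route_value j s i r \<mu> q1 q2"
        using optimal_D_eq[OF ji sr opt] unfolding route_value_def by blast
      note o = opt[unfolded optimal_def]
      have mu: "\<mu> \<le> l0" and l1: "leg j (- s) \<mu> t1 q1" and l2: "leg i r \<mu> t2 q2"
        and tt: "t1 + t2 \<le> 1" "\<mu> = l0 \<or> t1 + t2 = 1" using o by blast+
      have s0: "t1 = 0" "q1 = 0" if "s = 0" using l1 that unfolding leg_def by auto
      have r0: "t2 = 0" "q2 = 0" if "r = 0" using l2 that unfolding leg_def by auto
      have Kq1: "K j q1 = \<mu>" if "s \<noteq> 0" using l1 that unfolding leg_def by auto
      have Kq2: "K i q2 = \<mu>" if "r \<noteq> 0" using l2 that unfolding leg_def by blast
      \<comment> \<open>As \<open>\<mu> <= l0 <= L k 0\<close>, the level \<open>\<mu>\<close> is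
        reached at a nonpositive speed on every branch, and not only on the one used by the
        route.\<close>
      have "\<exists>q. q \<le> 0 \<and> K k q = \<mu>" if kN: "k \<in> {1..N}" for k
      proof -
        have "\<mu> \<le> L k 0" using mu l0_le[OF kN] by simp
        from unif_convex.K_level_nonpos[OF convex[OF kN] this] show ?thesis by blast
      qed
      then obtain qm where qm: "\<And>k. k \<in> {1..N} \<Longrightarrow> qm k \<le> 0" "\<And>k. k \<in> {1..N} \<Longrightarrow> K k (qm k) = \<mu>"
        by metis
      \<comment> \<open>At \<open>y = 0\<close> the speeds \<open>qm k\<close> make every
        \<open>Ham_minus\<close> equal to \<open>- \<mu>\<close>; being nonpositive, they give
        \<open>Ham\<close> the same value, as the case \<open>N = 1\<close> requires.\<close>
      define a where "a = (\<lambda>k. if s = 0 then - dL k (qm k) else - dL j q1)"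
      \<comment> \<open>At \<open>x = 0\<close> the steep slopes contribute \<open>- L k 0\<close>.
        This suffices if \<open>\<mu> = l0\<close>; otherwise branch \<open>j\<close> gets the slope
        of the straight path from \<open>y\<close>, which contributes
        \<open>- \<mu>\<close>.\<close>
      define b where "b = (\<lambda>l. if r \<noteq> 0 then dL i q2 else if l = j \<and> \<mu> \<noteq> l0 then dL j q1 else L l 1 - \<mu>)"
      have E: "D j s i r - r * b i - s * a j = \<mu>"
        unfolding Deq route_value_def a_def b_def by (simp add: algebra_simps)
      \<comment> \<open>With \<open>x = 0\<close> and no waiting, the leg from \<open>y\<close>
        takes the whole unit of time; its speed is \<open>- s\<close>, so the route is the straight
        path.\<close>
      have full: "s \<noteq> 0" "t1 = 1" "q1 = - s" if "r = 0" "\<mu> \<noteq> l0"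
      proof -
        show t1: "t1 = 1" using tt that r0 by simp
        show "s \<noteq> 0" using s0 t1 by auto
        have "- s = q1 * t1" using l1 unfolding leg_def by blast
        then show "q1 = - s" using t1 by simp
      qed
      have exp: "upper_expansion k s l r (D j s i r) (a k) (b l)"
        if kl: "k \<in> {1..N}" "l \<in> {1..N}" "k = j \<or> s = 0" "l = i \<or> r = 0" for k l
      proof -
        consider "s \<noteq> 0" "r \<noteq> 0" | "s = 0" "r \<noteq> 0" | "r = 0" "l = j" "\<mu> \<noteq> l0"
          | "s \<noteq> 0" "r = 0" "\<not> (l = j \<and> \<mu> \<noteq> l0)" | "s = 0" "r = 0" "\<not> (l = j \<and> \<mu> \<noteq> l0)" by blast
        then show ?thesis
        proof cases
          case 1
          then have "k = j" "l = i" using kl by auto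
          with upper_expansion_regular[OF ji regular_leg_left[OF ji(1) l1 1(1)] regular_leg_right[OF ji(2) l2 1(2)] tt]
          show ?thesis using 1 unfolding Deq route_value_def a_def b_def by (simp add: mult.commute)
        next
          case 2
          then have "l = i" using kl by auto
          have "t2 \<le> 1" "\<mu> = l0 \<or> t2 = 1" using tt s0 2 by auto
          from upper_expansion_short_regular[OF kl(1) ji(2) short_leg_left[OF kl(1) qm(1)[OF kl(1)] qm(2)[OF kl(1)]]
            regular_leg_right[OF ji(2) l2 2(2)] this]
          show ?thesis using 2 \<open>l = i\<close> unfolding Deq route_value_def a_def b_def by (simp add: mult.commute)
        next
          case 3
          note f = full[OF 3(1,3)]
          have k: "k = j" using kl f by blast
          have "K j (- s) = \<mu>" using Kq1 f by simp
          \<comment> \<open>Here \<open>x\<close> moves off 0 into the branch of \<open>y\<close>,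
            and the competitor stops short of 0 along the straight path; the slope thus belongs to
            the negative speed \<open>- s\<close>.\<close>
          then have "D j s i r = L j (0 - s)"
            using K_eq[OF ji(1), of "- s"] 3(1) f unfolding Deq route_value_def by simp
          then show ?thesis
            using upper_expansion_straight[OF ji(1), of s 0] k 3 f unfolding a_def b_def by simp
        next
          case 4
          then have "k = j" using kl by auto
          have "t1 \<le> 1" "\<mu> = l0 \<or> t1 = 1" using tt r0 4 by auto
          from upper_expansion_regular_short[OF ji(1) kl(2) regular_leg_left[OF ji(1) l1 4(1)]
            short_leg_right[OF kl(2)] this]
          have "upper_expansion j s l 0 (\<mu> + - dL j q1 * s) (- dL j q1) (L l 1 - \<mu>)" .
          moreover have "D j s i r = \<mu> + - dL j q1 * s" using 4 unfolding Deq route_value_def by simp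
          moreover have "a k = - dL j q1" "b l = L l 1 - \<mu>" using 4 unfolding a_def b_def by auto
          ultimately show ?thesis using 4(2) \<open>k = j\<close> by simp
        next
          case 5
          have m: "\<mu> = l0" using tt s0 r0 5 by auto
          from upper_expansion_short[OF kl(1,2) short_leg_left[OF kl(1) qm(1)[OF kl(1)], of l0] short_leg_right[OF kl(2)]]
          have "upper_expansion k 0 l 0 l0 (- dL k (qm k)) (L l 1 - l0)" using qm(2)[OF kl(1)] m by simp
          moreover have "D j s i r = l0" using 5 m unfolding Deq route_value_def by simp
          moreover have "a k = - dL k (qm k)" "b l = L l 1 - l0" using 5 m unfolding a_def b_def by auto
          ultimately show ?thesis using 5(1,2) by simp
        qed
      qed
      have "hj_slopes j s i r \<mu> a b"
        unfolding hj_slopes_def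
      proof (intro conjI impI)
        show "\<mu> + Ham L i (b i) = 0" if "r > 0"
          using Ham_slope[OF ji(2), of q2] Kq2 that unfolding b_def by simp
        show "\<mu> + Ham L j (- a j) = 0" if "s > 0"
          using Ham_slope[OF ji(1), of q1] Kq1 that unfolding a_def by simp
        show "\<mu> + Ham L 1 (- a 1) = 0" if "s = 0" "N = 1"
          using Ham_slope[of 1 "qm 1"] qm(2)[of 1] that unfolding a_def by simp
        show "\<mu> + Max ((\<lambda>k. Ham_minus L k (- a k)) ` {1..N}) = 0" if "s = 0"
        proof -
          have "Ham_minus L k (- a k) = - \<mu>" if "k \<in> {1..N}" for k
            using Ham_minus_slope[OF that qm(1)[OF that]] qm(2)[OF that] \<open>s = 0\<close> unfolding a_def by simp
          then have "Max ((\<lambda>k. Ham_minus L k (- a k)) ` {1..N}) = - \<mu>"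
            using ji(1) by (intro Max_image_eqI[of j]) auto
          then show ?thesis by simp
        qed
        show "\<mu> + Max ((\<lambda>k. Ham_minus L k (b k)) ` {1..N}) = 0" if r: "r = 0"
        proof -
          have st: "Ham_minus L k (L k 1 - \<mu>) = - L k 0" if "k \<in> {1..N}" for k
            using Ham_minus_steep[OF that steep[OF that mu]] .
          have le: "- L k 0 \<le> - \<mu>" if "k \<in> {1..N}" for k using l0_le[OF that] mu by simp
          have "Max ((\<lambda>k. Ham_minus L k (b k)) ` {1..N}) = - \<mu>"
          proof (cases "\<mu> = l0")
            case True
            then have bk: "Ham_minus L k (b k) = - L k 0" if "k \<in> {1..N}" for k
              using st[OF that] r unfolding b_def by simp
            \<comment> \<open>A branch with the least \<open>L k 0\<close> attains the maximum
              \<open>- l0\<close>.\<close>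
            obtain k where "k \<in> {1..N}" "l0 = L k 0" using l0_attained by blast
            then show ?thesis using bk le True by (intro Max_image_eqI[of k]) auto
          next
            case F: False
            note f = full[OF r F]
            \<comment> \<open>Branch \<open>j\<close> attains \<open>- \<mu>\<close> because its
              speed is nonpositive; every other branch contributes
              \<open>- L k 0 <= - l0 <= - \<mu>\<close>.\<close>
            have j: "Ham_minus L j (b j) = - \<mu>"
              using Ham_minus_slope[OF ji(1), of q1] Kq1 f sr r F unfolding b_def by simp
            have "Ham_minus L k (b k) \<le> - \<mu>" if "k \<in> {1..N}" for k
            proof (cases "k = j")
              case False
              then have "b k = L k 1 - \<mu>" using r unfolding b_def by simp
              then show ?thesis using st[OF that] le[OF that] by simp
            qed (use j in simp)
            with j show ?thesis using ji(1) by (intro Max_image_eqI[of j]) auto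
          qed
          then show ?thesis by simp
        qed
      qed
      then have hj: "hj_slopes j s i r (D j s i r - r * b i - s * a j) a b" unfolding E .
      have bd: "((k = j \<or> s = 0) \<longrightarrow> \<bar>a k\<bar> \<le> B R) \<and> ((k = i \<or> r = 0) \<longrightarrow> \<bar>b k\<bar> \<le> B R)"
        if R: "(if i = j then \<bar>s - r\<bar> else s + r) \<le> R" and k: "k \<in> {1..N}" for R k
      proof -
        note b2 = B2[OF ji sr opt Deq R]
        have "\<bar>dL j q1\<bar> \<le> B R" "\<bar>dL i q2\<bar> \<le> B R" "\<bar>L k 1 - \<mu>\<bar> \<le> B R"
          using b2[OF ji(1), of q1] b2[OF ji(2), of q2] b2[OF k] optimal_K_ge[OF ji sr opt] by blast+
        moreover have "\<bar>dL k (qm k)\<bar> \<le> B R" using b2[OF k, of "qm k"] qm(2)[OF k] by simp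
        ultimately have "\<bar>a k\<bar> \<le> B R" "\<bar>b k\<bar> \<le> B R" unfolding a_def b_def by auto
        then show ?thesis by blast
      qed
      show ?thesis unfolding test_data_def using exp hj bd by blast
    qed
  qed
qed

end

section \<open>Separable test functions\<close>

text \<open>The cube root is odd, so this form has no absolute value, and differentiability needs no
  distinction of signs.\<close>

lemma omega_eq: "omega z = z * root 3 z"
proof -
  have pos: "omega z = z * root 3 z" if "z > 0" for z
  proof -
    have "z powr (4/3) = z powr 1 * z powr (1/3)" using powr_add[of z 1 "1/3"] by simp
    then show ?thesis using that by (simp add: omega_def root_powr_inverse)
  qed
  consider "z > 0" | "z = 0" | "- z > 0" by linarith
  then show ?thesis
  proof cases
    case 3
    have "omega z = omega (- z)" by simp
    also have "\<dots> = - z * root 3 (- z)" by (rule pos[OF 3])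
    finally show ?thesis by (simp add: real_root_minus)
  qed (use pos in auto)
qed

lemma omega_deriv: "(omega has_real_derivative 4/3 * root 3 z) (at z)"
proof (cases "z = 0")
  case True
  \<comment> \<open>At 0 the difference quotient is the cube root itself, which tends to 0.\<close>
  have "((\<lambda>h. root 3 h) \<longlongrightarrow> root 3 0) (at 0)"
    by (intro tendsto_intros)
  then have "((\<lambda>h. (omega (0 + h) - omega 0) / h) \<longlongrightarrow> root 3 0) (at 0)"
    by (rule Lim_transform_eventually) (auto simp: eventually_at_filter omega_eq)
  then show ?thesis using True by (simp add: DERIV_def)
next
  case False
  have "(root 3 has_real_derivative inverse (real 3 * root 3 z ^ (3 - Suc 0))) (at z)"
    by (rule DERIV_odd_real_root) (use False in auto)
  then have "((\<lambda>z. z * root 3 z) has_real_derivative 1 * root 3 z + inverse (3 * root 3 z ^ 2) * z) (at z)"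
    by (intro DERIV_mult DERIV_ident) (simp add: numeral_2_eq_2 numeral_3_eq_3)
  moreover have "inverse (3 * root 3 z ^ 2) * z = root 3 z / 3"
  proof -
    have "z = root 3 z ^ 3" by (simp add: odd_real_root_pow)
    then have "inverse (3 * root 3 z ^ 2) * z = inverse (3 * root 3 z ^ 2) * root 3 z ^ 3" by simp
    also have "\<dots> = root 3 z / 3" using False by (simp add: field_simps power2_eq_square power3_eq_cube)
    finally show ?thesis .
  qed
  moreover have "omega = (\<lambda>z. z * root 3 z)" using omega_eq by blast
  ultimately show ?thesis by simp
qed

lemma at_within_atLeast_nontrivial:
  fixes t :: real
  assumes "t \<ge> 0"
  shows "at t within {0..} \<noteq> bot"
proof
  assume "at t within {0..} = bot"
  moreover have "at t within {t<..} \<le> at t within {0..}" by (rule at_le) (use assms in auto)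
  ultimately have "at_right t = bot" by (simp add: bot.extremum_unique)
  then show False using trivial_limit_at_right_real[of t] by (simp add: trivial_limit_def)
qed

text \<open>\<open>pdx\<close> and \<open>pdy\<close> are definite descriptions of derivatives on a
  half-line, so uniqueness is needed even at its end point 0.\<close>

lemma the_derivative_within_halfline:
  fixes f g :: "real \<Rightarrow> real"
  assumes t: "t \<ge> 0" and g: "(g has_real_derivative D) (at t)" and eq: "\<And>s. s \<ge> 0 \<Longrightarrow> f s = g s"
  shows "(THE D. (f has_real_derivative D) (at t within {0..})) = D"
proof (rule the_equality)
  have "(g has_real_derivative D) (at t within {0..})" using g by (rule has_field_derivative_at_within)
  then show f: "(f has_real_derivative D) (at t within {0..})"
    unfolding has_field_derivative_def
    by (rule has_derivative_transform[rotated 2]) (use t eq in auto)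
  fix D' assume "(f has_real_derivative D') (at t within {0..})"
  with f show "D' = D"
    using at_within_atLeast_nontrivial[OF t] tendsto_unique unfolding has_field_derivative_iff by blast
qed

context star_junction
begin

text \<open>At 0 the branch index is not determined in general; index 1 stands for all of them under
  the assumption that the \<open>F k\<close> agree at 0.\<close>

definition lift :: "(nat \<Rightarrow> real \<Rightarrow> real) \<Rightarrow> real^2 \<Rightarrow> real" where
  "lift F y = (if y = 0 then F 1 0 else F (brix N e y) (norm y))"

context
  fixes F :: "nat \<Rightarrow> real \<Rightarrow> real"
  assumes F0: "\<And>k. k \<in> {1..N} \<Longrightarrow> F k 0 = F 1 0"
begin

lemma lift_scaled:
  assumes "k \<in> {1..N}" "s \<ge> 0"
  shows "lift F (s *\<^sub>R e k) = F k s"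
proof (cases "s = 0")
  case False
  then have "brix N e (s *\<^sub>R e k) = k" "s *\<^sub>R e k \<noteq> 0"
    using brix_eq[OF assms(1) scaled_in_branch[OF assms(2)]] e_nonzero[OF assms(1)] by auto
  then show ?thesis using norm_scaled[OF assms(1), of s] assms(2) unfolding lift_def by (simp del: norm_scaleR)
qed (use F0[OF assms(1)] in \<open>simp add: lift_def\<close>)

lemma continuous_on_lift:
  assumes "\<And>k. k \<in> {1..N} \<Longrightarrow> continuous_on UNIV (F k)"
  shows "continuous_on J (lift F)"
proof -
  have "continuous_on (branch e k) (lift F)" if k: "k \<in> {1..N}" for k
  proof -
    have "continuous_on (branch e k) (\<lambda>y. F k (norm y))"
      by (intro continuous_on_compose2[OF assms[OF k]] continuous_intros) auto
    moreover have "F k (norm y) = lift F y" if "y \<in> branch e k" for y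
      using lift_scaled[OF k, of "norm y"] branch_iff[OF k] that by (metis norm_ge_zero)
    ultimately show ?thesis by (rule continuous_on_eq)
  qed
  then show ?thesis
    unfolding junction_def using closed_branch by (intro continuous_on_closed_Union) auto
qed

end

text \<open>The slopes need no matching at 0: the class asks for continuity across the branches, but
  for differentiability only on each quadrant separately.\<close>

lemma C1_star_separable:
  assumes F0: "\<And>k. k \<in> {1..N} \<Longrightarrow> F k 0 = F 1 0" and G0: "\<And>k. k \<in> {1..N} \<Longrightarrow> G k 0 = G 1 0"
    and dF: "\<And>k s. k \<in> {1..N} \<Longrightarrow> (F k has_real_derivative F' k s) (at s)"
    and dG: "\<And>k s. k \<in> {1..N} \<Longrightarrow> (G k has_real_derivative G' k s) (at s)"
    and cF: "\<And>k. k \<in> {1..N} \<Longrightarrow> continuous_on UNIV (F' k)" and cG: "\<And>k. k \<in> {1..N} \<Longrightarrow> continuous_on UNIV (G' k)"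
  shows "C1_star N e (\<lambda>y x. v + lift F y + lift G x)"
    and "k \<in> {1..N} \<Longrightarrow> pdy e (\<lambda>y x. v + lift F y + lift G x) y x k = F' k (norm y)"
    and "k \<in> {1..N} \<Longrightarrow> pdx e (\<lambda>y x. v + lift F y + lift G x) y x k = G' k (norm x)"
proof -
  have contF: "continuous_on UNIV (F k)" and contG: "continuous_on UNIV (G k)" if "k \<in> {1..N}" for k
    by (rule continuous_at_imp_continuous_on, rule ballI, rule DERIV_isCont, rule dF[OF that] dG[OF that])+
  show "C1_star N e (\<lambda>y x. v + lift F y + lift G x)"
    unfolding C1_star_def
  proof (intro conjI ballI)
    show "continuous_on (J \<times> J) (\<lambda>z. v + lift F (fst z) + lift G (snd z))"
      using continuous_on_lift[of F, OF F0 contF] continuous_on_lift[of G, OF G0 contG]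
      by (intro continuous_intros continuous_on_compose2[of J "lift F" _ fst] continuous_on_compose2[of J "lift G" _ snd]) auto
    fix i j assume i: "i \<in> {1..N}" and j: "j \<in> {1..N}"
    show "C1_quad (\<lambda>z. v + lift F (fst z *\<^sub>R e j) + lift G (snd z *\<^sub>R e i))"
      unfolding C1_quad_def
    proof (rule exI[of _ "\<lambda>p. F' j (fst p)"], rule exI[of _ "\<lambda>p. G' i (snd p)"], intro conjI ballI)
      show "continuous_on quadrant (\<lambda>p. F' j (fst p))"
        by (intro continuous_on_compose2[OF cF[OF j]] continuous_intros) auto
      show "continuous_on quadrant (\<lambda>p. G' i (snd p))"
        by (intro continuous_on_compose2[OF cG[OF i]] continuous_intros) auto
      fix p assume p: "p \<in> quadrant"
      have "((\<lambda>z. F j (fst z)) has_derivative (\<lambda>h. F' j (fst p) * fst h)) (at p within quadrant)"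
        by (rule has_derivative_compose[OF has_derivative_fst[OF has_derivative_ident] dF[OF j, unfolded has_field_derivative_def]])
      moreover have "((\<lambda>z. G i (snd z)) has_derivative (\<lambda>h. G' i (snd p) * snd h)) (at p within quadrant)"
        by (rule has_derivative_compose[OF has_derivative_snd[OF has_derivative_ident] dG[OF i, unfolded has_field_derivative_def]])
      ultimately have "((\<lambda>z. v + F j (fst z) + G i (snd z)) has_derivative
          (\<lambda>h. 0 + F' j (fst p) * fst h + G' i (snd p) * snd h)) (at p within quadrant)"
        by (intro has_derivative_add has_derivative_const)
      then have "((\<lambda>z. v + F j (fst z) + G i (snd z)) has_derivative
          (\<lambda>h. F' j (fst p) * fst h + G' i (snd p) * snd h)) (at p within quadrant)" by simp
      then show "((\<lambda>z. v + lift F (fst z *\<^sub>R e j) + lift G (snd z *\<^sub>R e i)) has_derivative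
          (\<lambda>h. F' j (fst p) * fst h + G' i (snd p) * snd h)) (at p within quadrant)"
      proof (rule has_derivative_transform[OF p, rotated])
        fix z assume "z \<in> quadrant"
        then show "v + lift F (fst z *\<^sub>R e j) + lift G (snd z *\<^sub>R e i) = v + F j (fst z) + G i (snd z)"
          using lift_scaled[of F, OF F0 j, of "fst z"] lift_scaled[of G, OF G0 i, of "snd z"] unfolding quadrant_def by simp
      qed
    qed
  qed
  show "pdy e (\<lambda>y x. v + lift F y + lift G x) y x k = F' k (norm y)" if k: "k \<in> {1..N}"
    unfolding pdy_def
  proof (rule the_derivative_within_halfline[where g="\<lambda>s. v + F k s + lift G x"])
    show "((\<lambda>s. v + F k s + lift G x) has_real_derivative F' k (norm y)) (at (norm y))"
      using dF[OF k, of "norm y"] by (auto intro!: derivative_eq_intros)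
  qed (use lift_scaled[of F, OF F0 k] in auto)
  show "pdx e (\<lambda>y x. v + lift F y + lift G x) y x k = G' k (norm x)" if k: "k \<in> {1..N}"
    unfolding pdx_def
  proof (rule the_derivative_within_halfline[where g="\<lambda>s. v + lift F y + G k s"])
    show "((\<lambda>s. v + lift F y + G k s) has_real_derivative G' k (norm x)) (at (norm x))"
      using dG[OF k, of "norm x"] by (auto intro!: derivative_eq_intros)
  qed (use lift_scaled[of G, OF G0 k] in auto)
qed

end

text \<open>Outside the box one of \<open>u\<^sup>2\<close>, \<open>w\<^sup>2\<close> exceeds
  \<open>\<delta>\<^sup>2\<close>. Of the bound on \<open>M\<close>, one share
  \<open>1 / \<delta>\<^sup>2\<close> absorbs the growth of \<open>P\<close>, the rest of the first
  quotient absorbs the constants, and \<open>A / \<delta>\<close> absorbs the linear terms.\<close>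

lemma outside_domination:
  fixes u w Ps Pr :: real
  assumes d: "\<delta> > 0" and P: "Ps \<ge> 0" "Pr \<ge> 0" "\<bar>u\<bar> \<le> \<delta> \<Longrightarrow> Ps \<le> Pm" "\<bar>w\<bar> \<le> \<delta> \<Longrightarrow> Pr \<le> Pm" "Pm \<ge> 0"
    and out: "\<bar>u\<bar> > \<delta> \<or> \<bar>w\<bar> > \<delta>" and A: "\<bar>a\<bar> \<le> A" "\<bar>b\<bar> \<le> A"
    and M: "M \<ge> (1 + 2 * Pm + \<bar>v\<bar> + 2 * A * \<delta>) / \<delta>\<^sup>2 + A / \<delta>"
  shows "Ps + Pr \<le> v + (a * u + M * (omega u + u\<^sup>2 * (1 + Ps))) + (b * w + M * (omega w + w\<^sup>2 * (1 + Pr)))"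
proof -
  define c where "c = 2 * Pm + \<bar>v\<bar> + 2 * A * \<delta>"
  have A0: "A \<ge> 0" using A by linarith
  have c0: "c \<ge> 0" unfolding c_def using A0 d P by simp
  have sq: "z\<^sup>2 / \<delta>\<^sup>2 \<ge> 1" if "\<bar>z\<bar> > \<delta>" for z :: real
  proof -
    have "\<delta>\<^sup>2 \<le> \<bar>z\<bar>\<^sup>2" using that d by (intro power_mono) auto
    then show ?thesis using d by simp
  qed
  \<comment> \<open>A growth term is bounded by \<open>Pm\<close> near the base point; elsewhere its
    quadratic factor is at least 1.\<close>
  have small: "p \<le> Pm + p * (z\<^sup>2 / \<delta>\<^sup>2)" if "p \<ge> 0" "\<bar>z\<bar> \<le> \<delta> \<Longrightarrow> p \<le> Pm" for p z :: real
  proof (cases "\<bar>z\<bar> \<le> \<delta>")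
    case True
    then show ?thesis using that(2)[OF True] that(1) by (simp add: add_increasing2)
  next
    case False
    then have "p * 1 \<le> p * (z\<^sup>2 / \<delta>\<^sup>2)" using sq[of z] that(1) by (intro mult_left_mono) auto
    then show ?thesis using P(5) by simp
  qed
  have lin: "- (q * z) \<le> A * \<delta> + A / \<delta> * z\<^sup>2" if "\<bar>q\<bar> \<le> A" for q z :: real
  proof -
    have "\<bar>z\<bar> \<le> \<delta> + z\<^sup>2 / \<delta>"
    proof (cases "\<bar>z\<bar> \<le> \<delta>")
      case False
      then have "\<delta> * \<bar>z\<bar> \<le> \<bar>z\<bar> * \<bar>z\<bar>" by (intro mult_right_mono) auto
      then have "\<bar>z\<bar> \<le> z\<^sup>2 / \<delta>" using d by (simp add: pos_le_divide_eq power2_eq_square mult.commute)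
      then show ?thesis using d by simp
    qed (use d in \<open>simp add: add_increasing2\<close>)
    then have "A * \<bar>z\<bar> \<le> A * (\<delta> + z\<^sup>2 / \<delta>)" using A0 by (rule mult_left_mono)
    moreover have "\<bar>q * z\<bar> \<le> A * \<bar>z\<bar>" using that by (simp add: abs_mult mult_right_mono)
    ultimately have "- (q * z) \<le> A * (\<delta> + z\<^sup>2 / \<delta>)" by linarith
    then show ?thesis by (simp add: algebra_simps)
  qed
  have "c \<le> c * ((u\<^sup>2 + w\<^sup>2) / \<delta>\<^sup>2)"
  proof -
    have "1 \<le> u\<^sup>2 / \<delta>\<^sup>2 + w\<^sup>2 / \<delta>\<^sup>2"
    proof -
      have "0 \<le> u\<^sup>2 / \<delta>\<^sup>2" "0 \<le> w\<^sup>2 / \<delta>\<^sup>2" by simp_all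
      then show ?thesis using out sq[of u] sq[of w] by linarith
    qed
    then have "c * 1 \<le> c * (u\<^sup>2 / \<delta>\<^sup>2 + w\<^sup>2 / \<delta>\<^sup>2)" using c0 by (rule mult_left_mono)
    then show ?thesis by (simp add: add_divide_distrib)
  qed
  moreover have "Ps \<le> Pm + Ps * (u\<^sup>2 / \<delta>\<^sup>2)" by (rule small[OF P(1)], rule P(3))
  moreover have "Pr \<le> Pm + Pr * (w\<^sup>2 / \<delta>\<^sup>2)" by (rule small[OF P(2)], rule P(4))
  ultimately have main: "c \<le> c * ((u\<^sup>2 + w\<^sup>2) / \<delta>\<^sup>2)" "Ps + Pr - v - a * u - b * w \<le> c + (Ps * u\<^sup>2 + Pr * w\<^sup>2) / \<delta>\<^sup>2 + A / \<delta> * (u\<^sup>2 + w\<^sup>2)"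
    using lin[OF A(1), of u] lin[OF A(2), of w]
    unfolding c_def by (simp_all add: algebra_simps add_divide_distrib)
  note main
  moreover have "(c / \<delta>\<^sup>2 + A / \<delta>) * (u\<^sup>2 + w\<^sup>2) + 1 / \<delta>\<^sup>2 * (Ps * u\<^sup>2 + Pr * w\<^sup>2) \<le> M * (u\<^sup>2 + w\<^sup>2) + M * (Ps * u\<^sup>2 + Pr * w\<^sup>2)"
  proof (intro add_mono mult_right_mono)
    have Meq: "M \<ge> 1 / \<delta>\<^sup>2 + c / \<delta>\<^sup>2 + A / \<delta>" using M unfolding c_def by (simp add: add_divide_distrib)
    have "1 / \<delta>\<^sup>2 \<ge> 0" "c / \<delta>\<^sup>2 \<ge> 0" "A / \<delta> \<ge> 0" using d c0 A0 by simp_all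
    then show "c / \<delta>\<^sup>2 + A / \<delta> \<le> M" "1 / \<delta>\<^sup>2 \<le> M" using Meq by linarith+
  qed (use P in auto)
  moreover have "M * (omega u + omega w) \<ge> 0"
  proof -
    have "M \<ge> 0" using M c0 A0 d unfolding c_def by (smt (verit) divide_nonneg_nonneg zero_le_power2)
    then show ?thesis by simp
  qed
  ultimately show ?thesis by (simp add: algebra_simps add_divide_distrib)
qed

text \<open>With \<open>\<eta> = 1\<close> on the branch of the base point and \<open>\<eta> = -1\<close> on the others, \<open>\<bar>\<eta> * s - s0\<bar>\<close> is the
  geodesic distance to the base point, so that the branches fit together continuously at \<open>s = 0\<close>.\<close>

definition bump :: "real \<Rightarrow> real \<Rightarrow> real \<Rightarrow> real \<Rightarrow> (real \<Rightarrow> real) \<Rightarrow> real \<Rightarrow> real" where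
  "bump \<eta> a s0 M P s = a * (\<eta> * s - s0) + M * (omega (\<eta> * s - s0) + (\<eta> * s - s0)\<^sup>2 * (1 + P s))"

definition dbump :: "real \<Rightarrow> real \<Rightarrow> real \<Rightarrow> real \<Rightarrow> (real \<Rightarrow> real) \<Rightarrow> (real \<Rightarrow> real) \<Rightarrow> real \<Rightarrow> real" where
  "dbump \<eta> a s0 M P P' s = a * \<eta> + M * (4/3 * root 3 (\<eta> * s - s0) * \<eta>
      + (2 * (\<eta> * s - s0) * \<eta> * (1 + P s) + (\<eta> * s - s0)\<^sup>2 * P' s))"

lemma bump_deriv:
  assumes "\<And>s. (P has_real_derivative P' s) (at s)"
  shows "(bump \<eta> a s0 M P has_real_derivative dbump \<eta> a s0 M P P' s) (at s)"
proof -
  have "((\<lambda>s. \<eta> * s - s0) has_real_derivative \<eta>) (at s)" by (auto intro!: derivative_eq_intros)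
  from DERIV_chain2[OF omega_deriv this]
  have "((\<lambda>s. omega (\<eta> * s - s0)) has_real_derivative 4/3 * root 3 (\<eta> * s - s0) * \<eta>) (at s)" .
  then show ?thesis
    unfolding bump_def[abs_def] dbump_def using assms[of s]
    by (auto intro!: derivative_eq_intros simp: algebra_simps)
qed

lemma bump_deriv_continuous:
  assumes "\<And>s. (P has_real_derivative P' s) (at s)" "continuous_on UNIV P'"
  shows "continuous_on UNIV (dbump \<eta> a s0 M P P')"
proof -
  have "continuous_on UNIV P" by (rule continuous_at_imp_continuous_on, rule ballI, rule DERIV_isCont, rule assms(1))
  then show ?thesis unfolding dbump_def[abs_def] using assms(2) by (intro continuous_intros)
qed

section \<open>Global test functions touching the minimal action\<close>

context junction_lagrangian
begin

text \<open>Half of the time per leg gives speeds \<open>2 * s\<close> and \<open>2 * r\<close>. The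
  shift by \<open>C\<close> makes all summands nonnegative, so the sum over the branches dominates
  each of them, and the bound is separable.\<close>

lemma growth:
  obtains P P' where "\<And>s. P s \<ge> 0" "\<And>s. (P has_real_derivative P' s) (at s)" "continuous_on UNIV P'"
    "\<And>k l s r. k \<in> {1..N} \<Longrightarrow> l \<in> {1..N} \<Longrightarrow> s \<ge> 0 \<Longrightarrow> r \<ge> 0 \<Longrightarrow> D k s l r \<le> P s + P r"
proof -
  obtain C where C: "C \<ge> 0" "\<And>k u. k \<in> {1..N} \<Longrightarrow> \<bar>u\<bar> - C \<le> L k u" using uniform_coercive by blast
  have LC: "L k u + C \<ge> 0" if "k \<in> {1..N}" for k u using C(2)[OF that, of u] by simp
  define P where "P = (\<lambda>s. \<Sum>k\<in>{1..N}. (L k (- 2 * s) + C) + (L k (2 * s) + C))"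
  define P' where "P' = (\<lambda>s. \<Sum>k\<in>{1..N}. - 2 * dL k (- 2 * s) + 2 * dL k (2 * s))"
  show thesis
  proof (rule that[of P P'])
    have LC2: "(L k (- 2 * s) + C) + (L k (2 * s) + C) \<ge> 0" if "k \<in> {1..N}" for k s
      by (rule add_nonneg_nonneg[OF LC[OF that] LC[OF that]])
    show P0: "P s \<ge> 0" for s unfolding P_def by (rule sum_nonneg[OF LC2])
    show "(P has_real_derivative P' s) (at s)" for s
      unfolding P_def P'_def
    proof (rule DERIV_sum)
      fix k assume k: "k \<in> {1..N}"
      have d: "((\<lambda>s. L k (c * s)) has_real_derivative dL k (c * s) * c) (at s)" for c
        by (rule DERIV_chain2[OF unif_convex.deriv1[OF convex[OF k]]]) (auto intro!: derivative_eq_intros)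
      show "((\<lambda>s. (L k (- 2 * s) + C) + (L k (2 * s) + C)) has_real_derivative - 2 * dL k (- 2 * s) + 2 * dL k (2 * s)) (at s)"
        using DERIV_add[OF DERIV_add[OF d[of "-2"] DERIV_const[of C]] DERIV_add[OF d[of 2] DERIV_const[of C]]]
        by (simp add: mult.commute)
    qed
    show "continuous_on UNIV P'"
      unfolding P'_def using contdL by (intro continuous_intros continuous_on_compose2[OF contdL]) auto
    fix k l s r assume kl: "k \<in> {1..N}" "l \<in> {1..N}" and sr: "s \<ge> (0::real)" "r \<ge> (0::real)"
    have le: "L k (- 2 * s) \<le> P s" "L k (2 * s) \<le> P s" if "k \<in> {1..N}" for k s
    proof -
      have "(L k (- 2 * s) + C) + (L k (2 * s) + C) \<le> P s"
        unfolding P_def using LC2 that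
        by (intro member_le_sum[of k "{1..N}" "\<lambda>k. (L k (- 2 * s) + C) + (L k (2 * s) + C)"]) auto
      then show "L k (- 2 * s) \<le> P s" "L k (2 * s) \<le> P s" using LC[OF that, of "- 2 * s"] LC[OF that, of "2 * s"] C(1) by linarith+
    qed
    have "D k s l r \<le> 1/2 * L k (- s / (1/2)) + 1/2 * L l (r / (1/2)) + (1 - 1/2 - 1/2) * l0"
      by (rule D_le_route[OF kl sr]) auto
    also have "\<dots> = 1/2 * L k (- 2 * s) + 1/2 * L l (2 * r)" by (simp add: mult.commute)
    also have "\<dots> \<le> P s + P r" using le(1)[OF kl(1), of s] le(2)[OF kl(2), of r] P0[of s] P0[of r] by linarith
    finally show "D k s l r \<le> P s + P r" .
  qed
qed

lemma uniform_expansion: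
  assumes "finite T" "\<And>k l. (k, l) \<in> T \<Longrightarrow> upper_expansion k s0 l r0 v (a k) (b l)"
  obtains M \<delta> where "M \<ge> 0" "\<delta> > 0"
    "\<And>k l s r. (k, l) \<in> T \<Longrightarrow> s \<ge> 0 \<Longrightarrow> r \<ge> 0 \<Longrightarrow> \<bar>s - s0\<bar> \<le> \<delta> \<Longrightarrow> \<bar>r - r0\<bar> \<le> \<delta> \<Longrightarrow>
      D k s l r \<le> v + a k * (s - s0) + b l * (r - r0) + M * (omega (s - s0) + omega (r - r0))"
proof -
  define Q where "Q = (\<lambda>p M \<delta>. \<forall>s r. s \<ge> 0 \<longrightarrow> r \<ge> 0 \<longrightarrow> \<bar>s - s0\<bar> \<le> \<delta> \<longrightarrow> \<bar>r - r0\<bar> \<le> \<delta> \<longrightarrow>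
      D (fst p) s (snd p) r \<le> v + a (fst p) * (s - s0) + b (snd p) * (r - r0) + M * (omega (s - s0) + omega (r - r0)))"
  have "\<exists>M \<delta>. M \<ge> 0 \<and> \<delta> > 0 \<and> Q p M \<delta>" if "p \<in> T" for p
    using assms(2)[of "fst p" "snd p"] that unfolding upper_expansion_def Q_def by auto
  then obtain Mf df where Md: "\<And>p. p \<in> T \<Longrightarrow> Mf p \<ge> (0::real)" "\<And>p. p \<in> T \<Longrightarrow> df p > (0::real)" "\<And>p. p \<in> T \<Longrightarrow> Q p (Mf p) (df p)"
    by metis
  define M \<delta> where "M = sum Mf T" and "\<delta> = Min (insert 1 (df ` T))"
  have "M \<ge> 0" unfolding M_def using Md(1) by (rule sum_nonneg)
  moreover have "\<delta> > 0" unfolding \<delta>_def using assms(1) Md(2) by (subst Min_gr_iff) auto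
  moreover have "D k s l r \<le> v + a k * (s - s0) + b l * (r - r0) + M * (omega (s - s0) + omega (r - r0))"
    if kl: "(k, l) \<in> T" and sr: "s \<ge> 0" "r \<ge> 0" "\<bar>s - s0\<bar> \<le> \<delta>" "\<bar>r - r0\<bar> \<le> \<delta>" for k l s r
  proof -
    have "\<delta> \<le> df (k, l)" unfolding \<delta>_def using assms(1) kl by (intro Min_le) auto
    then have "D k s l r \<le> v + a k * (s - s0) + b l * (r - r0) + Mf (k, l) * (omega (s - s0) + omega (r - r0))"
      using Md(3)[OF kl] sr unfolding Q_def by simp
    moreover have "Mf (k, l) \<le> M" unfolding M_def using kl Md(1) assms(1) by (intro member_le_sum) auto
    then have "Mf (k, l) * (omega (s - s0) + omega (r - r0)) \<le> M * (omega (s - s0) + omega (r - r0))"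
      by (intro mult_right_mono) auto
    ultimately show ?thesis by linarith
  qed
  ultimately show thesis by (rule that)
qed

text \<open>A sum of one bump in \<open>y\<close> and one in \<open>x\<close>. Near the base point
  the bumps dominate the expansions; away from it their quadratic terms, weighted by
  \<open>1 + P\<close>, dominate the growth of the minimal action.\<close>

lemma test_function:
  assumes ji: "j \<in> {1..N}" "i \<in> {1..N}" and sr0: "s0 \<ge> 0" "r0 \<ge> 0"
    and exp: "\<And>k l. k \<in> {1..N} \<Longrightarrow> l \<in> {1..N} \<Longrightarrow> k = j \<or> s0 = 0 \<Longrightarrow> l = i \<or> r0 = 0 \<Longrightarrow>
                upper_expansion k s0 l r0 v (a k) (b l)"
  obtains \<phi> where "C1_star N e \<phi>"
    "\<And>k l s r. k \<in> {1..N} \<Longrightarrow> l \<in> {1..N} \<Longrightarrow> s \<ge> 0 \<Longrightarrow> r \<ge> 0 \<Longrightarrow> D k s l r \<le> \<phi> (s *\<^sub>R e k) (r *\<^sub>R e l)"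
    "\<phi> (s0 *\<^sub>R e j) (r0 *\<^sub>R e i) = v"
    "\<And>k. k \<in> {1..N} \<Longrightarrow> k = j \<or> s0 = 0 \<Longrightarrow> pdy e \<phi> (s0 *\<^sub>R e j) (r0 *\<^sub>R e i) k = a k"
    "\<And>k. k \<in> {1..N} \<Longrightarrow> k = i \<or> r0 = 0 \<Longrightarrow> pdx e \<phi> (s0 *\<^sub>R e j) (r0 *\<^sub>R e i) k = b k"
proof -
  obtain P P' where P: "\<And>s. P s \<ge> 0" "\<And>s. (P has_real_derivative P' s) (at s)" "continuous_on UNIV P'"
    "\<And>k l s r. k \<in> {1..N} \<Longrightarrow> l \<in> {1..N} \<Longrightarrow> s \<ge> 0 \<Longrightarrow> r \<ge> 0 \<Longrightarrow> D k s l r \<le> P s + P r"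
    using growth by blast
  define T where "T = {k\<in>{1..N}. k = j \<or> s0 = 0} \<times> {l\<in>{1..N}. l = i \<or> r0 = 0}"
  have "finite T" unfolding T_def by simp
  obtain M0 \<delta>0 where M0: "M0 \<ge> 0" "\<delta>0 > 0"
    "\<And>k l s r. (k, l) \<in> T \<Longrightarrow> s \<ge> 0 \<Longrightarrow> r \<ge> 0 \<Longrightarrow> \<bar>s - s0\<bar> \<le> \<delta>0 \<Longrightarrow> \<bar>r - r0\<bar> \<le> \<delta>0 \<Longrightarrow>
      D k s l r \<le> v + a k * (s - s0) + b l * (r - r0) + M0 * (omega (s - s0) + omega (r - r0))"
    using uniform_expansion[OF \<open>finite T\<close>, of s0 r0 v a b] exp unfolding T_def by blast
  \<comment> \<open>If \<open>s0\<close> is not 0, then \<open>\<delta> < s0\<close>, so only points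
    of the base branch are within \<open>\<delta>\<close>; likewise for \<open>r0\<close>. The
    expansion is thus needed only on the branches where it is known.\<close>
  define \<delta> where "\<delta> = min \<delta>0 (min (if s0 = 0 then 1 else s0 / 2) (if r0 = 0 then 1 else r0 / 2))"
  have \<delta>: "\<delta> > 0" "\<delta> \<le> \<delta>0" "s0 \<noteq> 0 \<Longrightarrow> \<delta> < s0" "r0 \<noteq> 0 \<Longrightarrow> \<delta> < r0"
    using M0(2) sr0 unfolding \<delta>_def by auto
  \<comment> \<open>For \<open>s0 > 0\<close> all branches carry the slope of the base branch, as
    the values at 0 must agree.\<close>
  define a' where "a' = (\<lambda>k. if s0 = 0 then a k else a j)"
  define b' where "b' = (\<lambda>k. if r0 = 0 then b k else b i)"
  define \<eta> where "\<eta> = (\<lambda>k. if k = j \<or> s0 = 0 then 1 else - 1 :: real)"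
  define \<theta> where "\<theta> = (\<lambda>k. if k = i \<or> r0 = 0 then 1 else - 1 :: real)"
  have "continuous_on UNIV P"
    by (rule continuous_at_imp_continuous_on, rule ballI, rule DERIV_isCont, rule P(2))
  \<comment> \<open>The range contains every \<open>s\<close> and \<open>r\<close> with
    \<open>\<bar>u\<bar> <= \<delta>\<close> or \<open>\<bar>w\<bar> <= \<delta>\<close>,
    respectively.\<close>
  from continuous_bounded_on_interval[OF this, of "s0 + r0 + \<delta>"]
  obtain Pm where Pm: "\<And>q. \<bar>q\<bar> \<le> s0 + r0 + \<delta> \<Longrightarrow> \<bar>P q\<bar> \<le> Pm" by blast
  have Pm0: "Pm \<ge> 0" using Pm[of 0] P(1)[of 0] sr0 \<delta>(1) by simp
  define A where "A = (\<Sum>k\<in>{1..N}. \<bar>a' k\<bar>) + (\<Sum>k\<in>{1..N}. \<bar>b' k\<bar>)"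
  have A: "\<bar>a' k\<bar> \<le> A" "\<bar>b' k\<bar> \<le> A" if "k \<in> {1..N}" for k
  proof -
    have "\<bar>a' k\<bar> \<le> (\<Sum>k\<in>{1..N}. \<bar>a' k\<bar>)" "\<bar>b' k\<bar> \<le> (\<Sum>k\<in>{1..N}. \<bar>b' k\<bar>)"
      using that by (auto intro!: member_le_sum[where f="\<lambda>k. \<bar>a' k\<bar>"] member_le_sum[where f="\<lambda>k. \<bar>b' k\<bar>"])
    moreover have "(\<Sum>k\<in>{1..N}. \<bar>a' k\<bar>) \<ge> 0" "(\<Sum>k\<in>{1..N}. \<bar>b' k\<bar>) \<ge> 0" by (auto intro: sum_nonneg)
    ultimately show "\<bar>a' k\<bar> \<le> A" "\<bar>b' k\<bar> \<le> A" unfolding A_def by linarith+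
  qed
  define M1 where "M1 = (1 + 2 * Pm + \<bar>v\<bar> + 2 * A * \<delta>) / \<delta>\<^sup>2 + A / \<delta>"
  define M where "M = M0 + \<bar>M1\<bar>"
  have M: "M \<ge> M0" "M \<ge> M1" "M \<ge> 0" unfolding M_def using M0(1) by auto
  define F where "F = (\<lambda>k. bump (\<eta> k) (a' k) s0 M P)"
  define G where "G = (\<lambda>k. bump (\<theta> k) (b' k) r0 M P)"
  define F' where "F' = (\<lambda>k. dbump (\<eta> k) (a' k) s0 M P P')"
  define G' where "G' = (\<lambda>k. dbump (\<theta> k) (b' k) r0 M P P')"
  \<comment> \<open>At \<open>s = 0\<close> the sign \<open>\<eta> k\<close> drops out; the slope is
    common to all branches if \<open>s0\<close> is not 0, and otherwise its term vanishes.\<close>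
  have F0: "F k 0 = F 1 0" for k
    unfolding F_def bump_def a'_def by (cases "s0 = 0") auto
  have G0: "G k 0 = G 1 0" for k
    unfolding G_def bump_def b'_def by (cases "r0 = 0") auto
  have dF: "(F k has_real_derivative F' k s) (at s)" and dG: "(G k has_real_derivative G' k s) (at s)" for k s
    unfolding F_def F'_def G_def G'_def by (rule bump_deriv[OF P(2)])+
  have cF: "continuous_on UNIV (F' k)" and cG: "continuous_on UNIV (G' k)" for k
    unfolding F'_def G'_def by (rule bump_deriv_continuous[OF P(2,3)])+
  define \<phi> where "\<phi> = (\<lambda>y x. v + lift F y + lift G x)"
  note sep = C1_star_separable[where F=F and G=G and F'=F' and G'=G' and v=v, OF F0 G0 dF dG cF cG, folded \<phi>_def]
  have phi: "\<phi> (s *\<^sub>R e k) (r *\<^sub>R e l) = v + F k s + G l r"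
    if "k \<in> {1..N}" "l \<in> {1..N}" "s \<ge> 0" "r \<ge> 0" for k l s r
    unfolding \<phi>_def using lift_scaled[of F, OF F0 that(1,3)] lift_scaled[of G, OF G0 that(2,4)] by simp
  show thesis
  proof (rule that[of \<phi>])
    show "C1_star N e \<phi>" by (rule sep(1))
    show "\<phi> (s0 *\<^sub>R e j) (r0 *\<^sub>R e i) = v"
      using phi[OF ji sr0] unfolding F_def G_def bump_def \<eta>_def \<theta>_def by simp
    show "pdy e \<phi> (s0 *\<^sub>R e j) (r0 *\<^sub>R e i) k = a k" if "k \<in> {1..N}" "k = j \<or> s0 = 0" for k
    proof -
      have "pdy e \<phi> (s0 *\<^sub>R e j) (r0 *\<^sub>R e i) k = F' k s0"
        using sep(2)[OF that(1)] norm_scaled[OF ji(1), of s0] sr0 by (simp del: norm_scaleR)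
      also have "\<dots> = a k" using that(2) unfolding F'_def dbump_def \<eta>_def a'_def by auto
      finally show ?thesis .
    qed
    show "pdx e \<phi> (s0 *\<^sub>R e j) (r0 *\<^sub>R e i) k = b k" if "k \<in> {1..N}" "k = i \<or> r0 = 0" for k
    proof -
      have "pdx e \<phi> (s0 *\<^sub>R e j) (r0 *\<^sub>R e i) k = G' k r0"
        using sep(3)[OF that(1)] norm_scaled[OF ji(2), of r0] sr0 by (simp del: norm_scaleR)
      also have "\<dots> = b k" using that(2) unfolding G'_def dbump_def \<theta>_def b'_def by auto
      finally show ?thesis .
    qed
    fix k l s r assume kl: "k \<in> {1..N}" "l \<in> {1..N}" and sr: "s \<ge> (0::real)" "r \<ge> (0::real)"
    define u w where "u = \<eta> k * s - s0" and "w = \<theta> l * r - r0"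
    have FG: "F k s = a' k * u + M * (omega u + u\<^sup>2 * (1 + P s))" "G l r = b' l * w + M * (omega w + w\<^sup>2 * (1 + P r))"
      unfolding F_def G_def bump_def u_def w_def by simp_all
    have "D k s l r \<le> v + F k s + G l r"
    proof (cases "\<bar>u\<bar> \<le> \<delta> \<and> \<bar>w\<bar> \<le> \<delta>")
      case True
      have k: "k = j \<or> s0 = 0"
      proof (rule ccontr)
        assume "\<not> (k = j \<or> s0 = 0)"
        then have "u = - s - s0" "\<delta> < s0" using \<delta>(3) unfolding u_def \<eta>_def by auto
        then show False using True sr by linarith
      qed
      have l: "l = i \<or> r0 = 0"
      proof (rule ccontr)
        assume "\<not> (l = i \<or> r0 = 0)"
        then have "w = - r - r0" "\<delta> < r0" using \<delta>(4) unfolding w_def \<theta>_def by auto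
        then show False using True sr by linarith
      qed
      have uw: "u = s - s0" "w = r - r0" "a' k = a k" "b' l = b l"
        using k l unfolding u_def w_def \<eta>_def \<theta>_def a'_def b'_def by auto
      have "(k, l) \<in> T" using k l kl unfolding T_def by simp
      from M0(3)[OF this sr] True \<delta>(2) uw
      have "D k s l r \<le> v + a' k * u + b' l * w + M0 * (omega u + omega w)" by simp
      also have "M0 * (omega u + omega w) \<le> M * (omega u + omega w)"
        using M(1) by (intro mult_right_mono) auto
      also have "\<dots> \<le> M * (omega u + u\<^sup>2 * (1 + P s)) + M * (omega w + w\<^sup>2 * (1 + P r))"
      proof -
        have "M * (u\<^sup>2 * (1 + P s)) \<ge> 0" "M * (w\<^sup>2 * (1 + P r)) \<ge> 0" using M(3) P(1) by (simp_all add: add_nonneg_nonneg)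
        then show ?thesis by (simp add: distrib_left)
      qed
      finally show ?thesis unfolding FG by linarith
    next
      case False
      have "s \<le> \<bar>u\<bar> + s0" "r \<le> \<bar>w\<bar> + r0" using sr sr0 unfolding u_def w_def \<eta>_def \<theta>_def by (auto split: if_splits)
      then have small: "\<bar>u\<bar> \<le> \<delta> \<Longrightarrow> P s \<le> Pm" "\<bar>w\<bar> \<le> \<delta> \<Longrightarrow> P r \<le> Pm"
        using Pm[of s] Pm[of r] sr sr0 by linarith+
      have "P s + P r \<le> v + (a' k * u + M * (omega u + u\<^sup>2 * (1 + P s))) + (b' l * w + M * (omega w + w\<^sup>2 * (1 + P r)))"
      proof (rule outside_domination[OF \<delta>(1) P(1) P(1) _ _ Pm0 _ A(1)[OF kl(1)] A(2)[OF kl(2)]])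
        show "(1 + 2 * Pm + \<bar>v\<bar> + 2 * A * \<delta>) / \<delta>\<^sup>2 + A / \<delta> \<le> M" using M(2) unfolding M1_def .
        show "\<delta> < \<bar>u\<bar> \<or> \<delta> < \<bar>w\<bar>" using False by linarith
      qed (use small in auto)
      then show ?thesis unfolding FG using P(4)[OF kl sr] by linarith
    qed
    then show "D k s l r \<le> \<phi> (s *\<^sub>R e k) (r *\<^sub>R e l)" using phi[OF kl sr] by simp
  qed
qed

section \<open>Continuity and assembly\<close>

lemma gdist_scaled:
  assumes ji: "j \<in> {1..N}" "i \<in> {1..N}" and sr: "s \<ge> 0" "r \<ge> 0"
  shows "gdist N e (s *\<^sub>R e j) (r *\<^sub>R e i) = (if i = j then \<bar>s - r\<bar> else s + r)"
proof (cases "i = j")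
  case True
  have "s *\<^sub>R e j \<in> branch e j" "r *\<^sub>R e i \<in> branch e j" using scaled_in_branch sr True by auto
  then have "gdist N e (s *\<^sub>R e j) (r *\<^sub>R e i) = norm (s *\<^sub>R e j - r *\<^sub>R e i)" unfolding gdist_def using ji by auto
  also have "\<dots> = norm ((s - r) *\<^sub>R e j)" using True by (simp add: scaleR_left_diff_distrib)
  finally show ?thesis using norm_scaled[OF ji(1), of "s - r"] True by simp
next
  case False
  have n: "norm (s *\<^sub>R e j) = s" "norm (r *\<^sub>R e i) = r" using norm_scaled ji sr by (simp_all del: norm_scaleR)
  show ?thesis
  proof (cases "\<exists>k\<in>{1..N}. s *\<^sub>R e j \<in> branch e k \<and> r *\<^sub>R e i \<in> branch e k")
    case True
    then obtain k where k: "k \<in> {1..N}" "s *\<^sub>R e j \<in> branch e k" "r *\<^sub>R e i \<in> branch e k" by blast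
    \<comment> \<open>Points carrying different indices share a branch only if one of them is 0, and
      then both formulas for the distance agree.\<close>
    have "s = 0 \<or> r = 0"
    proof (rule ccontr)
      assume "\<not> (s = 0 \<or> r = 0)"
      then have "s *\<^sub>R e j \<noteq> 0" "r *\<^sub>R e i \<noteq> 0" using e_nonzero ji by auto
      then have "k = j" "k = i" using branch_unique k ji scaled_in_branch sr by metis+
      then show False using False by simp
    qed
    then have "norm (s *\<^sub>R e j - r *\<^sub>R e i) = s + r" using n by auto
    then show ?thesis unfolding gdist_def using True False by simp
  next
    case nc: False
    then have "gdist N e (s *\<^sub>R e j) (r *\<^sub>R e i) = norm (s *\<^sub>R e j) + norm (r *\<^sub>R e i)"
      unfolding gdist_def by (rule if_not_P)
    then show ?thesis unfolding n using False by simp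
  qed
qed

text \<open>At each point the minimal action is squeezed between two continuous functions that agree
  with it there: the lower support and a test function from above.\<close>

lemma continuous_on_D:
  assumes kl: "k \<in> {1..N}" "l \<in> {1..N}"
    and upper: "\<And>s r. s \<ge> 0 \<Longrightarrow> r \<ge> 0 \<Longrightarrow> \<exists>\<phi>. continuous_on quadrant \<phi> \<and> \<phi> (s, r) = D k s l r
        \<and> (\<forall>s'\<ge>0. \<forall>r'\<ge>0. D k s' l r' \<le> \<phi> (s', r'))"
  shows "continuous_on quadrant (\<lambda>p. D k (fst p) l (snd p))"
  unfolding continuous_on_def
proof
  fix p assume p: "p \<in> quadrant"
  then have sr: "fst p \<ge> 0" "snd p \<ge> 0" unfolding quadrant_def by auto
  obtain \<mu> t1 q1 t2 q2 where "optimal k (fst p) l (snd p) \<mu> t1 q1 t2 q2" using optimal_exists[OF kl] by blast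
  from lower_support[OF kl sr this] obtain f where f: "continuous_on UNIV f"
    "\<And>s' r'. s' \<ge> 0 \<Longrightarrow> r' \<ge> 0 \<Longrightarrow> f (s', r') \<le> D k s' l r'" "f (fst p, snd p) = D k (fst p) l (snd p)" by blast
  obtain \<phi> where \<phi>: "continuous_on quadrant \<phi>" "\<phi> (fst p, snd p) = D k (fst p) l (snd p)"
    "\<And>s' r'. s' \<ge> 0 \<Longrightarrow> r' \<ge> 0 \<Longrightarrow> D k s' l r' \<le> \<phi> (s', r')" using upper[OF sr] by blast
  have "continuous_on quadrant f" using f(1) continuous_on_subset by blast
  then have "(f \<longlongrightarrow> D k (fst p) l (snd p)) (at p within quadrant)" "(\<phi> \<longlongrightarrow> D k (fst p) l (snd p)) (at p within quadrant)"
    using \<phi>(1,2) f(3) p unfolding continuous_on_def by (metis prod.collapse)+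
  moreover have "\<forall>\<^sub>F x in at p within quadrant. f x \<le> D k (fst x) l (snd x)"
    "\<forall>\<^sub>F x in at p within quadrant. D k (fst x) l (snd x) \<le> \<phi> x"
    using f(2) \<phi>(3) unfolding eventually_at_filter quadrant_def by (auto intro!: always_eventually)
  ultimately show "((\<lambda>p. D k (fst p) l (snd p)) \<longlongrightarrow> D k (fst p) l (snd p)) (at p within quadrant)"
    using tendsto_sandwich[of f "\<lambda>p. D k (fst p) l (snd p)" "at p within quadrant" \<phi>] by blast
qed

lemma D0_eq_D_norm:
  assumes "k \<in> {1..N}" "l \<in> {1..N}" "y \<in> branch e k" "x \<in> branch e l"
  shows "D0 N e L y x = ereal (D k (norm y) l (norm x))"
proof -
  have "y = norm y *\<^sub>R e k" "x = norm x *\<^sub>R e l" using assms branch_iff by blast+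
  then show ?thesis using D0_eq_D[OF assms(1,2), of "norm y" "norm x"] by (metis norm_ge_zero)
qed

definition hj_test :: "real^2 \<Rightarrow> real^2 \<Rightarrow> (real^2 \<Rightarrow> real^2 \<Rightarrow> real) \<Rightarrow> bool" where
  "hj_test y x \<phi> \<longleftrightarrow> C1_star N e \<phi>
          \<and> (\<forall>y'\<in>J. \<forall>x'\<in>J. D0 N e L y' x' \<le> ereal (\<phi> y' x'))
          \<and> ereal (\<phi> y x) = D0 N e L y x
          \<and> (\<forall>i\<in>{1..N}. \<forall>j\<in>{1..N}. x \<in> branch e i \<longrightarrow> y \<in> branch e j \<longrightarrow>
               (x \<noteq> 0 \<longrightarrow> Eterm e \<phi> y x i j + Ham L i (pdx e \<phi> y x i) = 0)
             \<and> (x = 0 \<longrightarrow> Eterm e \<phi> y x i j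
                    + Max ((\<lambda>k. Ham_minus L k (pdx e \<phi> y 0 k)) ` {1..N}) = 0)
             \<and> (y \<noteq> 0 \<longrightarrow> Eterm e \<phi> y x i j + Ham L j (- pdy e \<phi> y x j) = 0)
             \<and> (y = 0 \<longrightarrow> N \<ge> 2 \<longrightarrow> Eterm e \<phi> y x i j
                    + Max ((\<lambda>k. Ham_minus L k (- pdy e \<phi> 0 x k)) ` {1..N}) = 0)
             \<and> (y = 0 \<longrightarrow> N = 1 \<longrightarrow> Eterm e \<phi> y x i j
                    + Ham L 1 (- pdy e \<phi> 0 x 1) = 0))"

definition gradient_bound :: "real^2 \<Rightarrow> real^2 \<Rightarrow> (real^2 \<Rightarrow> real^2 \<Rightarrow> real) \<Rightarrow> real \<Rightarrow> bool" where
  "gradient_bound y x \<phi> c \<longleftrightarrow> (\<forall>i\<in>{1..N}. \<forall>j\<in>{1..N}. x \<in> branch e i \<longrightarrow> y \<in> branch e j \<longrightarrow>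
      abs_dx N e \<phi> y x i + abs_dy N e \<phi> y x j \<le> c)"

lemma hj_test_exists:
  obtains C where "\<And>y x. y \<in> J \<Longrightarrow> x \<in> J \<Longrightarrow>
      \<exists>\<phi>. hj_test y x \<phi> \<and> (\<forall>R. gdist N e y x \<le> R \<longrightarrow> gradient_bound y x \<phi> (C R))"
proof -
  obtain B where B: "\<And>j i s r. j \<in> {1..N} \<Longrightarrow> i \<in> {1..N} \<Longrightarrow> s \<ge> 0 \<Longrightarrow> r \<ge> 0 \<Longrightarrow> \<exists>a b. test_data B j s i r a b"
    using test_data_exists by blast
  \<comment> \<open>One summand per variable: at 0 the gradient is a vector with \<open>N\<close>
    entries, whose Euclidean norm is at most the sum of their absolute values.\<close>
  define C where "C = (\<lambda>R. real N * \<bar>B R\<bar> + real N * \<bar>B R\<bar>)"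
  show thesis
  proof (rule that[of C])
    fix y x assume "y \<in> J" "x \<in> J"
    obtain j where j: "j \<in> {1..N}" "y \<in> branch e j" "y = norm y *\<^sub>R e j" using J_cases[OF \<open>y \<in> J\<close>] by blast
    obtain i where i: "i \<in> {1..N}" "x \<in> branch e i" "x = norm x *\<^sub>R e i" using J_cases[OF \<open>x \<in> J\<close>] by blast
    define s r where "s = norm y" and "r = norm x"
    have y: "y = s *\<^sub>R e j" and x: "x = r *\<^sub>R e i" using i j unfolding s_def r_def by blast+
    have sr: "s \<ge> 0" "r \<ge> 0" and s0: "s = 0 \<longleftrightarrow> y = 0" and r0: "r = 0 \<longleftrightarrow> x = 0" unfolding s_def r_def by auto
    from B[OF j(1) i(1) sr, unfolded test_data_def] obtain a b where
        exp0: "\<forall>k\<in>{1..N}. \<forall>l\<in>{1..N}. (k = j \<or> s = 0) \<longrightarrow> (l = i \<or> r = 0) \<longrightarrow>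
                upper_expansion k s l r (D j s i r) (a k) (b l)"
      and hj: "hj_slopes j s i r (D j s i r - r * b i - s * a j) a b"
      and bd0: "\<forall>R. (if i = j then \<bar>s - r\<bar> else s + r) \<le> R \<longrightarrow>
              (\<forall>k\<in>{1..N}. ((k = j \<or> s = 0) \<longrightarrow> \<bar>a k\<bar> \<le> B R) \<and> ((k = i \<or> r = 0) \<longrightarrow> \<bar>b k\<bar> \<le> B R))"
      by (elim exE conjE)
    have exp: "upper_expansion k s l r (D j s i r) (a k) (b l)"
      if "k \<in> {1..N}" "l \<in> {1..N}" "k = j \<or> s = 0" "l = i \<or> r = 0" for k l
      using exp0[rule_format, OF that] .
    have bd: "((k = j \<or> s = 0) \<longrightarrow> \<bar>a k\<bar> \<le> B R) \<and> ((k = i \<or> r = 0) \<longrightarrow> \<bar>b k\<bar> \<le> B R)"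
      if "(if i = j then \<bar>s - r\<bar> else s + r) \<le> R" "k \<in> {1..N}" for R k
      using bd0[THEN spec, THEN mp, OF that(1), THEN bspec, OF that(2)] .
    obtain \<phi> where \<phi>: "C1_star N e \<phi>"
      "\<And>k l s r. k \<in> {1..N} \<Longrightarrow> l \<in> {1..N} \<Longrightarrow> s \<ge> 0 \<Longrightarrow> r \<ge> 0 \<Longrightarrow> D k s l r \<le> \<phi> (s *\<^sub>R e k) (r *\<^sub>R e l)"
      "\<phi> (s *\<^sub>R e j) (r *\<^sub>R e i) = D j s i r"
      and dy: "\<And>k. k \<in> {1..N} \<Longrightarrow> k = j \<or> s = 0 \<Longrightarrow> pdy e \<phi> (s *\<^sub>R e j) (r *\<^sub>R e i) k = a k"
      and dx: "\<And>k. k \<in> {1..N} \<Longrightarrow> k = i \<or> r = 0 \<Longrightarrow> pdx e \<phi> (s *\<^sub>R e j) (r *\<^sub>R e i) k = b k"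
      using test_function[where v="D j s i r" and a=a and b=b, OF j(1) i(1) sr exp] by blast
    note \<phi> = \<phi>(1,2) \<phi>(3)[folded y x] and dy = dy[folded y x] and dx = dx[folded y x]
    have "hj_test y x \<phi>"
      unfolding hj_test_def
    proof (intro conjI ballI)
      show "C1_star N e \<phi>" by (rule \<phi>(1))
      show "ereal (\<phi> y x) = D0 N e L y x"
        using D0_eq_D[OF j(1) i(1) sr] \<phi>(3) unfolding y[symmetric] x[symmetric] by simp
      fix y' x' assume "y' \<in> J" "x' \<in> J"
      obtain k where k: "k \<in> {1..N}" "y' \<in> branch e k" "y' = norm y' *\<^sub>R e k" using J_cases[OF \<open>y' \<in> J\<close>] by blast
      obtain l where l: "l \<in> {1..N}" "x' \<in> branch e l" "x' = norm x' *\<^sub>R e l" using J_cases[OF \<open>x' \<in> J\<close>] by blast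
      have "D k (norm y') l (norm x') \<le> \<phi> y' x'"
        using \<phi>(2)[OF k(1) l(1) norm_ge_zero norm_ge_zero, of y' x'] unfolding k(3)[symmetric] l(3)[symmetric] .
      then show "D0 N e L y' x' \<le> ereal (\<phi> y' x')" using D0_eq_D_norm[OF k(1) l(1) k(2) l(2)] by simp
    next
      fix i' j' assume i': "i' \<in> {1..N}" and j': "j' \<in> {1..N}"
      show "x \<in> branch e i' \<longrightarrow> y \<in> branch e j' \<longrightarrow>
               (x \<noteq> 0 \<longrightarrow> Eterm e \<phi> y x i' j' + Ham L i' (pdx e \<phi> y x i') = 0)
             \<and> (x = 0 \<longrightarrow> Eterm e \<phi> y x i' j'
                    + Max ((\<lambda>k. Ham_minus L k (pdx e \<phi> y 0 k)) ` {1..N}) = 0)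
             \<and> (y \<noteq> 0 \<longrightarrow> Eterm e \<phi> y x i' j' + Ham L j' (- pdy e \<phi> y x j') = 0)
             \<and> (y = 0 \<longrightarrow> N \<ge> 2 \<longrightarrow> Eterm e \<phi> y x i' j'
                    + Max ((\<lambda>k. Ham_minus L k (- pdy e \<phi> 0 x k)) ` {1..N}) = 0)
             \<and> (y = 0 \<longrightarrow> N = 1 \<longrightarrow> Eterm e \<phi> y x i' j'
                    + Ham L 1 (- pdy e \<phi> 0 x 1) = 0)"
      proof (intro impI)
        assume "x \<in> branch e i'" "y \<in> branch e j'"
        then have ii: "x \<noteq> 0 \<Longrightarrow> i' = i" and jj: "y \<noteq> 0 \<Longrightarrow> j' = j"
          using branch_unique[OF i' i(1)] branch_unique[OF j' j(1)] i(2) j(2) by blast+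
        \<comment> \<open>The index \<open>i'\<close> is forced to be \<open>i\<close> unless
          \<open>x = 0\<close>, and then the factor \<open>norm x\<close> removes the dependence on
          it.\<close>
        have "norm x * pdx e \<phi> y x i' = r * b i"
          using ii dx[OF i(1)] unfolding r_def by (cases "x = 0") auto
        moreover have "norm y * pdy e \<phi> y x j' = s * a j"
          using jj dy[OF j(1)] unfolding s_def by (cases "y = 0") auto
        ultimately have E: "Eterm e \<phi> y x i' j' = D j s i r - r * b i - s * a j"
          unfolding Eterm_def \<phi>(3) by simp
        have c1: "E + Ham L i' (pdx e \<phi> y x i') = 0" if "x \<noteq> 0" "E + Ham L i (b i) = 0" for E
          using that ii dx[OF i(1)] by simp
        have c2: "(\<lambda>k. Ham_minus L k (pdx e \<phi> y 0 k)) ` {1..N} = (\<lambda>k. Ham_minus L k (b k)) ` {1..N}" if "x = 0"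
          by (rule image_cong[OF refl]) (use dx r0 that in simp)
        have c3: "E + Ham L j' (- pdy e \<phi> y x j') = 0" if "y \<noteq> 0" "E + Ham L j (- a j) = 0" for E
          using that jj dy[OF j(1)] by simp
        have c4: "(\<lambda>k. Ham_minus L k (- pdy e \<phi> 0 x k)) ` {1..N} = (\<lambda>k. Ham_minus L k (- a k)) ` {1..N}" if "y = 0"
          by (rule image_cong[OF refl]) (use dy s0 that in simp)
        have c5: "pdy e \<phi> 0 x 1 = a 1" if "y = 0" "N = 1"
          using dy[of 1] s0 that by simp
        have pos: "y \<noteq> 0 \<Longrightarrow> s > 0" "x \<noteq> 0 \<Longrightarrow> r > 0" unfolding s_def r_def by auto
        note h = hj[unfolded hj_slopes_def]
        show "(x \<noteq> 0 \<longrightarrow> Eterm e \<phi> y x i' j' + Ham L i' (pdx e \<phi> y x i') = 0)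
             \<and> (x = 0 \<longrightarrow> Eterm e \<phi> y x i' j'
                    + Max ((\<lambda>k. Ham_minus L k (pdx e \<phi> y 0 k)) ` {1..N}) = 0)
             \<and> (y \<noteq> 0 \<longrightarrow> Eterm e \<phi> y x i' j' + Ham L j' (- pdy e \<phi> y x j') = 0)
             \<and> (y = 0 \<longrightarrow> N \<ge> 2 \<longrightarrow> Eterm e \<phi> y x i' j'
                    + Max ((\<lambda>k. Ham_minus L k (- pdy e \<phi> 0 x k)) ` {1..N}) = 0)
             \<and> (y = 0 \<longrightarrow> N = 1 \<longrightarrow> Eterm e \<phi> y x i' j'
                    + Ham L 1 (- pdy e \<phi> 0 x 1) = 0)"
          unfolding E
        proof (intro conjI impI)
          assume "x \<noteq> 0"
          then show "D j s i r - r * b i - s * a j + Ham L i' (pdx e \<phi> y x i') = 0"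
            using h pos(2) by (intro c1) blast+
        next
          assume "x = 0"
          show "D j s i r - r * b i - s * a j + Max ((\<lambda>k. Ham_minus L k (pdx e \<phi> y 0 k)) ` {1..N}) = 0"
            unfolding c2[OF \<open>x = 0\<close>] using h r0 \<open>x = 0\<close> by blast
        next
          assume "y \<noteq> 0"
          then show "D j s i r - r * b i - s * a j + Ham L j' (- pdy e \<phi> y x j') = 0"
            using h pos(1) by (intro c3) blast+
        next
          assume "y = 0" "2 \<le> N"
          show "D j s i r - r * b i - s * a j + Max ((\<lambda>k. Ham_minus L k (- pdy e \<phi> 0 x k)) ` {1..N}) = 0"
            unfolding c4[OF \<open>y = 0\<close>] using h s0 \<open>y = 0\<close> \<open>2 \<le> N\<close> by blast
        next
          assume "y = 0" "N = 1"
          show "D j s i r - r * b i - s * a j + Ham L 1 (- pdy e \<phi> 0 x 1) = 0"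
            unfolding c5[OF \<open>y = 0\<close> \<open>N = 1\<close>] using h s0 \<open>y = 0\<close> \<open>N = 1\<close> by blast
        qed
      qed
    qed
    moreover have "abs_dx N e \<phi> y x i' + abs_dy N e \<phi> y x j' \<le> C R"
      if R: "gdist N e y x \<le> R" and i': "i' \<in> {1..N}" "x \<in> branch e i'" and j': "j' \<in> {1..N}" "y \<in> branch e j'" for R i' j'
    proof -
      have "gdist N e y x = (if i = j then \<bar>s - r\<bar> else s + r)"
        using gdist_scaled[OF j(1) i(1) sr] unfolding y[symmetric] x[symmetric] .
      then have bd': "k = j \<or> s = 0 \<Longrightarrow> \<bar>a k\<bar> \<le> \<bar>B R\<bar>" "k = i \<or> r = 0 \<Longrightarrow> \<bar>b k\<bar> \<le> \<bar>B R\<bar>" if "k \<in> {1..N}" for k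
        using bd[OF _ that, of R] R by auto
      have one: "\<bar>B R\<bar> \<le> real N * \<bar>B R\<bar>" using N1 by (simp add: mult_le_cancel_right1)
      have norm_le: "sqrt (\<Sum>k\<in>{1..N}. (f k)\<^sup>2) \<le> real N * \<bar>B R\<bar>" if "\<And>k. k \<in> {1..N} \<Longrightarrow> \<bar>f k\<bar> \<le> \<bar>B R\<bar>" for f :: "nat \<Rightarrow> real"
      proof -
        have "sqrt (\<Sum>k\<in>{1..N}. (f k)\<^sup>2) \<le> (\<Sum>k\<in>{1..N}. \<bar>f k\<bar>)"
          using L2_set_le_sum_abs[of f "{1..N}"] unfolding L2_set_def .
        also have "\<dots> \<le> (\<Sum>k\<in>{1..N}. \<bar>B R\<bar>)" by (rule sum_mono) (rule that)
        finally show ?thesis by simp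
      qed
      have "abs_dx N e \<phi> y x i' \<le> real N * \<bar>B R\<bar>"
      proof (cases "x = 0")
        case True
        then show ?thesis unfolding abs_dx_def using norm_le[of "\<lambda>k. pdx e \<phi> y 0 k"] dx bd'(2) r0 by simp
      next
        case False
        then have "i' = i" using branch_unique[OF i'(1) i(1) i'(2) i(2)] by blast
        then show ?thesis unfolding abs_dx_def using False dx[OF i(1)] bd'(2)[OF i(1)] one by simp
      qed
      moreover have "abs_dy N e \<phi> y x j' \<le> real N * \<bar>B R\<bar>"
      proof (cases "y = 0")
        case True
        then show ?thesis unfolding abs_dy_def using norm_le[of "\<lambda>k. pdy e \<phi> 0 x k"] dy bd'(1) s0 by simp
      next
        case False
        then have "j' = j" using branch_unique[OF j'(1) j(1) j'(2) j(2)] by blast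
        then show ?thesis unfolding abs_dy_def using False dy[OF j(1)] bd'(1)[OF j(1)] one by simp
      qed
      ultimately show ?thesis unfolding C_def by linarith
    qed
    ultimately show "\<exists>\<phi>. hj_test y x \<phi> \<and> (\<forall>R. gdist N e y x \<le> R \<longrightarrow> gradient_bound y x \<phi> (C R))"
      unfolding gradient_bound_def by blast
  qed
qed

text \<open>The test functions themselves serve as the upper barriers on each pair of branches;
  finitely many closed pairs cover \<open>J \<times> J\<close>, so continuity on each piece
  suffices.\<close>

lemma D0_continuous: "continuous_on (J \<times> J) (\<lambda>z. real_of_ereal (D0 N e L (fst z) (snd z)))"
proof -
  obtain C where C: "\<And>y x. y \<in> J \<Longrightarrow> x \<in> J \<Longrightarrow>
      \<exists>\<phi>. hj_test y x \<phi> \<and> (\<forall>R. gdist N e y x \<le> R \<longrightarrow> gradient_bound y x \<phi> (C R))" using hj_test_exists by blast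
  have quad: "continuous_on quadrant (\<lambda>p. D k (fst p) l (snd p))" if kl: "k \<in> {1..N}" "l \<in> {1..N}" for k l
  proof (rule continuous_on_D[OF kl])
    fix s r :: real assume sr: "s \<ge> 0" "r \<ge> 0"
    obtain \<phi> where \<phi>: "hj_test (s *\<^sub>R e k) (r *\<^sub>R e l) \<phi>"
      using C[OF scaled_in_J[OF kl(1) sr(1)] scaled_in_J[OF kl(2) sr(2)]] by blast
    have cont: "continuous_on (J \<times> J) (\<lambda>z. \<phi> (fst z) (snd z))"
      using \<phi> unfolding hj_test_def C1_star_def by blast
    define f where "f = (\<lambda>p. \<phi> (fst p *\<^sub>R e k) (snd p *\<^sub>R e l))"
    have "continuous_on quadrant (\<lambda>p. (\<lambda>z. \<phi> (fst z) (snd z)) (fst p *\<^sub>R e k, snd p *\<^sub>R e l))"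
      by (rule continuous_on_compose2[OF cont])
         (auto intro!: continuous_intros simp: quadrant_def scaled_in_J[OF kl(1)] scaled_in_J[OF kl(2)])
    then have "continuous_on quadrant f" unfolding f_def by simp
    moreover have "f (s, r) = D k s l r"
      using \<phi> D0_eq_D[OF kl sr] unfolding hj_test_def f_def by simp
    moreover have "D k s' l r' \<le> f (s', r')" if "s' \<ge> 0" "r' \<ge> 0" for s' r'
    proof -
      have "D0 N e L (s' *\<^sub>R e k) (r' *\<^sub>R e l) \<le> ereal (\<phi> (s' *\<^sub>R e k) (r' *\<^sub>R e l))"
        using \<phi> scaled_in_J[OF kl(1) that(1)] scaled_in_J[OF kl(2) that(2)] unfolding hj_test_def by blast
      then show ?thesis using D0_eq_D[OF kl that] unfolding f_def by simp
    qed
    ultimately show "\<exists>\<phi>. continuous_on quadrant \<phi> \<and> \<phi> (s, r) = D k s l r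
        \<and> (\<forall>s'\<ge>0. \<forall>r'\<ge>0. D k s' l r' \<le> \<phi> (s', r'))" by blast
  qed
  have "continuous_on (branch e k \<times> branch e l) (\<lambda>z. real_of_ereal (D0 N e L (fst z) (snd z)))"
    if kl: "k \<in> {1..N}" "l \<in> {1..N}" for k l
  proof -
    have "continuous_on (branch e k \<times> branch e l) (\<lambda>z. (\<lambda>p. D k (fst p) l (snd p)) (norm (fst z), norm (snd z)))"
      by (rule continuous_on_compose2[OF quad[OF kl]]) (auto intro!: continuous_intros simp: quadrant_def)
    then show ?thesis
      by (rule continuous_on_eq) (use D0_eq_D_norm[OF kl] in auto)
  qed
  moreover have "J \<times> J = (\<Union>p\<in>{1..N}\<times>{1..N}. branch e (fst p) \<times> branch e (snd p))"
    unfolding junction_def by auto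
  moreover have "closed (branch e k \<times> branch e l)" if "k \<in> {1..N}" "l \<in> {1..N}" for k l
    using closed_branch that by (intro closed_Times) auto
  ultimately show ?thesis
    by (simp only:) (intro continuous_on_closed_Union, auto)
qed

end

theorem mainTheorem7:
  fixes N :: nat and e :: "nat \<Rightarrow> real^2" and L :: "nat \<Rightarrow> real \<Rightarrow> real" and \<gamma> :: real
  assumes N1: "N \<ge> 1"
    and e_distinct: "inj_on e {1..N}"
    and e_unit: "\<forall>i\<in>{1..N}. norm (e i) = 1"
    and gamma_pos: "\<gamma> > 0"
    and A1: "\<forall>i\<in>{1..N}. C2_unif_convex (L i) \<gamma>"
  shows "(\<forall>y\<in>junction N e. \<forall>x\<in>junction N e. D0 N e L y x \<noteq> \<infinity> \<and> D0 N e L y x \<noteq> -\<infinity>)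
    \<and> continuous_on (junction N e \<times> junction N e) (\<lambda>z. real_of_ereal (D0 N e L (fst z) (snd z)))
    \<and> (\<exists>\<Phi> :: real^2 \<Rightarrow> real^2 \<Rightarrow> (real^2 \<Rightarrow> real^2 \<Rightarrow> real).
         (\<forall>y\<in>junction N e. \<forall>x\<in>junction N e.
            C1_star N e (\<Phi> y x)
          \<and> (\<forall>y'\<in>junction N e. \<forall>x'\<in>junction N e. D0 N e L y' x' \<le> ereal (\<Phi> y x y' x'))
          \<and> ereal (\<Phi> y x y x) = D0 N e L y x
          \<and> (\<forall>i\<in>{1..N}. \<forall>j\<in>{1..N}. x \<in> branch e i \<longrightarrow> y \<in> branch e j \<longrightarrow>
               (x \<noteq> 0 \<longrightarrow> Eterm e (\<Phi> y x) y x i j + Ham L i (pdx e (\<Phi> y x) y x i) = 0)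
             \<and> (x = 0 \<longrightarrow> Eterm e (\<Phi> y x) y x i j
                    + Max ((\<lambda>k. Ham_minus L k (pdx e (\<Phi> y x) y 0 k)) ` {1..N}) = 0)
             \<and> (y \<noteq> 0 \<longrightarrow> Eterm e (\<Phi> y x) y x i j + Ham L j (- pdy e (\<Phi> y x) y x j) = 0)
             \<and> (y = 0 \<longrightarrow> N \<ge> 2 \<longrightarrow> Eterm e (\<Phi> y x) y x i j
                    + Max ((\<lambda>k. Ham_minus L k (- pdy e (\<Phi> y x) 0 x k)) ` {1..N}) = 0)
             \<and> (y = 0 \<longrightarrow> N = 1 \<longrightarrow> Eterm e (\<Phi> y x) y x i j
                    + Ham L 1 (- pdy e (\<Phi> y x) 0 x 1) = 0)))
       \<and> (\<forall>R>0. \<exists>C>0. \<forall>y\<in>junction N e. \<forall>x\<in>junction N e. gdist N e y x \<le> R \<longrightarrow>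
            (\<forall>i\<in>{1..N}. \<forall>j\<in>{1..N}. x \<in> branch e i \<longrightarrow> y \<in> branch e j \<longrightarrow>
               abs_dx N e (\<Phi> y x) y x i + abs_dy N e (\<Phi> y x) y x j \<le> C)))"
proof -
  have "\<forall>i\<in>{1..N}. \<exists>D1 D2. unif_convex (L i) D1 D2 \<gamma>"
    using A1 gamma_pos unfolding C2_unif_convex_def unif_convex_def by blast
  then obtain dL ddL where "\<And>i. i \<in> {1..N} \<Longrightarrow> unif_convex (L i) (dL i) (ddL i) \<gamma>" by metis
  then interpret junction_lagrangian N e L dL ddL \<gamma>
    using N1 e_distinct e_unit unfolding junction_lagrangian_def star_junction_def junction_lagrangian_axioms_def by blast
  obtain C where C: "\<And>y x. y \<in> J \<Longrightarrow> x \<in> J \<Longrightarrow>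
      \<exists>\<phi>. hj_test y x \<phi> \<and> (\<forall>R. gdist N e y x \<le> R \<longrightarrow> gradient_bound y x \<phi> (C R))" using hj_test_exists by blast
  \<comment> \<open>One test function per base point is chosen before \<open>R\<close>, so the
    gradient bounds for all \<open>R\<close> hold for the same choice.\<close>
  then obtain \<Phi> where \<Phi>: "\<And>y x. y \<in> J \<Longrightarrow> x \<in> J \<Longrightarrow> hj_test y x (\<Phi> y x)"
    and bd: "\<And>y x R. y \<in> J \<Longrightarrow> x \<in> J \<Longrightarrow> gdist N e y x \<le> R \<Longrightarrow> gradient_bound y x (\<Phi> y x) (C R)"
    by metis
  have fin: "D0 N e L y x \<noteq> \<infinity> \<and> D0 N e L y x \<noteq> -\<infinity>" if "y \<in> J" "x \<in> J" for y x
    using \<Phi>[OF that] unfolding hj_test_def by (metis MInfty_neq_ereal(1) PInfty_neq_ereal(1))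
  have "\<exists>C'>0. \<forall>y\<in>J. \<forall>x\<in>J. gdist N e y x \<le> R \<longrightarrow>
            (\<forall>i\<in>{1..N}. \<forall>j\<in>{1..N}. x \<in> branch e i \<longrightarrow> y \<in> branch e j \<longrightarrow>
               abs_dx N e (\<Phi> y x) y x i + abs_dy N e (\<Phi> y x) y x j \<le> C')" for R
  proof (rule exI[of _ "\<bar>C R\<bar> + 1"], intro conjI ballI impI)
    fix y x i j assume yx: "y \<in> J" "x \<in> J" "gdist N e y x \<le> R"
      and ij: "i \<in> {1..N}" "j \<in> {1..N}" "x \<in> branch e i" "y \<in> branch e j"
    from bd[OF yx, unfolded gradient_bound_def, rule_format, OF ij] show "abs_dx N e (\<Phi> y x) y x i + abs_dy N e (\<Phi> y x) y x j \<le> \<bar>C R\<bar> + 1" by linarith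
  qed simp
  then show ?thesis
    using fin D0_continuous \<Phi>[unfolded hj_test_def] by (intro conjI exI[of _ \<Phi>]) blast+
qed

end
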